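(* Let $1\le p\le\infty$ and $1<q\le\infty$. Let $\alpha:[0,1]\to[0,\infty)$ be a measurable function with $\alpha_0:=\inf_{0\le t\le1}\alpha(t)>\left(\frac1p-\frac1q\right)_+$. Then there is a constant $c>0$ such that for all integers $n\ge1$ $$e_n(R^{\alpha(\cdot)}:L_p[0,1]\to L_q[0,1])\le c\,n^{-\alpha_0}.$$ If $1<q\le p\le\infty$, then for each $b>0$ the constant $c$ may be chosen uniformly for all such $\alpha(\cdot)$ with $\alpha_0\le b$. If $1\le p<q\le\infty$, then for all $a,b$ with $\frac1p-\frac1q<a<b<\infty$ the constant $c$ may be chosen uniformly for all such $\alpha(\cdot)$ with $\alpha_0\in[a,b]$ (in this case $c$ may also depend on $p$ and $q$).
   Context: For a measurable function $\alpha:[0,1]\to[0,\infty)$ with $\alpha(t)>0$ for almost every $t$, the Riemann--Liouville operator of variable order is $$(R^{\alpha(\cdot)}f)(t):=\frac{1}{\Gamma(\alpha(t))}\int_0^t (t-s)^{\alpha(t)-1}f(s)\,ds,\qquad t\in[0,1].$$ For a bounded operator $S$ between Banach spaces $E$ and $F$ with unit balls $B_E$, $B_F$, the $n$-th (dyadic) entropy number is $$e_n(S):=\inf\Big\{\varepsilon>0:\ \exists\,y_1,\dots,y_{2^{n-1}}\in F\ \text{such that}\ S(B_E)\subseteq\bigcup_{j=1}^{2^{n-1}}(y_j+\varepsilon B_F)\Big\}.$$ Here $x_+=\max\{x,0\}$ and $1/\infty=0$. The exponents $p,q$ are fixed; uniformity of constants refers to the function $\alpha(\cdot)$ and to $n$.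 *)

theory Defs
  imports "HOL-Analysis.Analysis" "HOL-Probability.Essential_Supremum"
begin

text \<open>
  Elements of \<open>L\<^sub>p\<close> are represented by functions instead of almost-everywhere equivalence classes,
  so \<open>Lp_norm\<close> is a seminorm on \<open>Lp_space\<close>. Exponents are extended nonnegative reals;
  on \<^typ>\<open>ennreal\<close> one has \<open>1 / \<infinity> = 0\<close>.
\<close>

definition Lp_space :: "'a measure \<Rightarrow> ennreal \<Rightarrow> ('a \<Rightarrow> real) set" where
  "Lp_space M p = {f \<in> borel_measurable M.
     if p = \<infinity> then esssup M (\<lambda>x. ereal \<bar>f x\<bar>) < \<infinity>
     else integrable M (\<lambda>x. \<bar>f x\<bar> powr enn2real p)}"

definition Lp_norm :: "'a measure \<Rightarrow> ennreal \<Rightarrow> ('a \<Rightarrow> real) \<Rightarrow> real" where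
  "Lp_norm M p f =
     (if p = \<infinity> then real_of_ereal (esssup M (\<lambda>x. ereal \<bar>f x\<bar>))
      else (\<integral>x. \<bar>f x\<bar> powr enn2real p \<partial>M) powr (1 / enn2real p))"

definition unit_ball :: "'a set \<Rightarrow> ('a \<Rightarrow> real) \<Rightarrow> 'a set" where
  "unit_ball E N = {x \<in> E. N x \<le> 1}"

text \<open>
  Dyadic entropy numbers of a map \<open>S\<close> from a space \<open>E\<close> with (semi)norm \<open>NE\<close> to a space \<open>F\<close> of
  functions with (semi)norm \<open>NF\<close>, for \<open>n \<ge> 1\<close>. The infimum is taken in the extended reals, so that
  it is \<open>\<infinity>\<close> if no admissible \<open>\<epsilon>\<close> exists. Since the covering sets \<open>y j + \<epsilon> B\<^sub>F\<close> are subsets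
  of \<open>F\<close>, a finite value entails that \<open>S\<close> maps the unit ball of \<open>E\<close> into a bounded subset of \<open>F\<close>.
\<close>

definition entropy_number ::
  "'a set \<Rightarrow> ('a \<Rightarrow> real) \<Rightarrow> ('b \<Rightarrow> real) set \<Rightarrow> (('b \<Rightarrow> real) \<Rightarrow> real) \<Rightarrow>
   ('a \<Rightarrow> 'b \<Rightarrow> real) \<Rightarrow> nat \<Rightarrow> ereal" where
  "entropy_number E NE F NF S n =
     Inf {ereal \<epsilon> | \<epsilon>. \<epsilon> > 0 \<and>
       (\<exists>y :: nat \<Rightarrow> 'b \<Rightarrow> real. (\<forall>j \<in> {1..2 ^ (n - 1)}. y j \<in> F) \<and>
         S ` unit_ball E NE \<subseteq>
           (\<Union>j \<in> {1..2 ^ (n - 1)}. (\<lambda>g t. y j t + \<epsilon> * g t) ` unit_ball F NF))}"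

definition RL_operator :: "(real \<Rightarrow> real) \<Rightarrow> (real \<Rightarrow> real) \<Rightarrow> real \<Rightarrow> real" where
  "RL_operator \<alpha> f t =
     1 / Gamma (\<alpha> t) * (\<integral>s. (t - s) powr (\<alpha> t - 1) * f s \<partial>lebesgue_on {0..t})"

definition RL_entropy :: "ennreal \<Rightarrow> ennreal \<Rightarrow> (real \<Rightarrow> real) \<Rightarrow> nat \<Rightarrow> ereal" where
  "RL_entropy p q \<alpha> n =
     entropy_number
       (Lp_space (lebesgue_on {0..1}) p) (Lp_norm (lebesgue_on {0..1}) p)
       (Lp_space (lebesgue_on {0..1}) q) (Lp_norm (lebesgue_on {0..1}) q)
       (RL_operator \<alpha>) n"

definition inf_order :: "(real \<Rightarrow> real) \<Rightarrow> real" where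
  "inf_order \<alpha> = (INF t\<in>{0..1}. \<alpha> t)"

definition admissible_order :: "ennreal \<Rightarrow> ennreal \<Rightarrow> (real \<Rightarrow> real) \<Rightarrow> bool" where
  "admissible_order p q \<alpha> \<longleftrightarrow>
     \<alpha> \<in> borel_measurable (lebesgue_on {0..1}) \<and> (\<forall>t \<in> {0..1}. 0 \<le> \<alpha> t) \<and>
     inf_order \<alpha> > max (enn2real (1 / p) - enn2real (1 / q)) 0"

end

theory Submission
  imports Defs "HOL-Probability.Probability_Measure"
begin

text \<open>
Write \<open>R\<^sup>b\<close> for the fractional integral of constant order \<open>b\<close>, and let \<open>\<beta> = inf \<alpha>\<close>. At a fixed point
\<open>t\<close>, the semigroup law of constant-order integrals expresses the value of the variable-order integral
of \<open>f\<close> as \<open>(R\<^sup>\<gamma> (R\<^sup>\<beta> f)) t\<close> with \<open>\<gamma> = \<alpha> t - \<beta> \<ge> 0\<close>. Hence the operator of variable order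
factors as \<open>R\<^sup>\<beta>\<close> from \<open>L\<^sub>p\<close> to \<open>L\<^sub>q\<close>, followed by an operator of variable order \<open>\<gamma>\<close> on
\<open>L\<^sub>q\<close>. A fractional integral of any positive order is dominated at every point by a
universal multiple of a one-sided maximal function (\<open>rl_abs_le_maximal\<close>), and the maximal function is bounded on \<open>L\<^sub>q\<close> because \<open>q > 1\<close>
(\<open>maximal_strong_type\<close>). So the second factor costs only a constant that depends on \<open>q\<close> alone
(\<open>entropy_cover_variable_order\<close>), and only the constant order \<open>\<beta>\<close> has to be studied, uniformly
in \<open>\<beta>\<close>.

Coverings of two operators compose, with the numbers of bits adding and the radii multiplying
(\<open>entropy_cover_compose\<close>). Writing an integral of order \<open>2b\<close> as the square of the one of order
\<open>b\<close>, through the exponent midway between \<open>1/p\<close> and \<open>1/q\<close>, doubles the range of admissible orders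
(\<open>uniform_cover_double\<close>), so that orders \<open>b \<le> 1/2\<close> suffice. For those the kernel is decreasing,
and evaluating it only at the left ends of dyadic intervals of length \<open>2\<^sup>-\<^sup>k\<close> changes the integral by
\<open>O(2\<^sup>-\<^sup>b\<^sup>k)\<close> in \<open>L\<^sub>p\<close> (\<open>rl_step_error\<close>). The constant stays bounded as \<open>b\<close> tends to \<open>0\<close>, since the
factor \<open>1/\<Gamma>(b)\<close> compensates the mass \<open>1/b\<close> of the singularity.

The increments between consecutive levels are constant on dyadic cells. Their values are rounded
towards zero to multiples of a mesh that depends on the level, so that the number of possible
results is a number of integer vectors with bounded \<open>l\<^sub>1\<close> norm (\<open>int_vectors_card_dense\<close>,
\<open>int_vectors_card_sparse\<close>). With \<open>x\<close> bits available, the critical level is \<open>\<kappa> = log\<^sub>2 x + O(1)\<close>.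
Below it the mesh is fine, and both the rounding errors and the numbers of bits spent decay
geometrically away from \<open>\<kappa>\<close>. If \<open>q \<le> p\<close>, one reduces to \<open>p = q\<close>, where the levels above \<open>\<kappa>\<close> can
be dropped. If \<open>p < q\<close>, a level above \<open>\<kappa>\<close> is rounded with a coarse mesh that keeps only its few
large values; the rounding error is at most the mesh and at most the increment itself, which makes
it small in \<open>L\<^sub>q\<close> by interpolation (\<open>Lnorm_le_interpolate\<close>), and \<open>b > 1/p - 1/q\<close> makes these
errors decay geometrically too (\<open>rl_cover_small_order\<close>).
\<close>

section \<open>Norm bounds on the unit interval\<close>

abbreviation leb01 :: "real measure" where "leb01 \<equiv> lebesgue_on {0..1}"

interpretation leb01: prob_space leb01
  by (rule prob_spaceI) (simp add: emeasure_restrict_space)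

interpretation leb01_pair: pair_sigma_finite leb01 leb01
  by standard

text \<open>
The convex function \<open>x powr p\<close> lies above its tangent at \<open>m\<close>. The subtracted term of the tangent
is on the right-hand side, so that the inequality can be integrated in \<^typ>\<open>ennreal\<close>.
\<close>

lemma powr_tangent:
  fixes x m p :: real
  assumes "0 \<le> x" "0 \<le> m" "1 \<le> p"
  shows "p * m powr (p - 1) * x \<le> x powr p + (p - 1) * m powr p"
proof (cases "m = 0 \<or> x = 0 \<or> p = 1")
  case True
  then show ?thesis using assms by auto
next
  case False
  then have pos: "m > 0" "x > 0" "p > 1" using assms by auto
  have "x * m powr (p - 1) \<le> x powr p / p + (m powr (p - 1)) powr (p / (p - 1)) / (p / (p - 1))"
    by (rule Youngs_inequality) (use pos in \<open>auto simp: field_simps\<close>)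
  also have "(m powr (p - 1)) powr (p / (p - 1)) = m powr p"
    using pos by (simp add: powr_powr)
  finally have "p * (x * m powr (p - 1)) \<le> p * (x powr p / p + m powr p / (p / (p - 1)))"
    using pos by (intro mult_left_mono) auto
  also have "\<dots> = x powr p + (p - 1) * m powr p"
    using pos by (simp add: field_simps)
  finally show ?thesis by (simp add: mult_ac)
qed

lemma powr_convex_comb:
  fixes x y l p :: real
  assumes "0 \<le> x" "0 \<le> y" "0 \<le> l" "l \<le> 1" "1 \<le> p"
  shows "(l * x + (1 - l) * y) powr p \<le> l * x powr p + (1 - l) * y powr p"
proof -
  define m where "m = l * x + (1 - l) * y"
  have m: "m \<ge> 0" using assms by (simp add: m_def)
  have "l * (p * m powr (p - 1) * x) + (1 - l) * (p * m powr (p - 1) * y)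
      \<le> l * (x powr p + (p - 1) * m powr p) + (1 - l) * (y powr p + (p - 1) * m powr p)"
    by (intro add_mono mult_left_mono powr_tangent) (use assms m in auto)
  moreover have "l * (p * m powr (p - 1) * x) + (1 - l) * (p * m powr (p - 1) * y) = p * m powr p"
  proof -
    have "l * (p * m powr (p - 1) * x) + (1 - l) * (p * m powr (p - 1) * y) = p * (m powr (p - 1) * m)"
      by (simp add: m_def algebra_simps)
    also have "m powr (p - 1) * m = m powr p"
      using m powr_mult_base[of m "p - 1"] by (simp add: mult.commute)
    finally show ?thesis .
  qed
  ultimately show ?thesis unfolding m_def[symmetric] by (simp add: algebra_simps)
qed

text \<open>
Jensen's inequality for a weight of total mass at most one. Bounding the mean from below by a real
number \<open>r\<close>, at which the tangent is then taken, avoids a separate treatment of infinite integrals.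
\<close>

lemma nn_integral_jensen_powr:
  fixes x :: "'a \<Rightarrow> real" and w :: "'a \<Rightarrow> ennreal"
  assumes [measurable]: "x \<in> borel_measurable M" "w \<in> borel_measurable M"
    and x0: "\<And>s. 0 \<le> x s" and w1: "(\<integral>\<^sup>+s. w s \<partial>M) \<le> 1" and p: "1 \<le> p" and r: "0 \<le> r"
    and le: "ennreal r \<le> (\<integral>\<^sup>+s. w s * ennreal (x s) \<partial>M)"
  shows "ennreal (r powr p) \<le> (\<integral>\<^sup>+s. w s * ennreal (x s powr p) \<partial>M)"
proof -
  let ?J = "\<integral>\<^sup>+s. w s * ennreal (x s powr p) \<partial>M"
  define a where "a = p * r powr (p - 1)"
  define b where "b = (p - 1) * r powr p"
  have ab: "a \<ge> 0" "b \<ge> 0" using p by (auto simp: a_def b_def)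
  have "ennreal (p * r powr p) = ennreal a * ennreal r"
    using powr_mult_base[of r "p - 1"] r p
    by (simp add: a_def ennreal_mult[symmetric] mult_ac)
  also have "\<dots> \<le> ennreal a * (\<integral>\<^sup>+s. w s * ennreal (x s) \<partial>M)"
    by (intro mult_left_mono le) auto
  also have "\<dots> = (\<integral>\<^sup>+s. w s * ennreal (a * x s) \<partial>M)"
    by (subst nn_integral_cmult[symmetric])
       (auto simp: ennreal_mult ab x0 mult_ac intro!: nn_integral_cong)
  also have "\<dots> \<le> (\<integral>\<^sup>+s. w s * ennreal (x s powr p) + ennreal b * w s \<partial>M)"
  proof (intro nn_integral_mono)
    fix s
    have "ennreal (a * x s) \<le> ennreal (x s powr p + b)"
      unfolding a_def b_def using powr_tangent[OF x0 r p] by (intro ennreal_leI) auto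
    also have "\<dots> = ennreal (x s powr p) + ennreal b" using ab by simp
    finally have "w s * ennreal (a * x s) \<le> w s * (ennreal (x s powr p) + ennreal b)"
      by (intro mult_left_mono) auto
    then show "w s * ennreal (a * x s) \<le> w s * ennreal (x s powr p) + ennreal b * w s"
      by (simp add: algebra_simps)
  qed
  also have "\<dots> = ?J + ennreal b * (\<integral>\<^sup>+s. w s \<partial>M)"
    by (simp add: nn_integral_add nn_integral_cmult)
  also have "\<dots> \<le> ?J + ennreal b * 1"
    by (intro add_left_mono mult_left_mono w1) auto
  finally have *: "ennreal (p * r powr p) \<le> ?J + ennreal b" by simp
  have "ennreal (p * r powr p) = ennreal (r powr p) + ennreal b"
    using ab p unfolding b_def by (subst ennreal_plus[symmetric]) (auto simp: algebra_simps)
  with * show ?thesis by (simp add: ennreal_add_left_cancel_le add.commute[of _ "ennreal b"])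
qed

text \<open>
The bound \<open>c\<close> on the norm in \<open>L\<^sub>p\<close>, in terms of \<open>u = 1 / p\<close>, so that \<open>u = 0\<close> is the exponent
\<open>\<infinity>\<close> and the exponents between \<open>p\<close> and \<open>q\<close> are averages of real numbers. Dividing by \<open>c\<close> inside
the power turns every norm inequality for \<open>c > 0\<close> into a pointwise inequality followed by
integration, without roots of integrals.
\<close>

definition Lnorm_le :: "real \<Rightarrow> (real \<Rightarrow> real) \<Rightarrow> real \<Rightarrow> bool" where
  "Lnorm_le u f c \<longleftrightarrow> f \<in> borel_measurable leb01 \<and>
     (if u = 0 then AE t in leb01. \<bar>f t\<bar> \<le> c
      else (\<integral>\<^sup>+t. ennreal ((\<bar>f t\<bar> / c) powr (1 / u)) \<partial>leb01) \<le> 1)"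

lemma Lnorm_le_measurable: "Lnorm_le u f c \<Longrightarrow> f \<in> borel_measurable leb01"
  by (simp add: Lnorm_le_def)

lemma Lnorm_le_dominated:
  assumes f: "Lnorm_le u f c" and [measurable]: "g \<in> borel_measurable leb01"
    and le: "AE t in leb01. \<bar>g t\<bar> \<le> k * \<bar>f t\<bar>" and pos: "0 < k" "0 < c" "0 \<le> u"
  shows "Lnorm_le u g (k * c)"
proof (cases "u = 0")
  case True
  from f True have "AE t in leb01. \<bar>f t\<bar> \<le> c" by (simp add: Lnorm_le_def)
  with le have "AE t in leb01. \<bar>g t\<bar> \<le> k * c"
    by eventually_elim (use pos in \<open>auto intro: order_trans mult_left_mono\<close>)
  with True show ?thesis by (simp add: Lnorm_le_def)
next
  case False
  have "(\<integral>\<^sup>+t. ennreal ((\<bar>g t\<bar> / (k * c)) powr (1 / u)) \<partial>leb01)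
      \<le> (\<integral>\<^sup>+t. ennreal ((\<bar>f t\<bar> / c) powr (1 / u)) \<partial>leb01)"
  proof (intro nn_integral_mono_AE, use le in eventually_elim)
    case (elim t)
    then have "\<bar>g t\<bar> / (k * c) \<le> \<bar>f t\<bar> / c" using pos by (simp add: field_simps)
    then show ?case using pos by (intro ennreal_leI powr_mono2) auto
  qed
  also have "\<dots> \<le> 1" using f False by (simp add: Lnorm_le_def)
  finally show ?thesis using False by (simp add: Lnorm_le_def)
qed

lemma Lnorm_le_mono:
  assumes "Lnorm_le u f c" "c \<le> d" "0 < c" "0 \<le> u"
  shows "Lnorm_le u f d"
proof -
  have "Lnorm_le u f (d / c * c)"
    by (rule Lnorm_le_dominated[OF assms(1)])
       (use assms in \<open>auto simp: Lnorm_le_measurable field_simps mult_right_mono\<close>)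
  then show ?thesis using assms by simp
qed

lemma Lnorm_le_const:
  assumes [measurable]: "g \<in> borel_measurable leb01" and le: "AE t in leb01. \<bar>g t\<bar> \<le> c"
    and "0 < c" "0 \<le> u"
  shows "Lnorm_le u g c"
proof (cases "u = 0")
  case True
  then show ?thesis using assms by (simp add: Lnorm_le_def)
next
  case False
  have "(\<integral>\<^sup>+t. ennreal ((\<bar>g t\<bar> / c) powr (1 / u)) \<partial>leb01) \<le> (\<integral>\<^sup>+t. 1 \<partial>leb01)"
  proof (intro nn_integral_mono_AE, use le in eventually_elim)
    case (elim t)
    then have "(\<bar>g t\<bar> / c) powr (1 / u) \<le> 1 powr (1 / u)"
      using assms by (intro powr_mono2) auto
    then show ?case by simp
  qed
  also have "\<dots> = 1" by (simp add: leb01.emeasure_space_1[simplified])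
  finally show ?thesis using False by (simp add: Lnorm_le_def)
qed

text \<open>
After normalization, Minkowski's inequality is convexity of the power, with weights \<open>c / (c + d)\<close>
and \<open>d / (c + d)\<close>.
\<close>

lemma Lnorm_le_add:
  assumes f: "Lnorm_le u f c" and g: "Lnorm_le u g d" and pos: "0 < c" "0 < d" and u: "0 \<le> u" "u \<le> 1"
  shows "Lnorm_le u (\<lambda>t. f t + g t) (c + d)"
proof -
  have [measurable]: "f \<in> borel_measurable leb01" "g \<in> borel_measurable leb01"
    using f g by (auto simp: Lnorm_le_def)
  show ?thesis
  proof (cases "u = 0")
    case True
    then have "AE t in leb01. \<bar>f t\<bar> \<le> c" "AE t in leb01. \<bar>g t\<bar> \<le> d"
      using f g by (auto simp: Lnorm_le_def)
    then have "AE t in leb01. \<bar>f t + g t\<bar> \<le> c + d" by eventually_elim auto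
    then show ?thesis using True by (simp add: Lnorm_le_def)
  next
    case False
    define l where "l = c / (c + d)"
    have l: "0 \<le> l" "l \<le> 1" "1 - l = d / (c + d)" using pos by (auto simp: l_def field_simps)
    have "(\<integral>\<^sup>+t. ennreal ((\<bar>f t + g t\<bar> / (c + d)) powr (1 / u)) \<partial>leb01)
       \<le> (\<integral>\<^sup>+t. ennreal l * ennreal ((\<bar>f t\<bar> / c) powr (1 / u))
              + ennreal (1 - l) * ennreal ((\<bar>g t\<bar> / d) powr (1 / u)) \<partial>leb01)"
    proof (intro nn_integral_mono)
      fix t
      have "\<bar>f t + g t\<bar> / (c + d) \<le> l * (\<bar>f t\<bar> / c) + (1 - l) * (\<bar>g t\<bar> / d)"
        using pos unfolding l by (simp add: l_def add_divide_distrib[symmetric] divide_right_mono)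
      then have "(\<bar>f t + g t\<bar> / (c + d)) powr (1 / u) \<le> (l * (\<bar>f t\<bar> / c) + (1 - l) * (\<bar>g t\<bar> / d)) powr (1 / u)"
        using pos u by (intro powr_mono2) auto
      also have "\<dots> \<le> l * (\<bar>f t\<bar> / c) powr (1 / u) + (1 - l) * (\<bar>g t\<bar> / d) powr (1 / u)"
        using pos u False l by (intro powr_convex_comb) auto
      finally show "ennreal ((\<bar>f t + g t\<bar> / (c + d)) powr (1 / u))
        \<le> ennreal l * ennreal ((\<bar>f t\<bar> / c) powr (1 / u)) + ennreal (1 - l) * ennreal ((\<bar>g t\<bar> / d) powr (1 / u))"
        using l(1,2) by (simp add: ennreal_mult[symmetric] ennreal_plus[symmetric] ennreal_leI del: ennreal_plus)
    qed
    also have "\<dots> = ennreal l * (\<integral>\<^sup>+t. ennreal ((\<bar>f t\<bar> / c) powr (1 / u)) \<partial>leb01)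
              + ennreal (1 - l) * (\<integral>\<^sup>+t. ennreal ((\<bar>g t\<bar> / d) powr (1 / u)) \<partial>leb01)"
      by (simp add: nn_integral_add nn_integral_cmult)
    also have "\<dots> \<le> ennreal l * 1 + ennreal (1 - l) * 1"
      using f g False by (intro add_mono mult_left_mono) (auto simp: Lnorm_le_def)
    also have "\<dots> = 1" using l by (simp add: ennreal_plus[symmetric] del: ennreal_plus)
    finally show ?thesis using False by (simp add: Lnorm_le_def)
  qed
qed

lemma Lnorm_le_sum:
  assumes "finite A" "A \<noteq> {}" "\<And>k. k \<in> A \<Longrightarrow> Lnorm_le u (f k) (c k)" "\<And>k. k \<in> A \<Longrightarrow> 0 < c k"
    "0 \<le> u" "u \<le> 1"
  shows "Lnorm_le u (\<lambda>t. \<Sum>k\<in>A. f k t) (\<Sum>k\<in>A. c k)"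
  using assms(1-4)
proof (induction A rule: finite_ne_induct)
  case (singleton k)
  then show ?case by simp
next
  case (insert k A)
  then show ?case using assms(5,6) by (auto intro!: Lnorm_le_add sum_pos)
qed

text \<open>
On a probability space the norm grows with the exponent. The tangent of the power at \<open>1\<close> replaces
Hoelder's inequality, because \<open>f\<close> is normalized by the same \<open>c\<close> on both sides.
\<close>

lemma Lnorm_le_inclusion:
  assumes f: "Lnorm_le u f c" and "0 \<le> u" "u \<le> v" "0 < c"
  shows "Lnorm_le v f c"
proof (cases "u = 0")
  case True
  then show ?thesis using f assms by (intro Lnorm_le_const) (auto simp: Lnorm_le_def)
next
  case False
  have [measurable]: "f \<in> borel_measurable leb01" using f by (simp add: Lnorm_le_def)
  define a where "a = v / u"
  have a: "a \<ge> 1" using False assms by (simp add: a_def)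
  have v: "v > 0" using False assms by simp
  have "(\<integral>\<^sup>+t. ennreal ((\<bar>f t\<bar> / c) powr (1 / v)) \<partial>leb01)
      \<le> (\<integral>\<^sup>+t. ennreal (1 / a) * ennreal ((\<bar>f t\<bar> / c) powr (1 / u)) + ennreal (1 - 1 / a) \<partial>leb01)"
  proof (intro nn_integral_mono)
    fix t
    define y where "y = (\<bar>f t\<bar> / c) powr (1 / v)"
    have "a * 1 powr (a - 1) * y \<le> y powr a + (a - 1) * 1 powr a"
      by (rule powr_tangent) (use a in \<open>auto simp: y_def\<close>)
    moreover have "y powr a = (\<bar>f t\<bar> / c) powr (1 / u)"
      using v by (simp add: y_def powr_powr a_def)
    ultimately have "a * y \<le> (\<bar>f t\<bar> / c) powr (1 / u) + (a - 1)"
      by simp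
    then have "y \<le> ((\<bar>f t\<bar> / c) powr (1 / u) + (a - 1)) / a"
      using a by (simp add: pos_le_divide_eq mult.commute)
    also have "\<dots> = 1 / a * (\<bar>f t\<bar> / c) powr (1 / u) + (1 - 1 / a)"
      using a by (simp add: field_simps)
    finally have "y \<le> 1 / a * (\<bar>f t\<bar> / c) powr (1 / u) + (1 - 1 / a)" .
    then have "ennreal y \<le> ennreal (1 / a * (\<bar>f t\<bar> / c) powr (1 / u) + (1 - 1 / a))"
      by (rule ennreal_leI)
    also have "\<dots> = ennreal (1 / a) * ennreal ((\<bar>f t\<bar> / c) powr (1 / u)) + ennreal (1 - 1 / a)"
      using a by (subst ennreal_plus) (auto simp: ennreal_mult[symmetric])
    finally show "ennreal ((\<bar>f t\<bar> / c) powr (1 / v)) \<le> ennreal (1 / a) * ennreal ((\<bar>f t\<bar> / c) powr (1 / u)) + ennreal (1 - 1 / a)"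
      by (simp add: y_def)
  qed
  also have "\<dots> = ennreal (1 / a) * (\<integral>\<^sup>+t. ennreal ((\<bar>f t\<bar> / c) powr (1 / u)) \<partial>leb01) + ennreal (1 - 1 / a)"
    by (simp add: nn_integral_add nn_integral_cmult leb01.emeasure_space_1[simplified])
  also have "\<dots> \<le> ennreal (1 / a) * 1 + ennreal (1 - 1 / a)"
    using f False by (intro add_mono mult_left_mono) (auto simp: Lnorm_le_def)
  also have "\<dots> = 1" using a by (simp add: ennreal_plus[symmetric] del: ennreal_plus)
  finally show ?thesis using v by (simp add: Lnorm_le_def)
qed

text \<open>
The gain in the passage from \<open>L\<^sub>p\<close> to \<open>L\<^sub>q\<close>: where \<open>g\<close> is at most \<open>d\<close> and at most \<open>f\<close>, the factor
\<open>\<bar>g\<bar> powr (1 - p / q)\<close> is paid by \<open>d\<close> and the rest by the norm of \<open>f\<close>.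
\<close>

lemma Lnorm_le_interpolate:
  assumes f: "Lnorm_le u f c" and [measurable]: "g \<in> borel_measurable leb01"
    and gf: "AE t in leb01. \<bar>g t\<bar> \<le> \<bar>f t\<bar>" and gd: "AE t in leb01. \<bar>g t\<bar> \<le> d"
    and pos: "0 < c" "0 < d" and uv: "0 \<le> v" "v < u"
  shows "Lnorm_le v g (d powr (1 - v / u) * c powr (v / u))"
proof (cases "v = 0")
  case True
  then show ?thesis using gd pos by (simp add: Lnorm_le_def)
next
  case False
  define e where "e = d powr (1 - v / u) * c powr (v / u)"
  have "(\<integral>\<^sup>+t. ennreal ((\<bar>g t\<bar> / e) powr (1 / v)) \<partial>leb01)
      \<le> (\<integral>\<^sup>+t. ennreal ((\<bar>f t\<bar> / c) powr (1 / u)) \<partial>leb01)"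
  proof (intro nn_integral_mono_AE, use gf gd in eventually_elim)
    case (elim t)
    show ?case
    proof (cases "g t = 0")
      case False
      define x where "x = \<bar>g t\<bar>"
      have x: "0 < x" using False by (simp add: x_def)
      have "x = x powr (1 - v / u) * x powr (v / u)" using x by (simp add: powr_add[symmetric])
      then have "x / e = (x / d) powr (1 - v / u) * (x / c) powr (v / u)"
        unfolding e_def using pos x by (simp add: powr_divide)
      also have "\<dots> \<le> 1 * (x / c) powr (v / u)"
        using elim pos x uv by (intro mult_right_mono powr_le1) (auto simp: x_def field_simps)
      also have "\<dots> \<le> (\<bar>f t\<bar> / c) powr (v / u)"
        using elim pos x uv by (auto simp: x_def intro!: powr_mono2 divide_right_mono)
      finally have "(x / e) powr (1 / v) \<le> ((\<bar>f t\<bar> / c) powr (v / u)) powr (1 / v)"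
        using uv x pos by (intro powr_mono2) (auto simp: e_def)
      also have "\<dots> = (\<bar>f t\<bar> / c) powr (1 / u)"
        using \<open>v \<noteq> 0\<close> by (simp add: powr_powr)
      finally show ?thesis by (simp add: x_def ennreal_leI)
    qed auto
  qed
  also have "\<dots> \<le> 1" using f uv by (auto simp: Lnorm_le_def)
  finally show ?thesis using False by (simp add: Lnorm_le_def e_def)
qed

lemma Lnorm_le_AE_limit:
  assumes e: "\<And>n. Lnorm_le v (e n) c" and [measurable]: "r \<in> borel_measurable leb01"
    and lim: "AE t in leb01. (\<lambda>n. e n t) \<longlonglongrightarrow> r t" and c: "0 < c" and v: "0 \<le> v"
  shows "Lnorm_le v r c"
proof (cases "v = 0")
  case True
  then have "AE t in leb01. \<forall>n. \<bar>e n t\<bar> \<le> c" using e by (auto simp: Lnorm_le_def AE_all_countable)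
  with lim have "AE t in leb01. \<bar>r t\<bar> \<le> c"
  proof eventually_elim
    case (elim t)
    show ?case
      by (rule LIMSEQ_le_const2[OF tendsto_rabs[OF elim(1)]]) (use elim in auto)
  qed
  then show ?thesis using True by (simp add: Lnorm_le_def)
next
  case False
  have [measurable]: "e n \<in> borel_measurable leb01" for n using e by (auto simp: Lnorm_le_def)
  have "(\<integral>\<^sup>+t. ennreal ((\<bar>r t\<bar> / c) powr (1 / v)) \<partial>leb01)
     \<le> (\<integral>\<^sup>+t. liminf (\<lambda>n. ennreal ((\<bar>e n t\<bar> / c) powr (1 / v))) \<partial>leb01)"
  proof (intro nn_integral_mono_AE, use lim in eventually_elim)
    case (elim t)
    have "(\<lambda>n. ennreal ((\<bar>e n t\<bar> / c) powr (1 / v))) \<longlonglongrightarrow> ennreal ((\<bar>r t\<bar> / c) powr (1 / v))"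
      using False v c by (intro tendsto_ennrealI tendsto_powr2 tendsto_intros elim) auto
    from lim_imp_Liminf[OF _ this] show ?case by simp
  qed
  also have "\<dots> \<le> liminf (\<lambda>n. \<integral>\<^sup>+t. ennreal ((\<bar>e n t\<bar> / c) powr (1 / v)) \<partial>leb01)"
    by (intro nn_integral_liminf) auto
  also have "\<dots> \<le> liminf (\<lambda>n. 1)"
    using e False by (intro Liminf_mono) (auto simp: Lnorm_le_def)
  finally show ?thesis using False by (simp add: Lnorm_le_def Liminf_const)
qed

lemma Lnorm_le_integral:
  assumes "Lnorm_le 1 f c" "0 < c"
  shows "(\<integral>\<^sup>+t. ennreal \<bar>f t\<bar> \<partial>leb01) \<le> ennreal c"
proof -
  have [measurable]: "f \<in> borel_measurable leb01" using assms by (simp add: Lnorm_le_def)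
  have "(\<integral>\<^sup>+s. ennreal \<bar>f s\<bar> \<partial>leb01) = (\<integral>\<^sup>+s. ennreal c * ennreal ((\<bar>f s\<bar> / c) powr (1 / 1)) \<partial>leb01)"
    using assms by (intro nn_integral_cong) (simp add: ennreal_mult[symmetric])
  also have "\<dots> = ennreal c * (\<integral>\<^sup>+s. ennreal ((\<bar>f s\<bar> / c) powr (1 / 1)) \<partial>leb01)"
    by (intro nn_integral_cmult) measurable
  also have "\<dots> \<le> ennreal c * 1" using assms by (intro mult_left_mono) (auto simp: Lnorm_le_def)
  finally show ?thesis by simp
qed

lemma Lnorm_le_integrable:
  assumes f: "Lnorm_le u f c" and c: "0 < c" and u: "0 \<le> u" "u \<le> 1"
  shows "integrable leb01 f"
proof (rule integrableI_bounded)
  show "f \<in> borel_measurable leb01" using f by (rule Lnorm_le_measurable)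
  have "(\<integral>\<^sup>+t. ennreal (norm (f t)) \<partial>leb01) \<le> ennreal c"
    using Lnorm_le_integral[OF Lnorm_le_inclusion[OF f u c] c] by simp
  then show "(\<integral>\<^sup>+t. ennreal (norm (f t)) \<partial>leb01) < \<infinity>"
    by (rule le_less_trans) simp
qed

lemma AE_leb01_lt_1: "AE t in leb01. 0 \<le> t \<and> t < 1"
proof -
  have "AE t in leb01. t \<noteq> 1"
    by (subst AE_restrict_space_iff) (auto intro!: AE_I'[of "{1}"])
  then show ?thesis using AE_space by eventually_elim auto
qed

section \<open>Fractional integrals and their semigroup property\<close>

lemma leb01_pair_fst_measurable [measurable]: "fst \<in> borel_measurable (leb01 \<Otimes>\<^sub>M leb01)"
  using measurable_compose[OF measurable_fst id_borel_measurable_lebesgue_on[of "{0..1::real}"], of leb01]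
  by (simp add: o_def id_def)

lemma leb01_pair_snd_measurable [measurable]: "snd \<in> borel_measurable (leb01 \<Otimes>\<^sub>M leb01)"
  using measurable_compose[OF measurable_snd id_borel_measurable_lebesgue_on[of "{0..1::real}"], of leb01]
  by (simp add: o_def id_def)

lemma leb01_ident_measurable [measurable (raw)]: "(\<lambda>t. t) \<in> borel_measurable leb01"
  using id_borel_measurable_lebesgue_on[of "{0..1::real}"] by (simp add: id_def)

lemma nn_integral_leb01:
  assumes [measurable]: "g \<in> borel_measurable borel"
  shows "(\<integral>\<^sup>+s. g s \<partial>leb01) = (\<integral>\<^sup>+s. g s * indicator {0..1} s \<partial>lborel)"
  by (subst nn_integral_restrict_space) (auto simp: nn_integral_completion)

lemma nn_integral_leb01_le:
  assumes [measurable]: "g \<in> borel_measurable borel"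
  shows "(\<integral>\<^sup>+s. g s \<partial>leb01) \<le> (\<integral>\<^sup>+s. g s \<partial>lborel)"
  unfolding nn_integral_leb01[OF assms]
  by (intro nn_integral_mono) (auto split: split_indicator)

lemma nn_integral_reflect:
  assumes [measurable]: "E \<in> borel_measurable borel"
  shows "(\<integral>\<^sup>+s. E (t - s) \<partial>leb01) \<le> (\<integral>\<^sup>+x. E x \<partial>lborel)"
proof -
  have "(\<integral>\<^sup>+s. E (t - s) \<partial>leb01) \<le> (\<integral>\<^sup>+s. E (t - s) \<partial>lborel)"
    by (intro nn_integral_leb01_le) measurable
  also have "\<dots> = (\<integral>\<^sup>+x. E x \<partial>lborel)"
    using nn_integral_real_affine[of E "-1" t] by simp
  finally show ?thesis .
qed

lemma nn_integral_translate:
  assumes [measurable]: "E \<in> borel_measurable borel"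
  shows "(\<integral>\<^sup>+t. E (t - s) \<partial>leb01) \<le> (\<integral>\<^sup>+x. E x \<partial>lborel)"
proof -
  have "(\<integral>\<^sup>+t. E (t - s) \<partial>leb01) \<le> (\<integral>\<^sup>+t. E (t - s) \<partial>lborel)"
    by (intro nn_integral_leb01_le) measurable
  also have "\<dots> = (\<integral>\<^sup>+x. E x \<partial>lborel)"
    using nn_integral_real_affine[of E 1 "-s"] by simp
  finally show ?thesis .
qed

text \<open>
Young's inequality for convolution with an integrable kernel, by Jensen's inequality for each \<open>t\<close>
and Tonelli's theorem. The pointwise hypothesis on \<open>r\<close> only bounds its modulus, so that \<open>r\<close> may be an
integral with cancellation.
\<close>

lemma Lnorm_le_convolution:
  fixes E :: "real \<Rightarrow> real"
  assumes f: "Lnorm_le u f c" and [measurable]: "E \<in> borel_measurable borel" "r \<in> borel_measurable leb01"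
    and E0: "\<And>x. 0 \<le> E x" and EA: "(\<integral>\<^sup>+x. ennreal (E x) \<partial>lborel) \<le> ennreal A"
    and r: "AE t in leb01. ennreal \<bar>r t\<bar> \<le> (\<integral>\<^sup>+s. ennreal (E (t - s)) * ennreal \<bar>f s\<bar> \<partial>leb01)"
    and pos: "0 < A" "0 < c" and u: "0 \<le> u" "u \<le> 1"
  shows "Lnorm_le u r (A * c)"
proof -
  have [measurable]: "f \<in> borel_measurable leb01" using f by (rule Lnorm_le_measurable)
  have s_int: "(\<integral>\<^sup>+s. ennreal (E (t - s)) \<partial>leb01) \<le> ennreal A" for t
    using nn_integral_reflect[of "\<lambda>x. ennreal (E x)" t] EA by simp
  have t_int: "(\<integral>\<^sup>+t. ennreal (E (t - s)) \<partial>leb01) \<le> ennreal A" for s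
    using nn_integral_translate[of "\<lambda>x. ennreal (E x)" s] EA by simp
  show ?thesis
  proof (cases "u = 0")
    case True
    then have fc: "AE s in leb01. \<bar>f s\<bar> \<le> c" using f by (simp add: Lnorm_le_def)
    from r have "AE t in leb01. \<bar>r t\<bar> \<le> A * c"
    proof eventually_elim
      case (elim t)
      also have "(\<integral>\<^sup>+s. ennreal (E (t - s)) * ennreal \<bar>f s\<bar> \<partial>leb01) \<le> (\<integral>\<^sup>+s. ennreal (E (t - s)) * ennreal c \<partial>leb01)"
        by (intro nn_integral_mono_AE, use fc in eventually_elim) (auto intro!: mult_left_mono ennreal_leI)
      also have "\<dots> = (\<integral>\<^sup>+s. ennreal (E (t - s)) \<partial>leb01) * ennreal c"
        by (intro nn_integral_multc) measurable
      also have "\<dots> \<le> ennreal A * ennreal c" by (intro mult_right_mono s_int) auto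
      also have "\<dots> = ennreal (A * c)" using pos by (simp add: ennreal_mult)
      finally show ?case using pos by (simp add: ennreal_le_iff)
    qed
    then show ?thesis using True by (simp add: Lnorm_le_def)
  next
    case False
    define p where "p = 1 / u"
    have p: "p \<ge> 1" using u False by (simp add: p_def)
    define w where "w = (\<lambda>x. ennreal (1 / A) * ennreal (E x))"
    have [measurable]: "w \<in> borel_measurable borel" unfolding w_def by measurable
    have w_int: "(\<integral>\<^sup>+s. w (\<phi> s) \<partial>leb01) \<le> 1"
      if [measurable]: "\<phi> \<in> borel_measurable leb01" and "(\<integral>\<^sup>+s. ennreal (E (\<phi> s)) \<partial>leb01) \<le> ennreal A" for \<phi>
    proof -
      have "(\<integral>\<^sup>+s. w (\<phi> s) \<partial>leb01) = ennreal (1 / A) * (\<integral>\<^sup>+s. ennreal (E (\<phi> s)) \<partial>leb01)"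
        unfolding w_def by (intro nn_integral_cmult) measurable
      also have "\<dots> \<le> ennreal (1 / A) * ennreal A" by (intro mult_left_mono that) auto
      also have "\<dots> = 1" using pos by (simp add: ennreal_mult[symmetric])
      finally show ?thesis .
    qed
    have ws: "(\<integral>\<^sup>+s. w (t - s) \<partial>leb01) \<le> 1" for t by (rule w_int[OF _ s_int]) measurable
    have wt: "(\<integral>\<^sup>+t. w (t - s) \<partial>leb01) \<le> 1" for s by (rule w_int[OF _ t_int]) measurable
    let ?x = "\<lambda>s. \<bar>f s\<bar> / c"
    from r have pw: "AE t in leb01. ennreal ((\<bar>r t\<bar> / (A * c)) powr p) \<le> (\<integral>\<^sup>+s. w (t - s) * ennreal (?x s powr p) \<partial>leb01)"
    proof eventually_elim
      case (elim t)
      have "ennreal (\<bar>r t\<bar> / (A * c)) = ennreal (1 / (A * c)) * ennreal \<bar>r t\<bar>"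
        using pos by (simp add: ennreal_mult[symmetric])
      also have "\<dots> \<le> ennreal (1 / (A * c)) * (\<integral>\<^sup>+s. ennreal (E (t - s)) * ennreal \<bar>f s\<bar> \<partial>leb01)"
        by (intro mult_left_mono elim) auto
      also have "\<dots> = (\<integral>\<^sup>+s. ennreal (1 / (A * c)) * (ennreal (E (t - s)) * ennreal \<bar>f s\<bar>) \<partial>leb01)"
        by (intro nn_integral_cmult[symmetric]) measurable
      also have "\<dots> = (\<integral>\<^sup>+s. w (t - s) * ennreal (?x s) \<partial>leb01)"
        using pos E0 unfolding w_def
        by (intro nn_integral_cong) (simp add: ennreal_mult[symmetric])
      finally show ?case
        by (intro nn_integral_jensen_powr ws p) (use pos in auto)
    qed
    have "(\<integral>\<^sup>+t. ennreal ((\<bar>r t\<bar> / (A * c)) powr p) \<partial>leb01)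
       \<le> (\<integral>\<^sup>+t. (\<integral>\<^sup>+s. w (t - s) * ennreal (?x s powr p) \<partial>leb01) \<partial>leb01)"
      by (intro nn_integral_mono_AE pw)
    also have "\<dots> = (\<integral>\<^sup>+s. (\<integral>\<^sup>+t. w (t - s) * ennreal (?x s powr p) \<partial>leb01) \<partial>leb01)"
      by (rule leb01_pair.Fubini') measurable
    also have "\<dots> = (\<integral>\<^sup>+s. (\<integral>\<^sup>+t. w (t - s) \<partial>leb01) * ennreal (?x s powr p) \<partial>leb01)"
      by (intro nn_integral_cong nn_integral_multc) measurable
    also have "\<dots> \<le> (\<integral>\<^sup>+s. 1 * ennreal (?x s powr p) \<partial>leb01)"
      by (intro nn_integral_mono mult_right_mono wt) auto
    also have "\<dots> \<le> 1" using f False by (simp add: Lnorm_le_def p_def)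
    finally show ?thesis using False by (simp add: Lnorm_le_def p_def)
  qed
qed

text \<open>
Points of the unit interval have distance at most one, so cutting the kernel off at \<open>1\<close> leaves the
operator unchanged there. Since \<^const>\<open>rGamma\<close> is the entire function \<open>1 / \<Gamma>\<close>, the kernel is
measurable also in the order \<open>b\<close>.
\<close>

definition rl_kernel :: "real \<Rightarrow> real \<Rightarrow> real" where
  "rl_kernel b x = (if 0 < x \<and> x \<le> 1 then rGamma b * x powr (b - 1) else 0)"

definition rl :: "real \<Rightarrow> (real \<Rightarrow> real) \<Rightarrow> real \<Rightarrow> real" where
  "rl b f t = (\<integral>s. rl_kernel b (t - s) * f s \<partial>leb01)"

definition rGamma_sup :: real where
  "rGamma_sup = (SUP x\<in>{1..}. rGamma x)"

lemma rGamma_pos: "0 < x \<Longrightarrow> 0 < rGamma (x::real)"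
  by (simp add: rGamma_inverse_Gamma Gamma_real_pos)

lemma rGamma_succ: "0 < x \<Longrightarrow> rGamma x = x * rGamma (x + 1)" for x :: real
  by (rule rGamma_plus1[symmetric])

text \<open>
The recursion \<open>\<Gamma>(x + 1) = x \<Gamma>(x)\<close> makes \<open>1 / \<Gamma>\<close> decrease under unit steps to the right of \<open>1\<close>, so
that its bound on the compact interval from \<open>1\<close> to \<open>2\<close> propagates.
\<close>

lemma rGamma_bdd_above: "bdd_above (rGamma ` {1::real..})"
proof -
  have "bdd_above (rGamma ` {1..2::real})"
    by (intro bounded_imp_bdd_above compact_imp_bounded compact_continuous_image
          continuous_on_rGamma compact_Icc)
  then obtain G where "\<forall>y\<in>rGamma ` {1..2::real}. y \<le> G"
    unfolding bdd_above_def by (elim exE)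
  then have G: "rGamma x \<le> G" if "x \<in> {1..2}" for x :: real
    using that by blast
  have *: "\<forall>x. 1 \<le> x \<and> x \<le> 2 + real n \<longrightarrow> rGamma x \<le> G" for n
  proof (induction n)
    case 0
    show ?case by (intro allI impI G) simp
  next
    case (Suc n)
    show ?case
    proof (intro allI impI)
      fix x :: real assume x: "1 \<le> x \<and> x \<le> 2 + real (Suc n)"
      show "rGamma x \<le> G"
      proof (cases "x \<le> 2")
        case True
        then show ?thesis by (intro G) (use x in simp)
      next
        case False
        have "1 * rGamma x \<le> (x - 1) * rGamma x"
          using False rGamma_pos[of x] by (intro mult_right_mono) auto
        also have "\<dots> = rGamma (x - 1)" using rGamma_plus1[of "x - 1"] by (simp only: diff_add_cancel)
        also have "\<dots> \<le> G" by (rule Suc.IH[rule_format]) (use False x in simp)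
        finally show ?thesis by simp
      qed
    qed
  qed
  have "rGamma x \<le> G" if x: "1 \<le> x" for x :: real
  proof -
    obtain n :: nat where "x \<le> real n" using real_arch_simple by blast
    then have "x \<le> 2 + real n" by linarith
    then show ?thesis using * x by blast
  qed
  then show ?thesis by (intro bdd_aboveI2[of _ _ G]) simp
qed

lemma rGamma_le_sup: "1 \<le> x \<Longrightarrow> rGamma x \<le> rGamma_sup"
  unfolding rGamma_sup_def by (intro cSUP_upper rGamma_bdd_above) auto

lemma rGamma_sup_ge_1: "1 \<le> rGamma_sup"
  using rGamma_le_sup[of 1] by simp

lemma rl_kernel_nonneg: "0 < b \<Longrightarrow> 0 \<le> rl_kernel b x"
  using rGamma_pos[of b] by (auto simp: rl_kernel_def)

lemma rGamma_measurable [measurable]: "rGamma \<in> borel_measurable (borel :: real measure)"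
  by (intro borel_measurable_continuous_onI continuous_on_rGamma)

lemma rl_kernel_measurable2:
  "(\<lambda>z. rl_kernel (fst z) (snd z)) \<in> borel_measurable (borel \<Otimes>\<^sub>M borel)"
  unfolding rl_kernel_def by measurable

lemma rl_kernel_measurable [measurable (raw)]:
  assumes "g \<in> borel_measurable M" "h \<in> borel_measurable M"
  shows "(\<lambda>z. rl_kernel (g z) (h z)) \<in> borel_measurable M"
  using measurable_compose[OF measurable_Pair[OF assms] rl_kernel_measurable2] by simp

lemma nn_integral_powr_Icc0:
  assumes "-1 < a" "0 \<le> c"
  shows "(\<integral>\<^sup>+x. ennreal (x powr a) * indicator {0..c} x \<partial>lborel) = ennreal (c powr (a + 1) / (a + 1))"
  by (rule nn_integral_has_integral_lebesgue'[OF _ has_integral_powr_from_0]) (use assms in auto)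

lemma rl_var_measurable:
  assumes [measurable]: "g \<in> borel_measurable leb01" "f \<in> borel_measurable leb01"
  shows "(\<lambda>t. rl (g t) f t) \<in> borel_measurable leb01"
  unfolding rl_def
  by (rule leb01.borel_measurable_lebesgue_integral) measurable

lemma rl_measurable [measurable (raw)]:
  assumes [measurable]: "f \<in> borel_measurable leb01"
  shows "rl b f \<in> borel_measurable leb01"
  using rl_var_measurable[of "\<lambda>_. b" f] assms by simp

text \<open>
Where this is finite, the integral that defines \<^const>\<open>rl\<close> converges absolutely. Elsewhere
\<^const>\<open>rl\<close> is the default value \<open>0\<close> of a non-integrable function, for which \<open>rl_le_rl_abs\<close> still
holds.
\<close>

definition rl_abs :: "real \<Rightarrow> (real \<Rightarrow> real) \<Rightarrow> real \<Rightarrow> ennreal" where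
  "rl_abs b f t = (\<integral>\<^sup>+s. ennreal (rl_kernel b (t - s)) * ennreal \<bar>f s\<bar> \<partial>leb01)"

lemma rl_integrable:
  assumes [measurable]: "f \<in> borel_measurable leb01" and "0 < b" and fin: "rl_abs b f t < \<infinity>"
  shows "integrable leb01 (\<lambda>s. rl_kernel b (t - s) * f s)"
proof (rule integrableI_bounded)
  have "(\<integral>\<^sup>+s. ennreal (norm (rl_kernel b (t - s) * f s)) \<partial>leb01) = rl_abs b f t"
    unfolding rl_abs_def using rl_kernel_nonneg[OF \<open>0 < b\<close>]
    by (intro nn_integral_cong) (simp add: abs_mult ennreal_mult)
  then show "(\<integral>\<^sup>+s. ennreal (norm (rl_kernel b (t - s) * f s)) \<partial>leb01) < \<infinity>" using fin by simp
qed measurable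

lemma rl_le_rl_abs:
  assumes [measurable]: "f \<in> borel_measurable leb01" and b: "0 < b"
  shows "ennreal \<bar>rl b f t\<bar> \<le> rl_abs b f t"
proof (cases "integrable leb01 (\<lambda>s. rl_kernel b (t - s) * f s)")
  case True
  from integral_norm_bound_ennreal[OF this]
  have "ennreal \<bar>rl b f t\<bar> \<le> (\<integral>\<^sup>+s. ennreal (norm (rl_kernel b (t - s) * f s)) \<partial>leb01)"
    by (simp add: rl_def)
  also have "\<dots> = rl_abs b f t"
    unfolding rl_abs_def using rl_kernel_nonneg[OF b]
    by (intro nn_integral_cong) (simp add: abs_mult ennreal_mult)
  finally show ?thesis .
next
  case False
  then show ?thesis by (simp add: rl_def not_integrable_integral_eq)
qed

lemma rl_diff:
  assumes "f \<in> borel_measurable leb01" "g \<in> borel_measurable leb01" "0 < b"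
    "rl_abs b f t < \<infinity>" "rl_abs b g t < \<infinity>"
  shows "rl b (\<lambda>s. f s - g s) t = rl b f t - rl b g t"
  unfolding rl_def right_diff_distrib
  by (intro Bochner_Integration.integral_diff rl_integrable assms)

lemma rl_cmult: "rl b (\<lambda>s. k * f s) t = k * rl b f t"
  unfolding rl_def by (simp add: mult.left_commute[of _ k])

text \<open>
The substitution \<open>s = r + (t - r) x\<close> turns the integral into the Beta integral.
\<close>

lemma beta_kernel_nn:
  assumes a: "0 < a" and b: "0 < b" and t: "t \<in> {0..1}" and r: "r \<in> {0..1}"
  shows "(\<integral>\<^sup>+s. ennreal (rl_kernel a (t - s) * rl_kernel b (s - r)) \<partial>leb01) = ennreal (rl_kernel (a + b) (t - r))"
proof (cases "r < t")
  case False
  then have "(\<integral>\<^sup>+s. ennreal (rl_kernel a (t - s) * rl_kernel b (s - r)) \<partial>leb01) = (\<integral>\<^sup>+s. 0 \<partial>leb01)"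
    by (intro nn_integral_cong) (auto simp: rl_kernel_def)
  moreover have "rl_kernel (a + b) (t - r) = 0" using False by (simp add: rl_kernel_def)
  ultimately show ?thesis by simp
next
  case True
  let ?F = "\<lambda>s. ennreal (rl_kernel a (t - s) * rl_kernel b (s - r))"
  define d where "d = t - r"
  have d: "0 < d" "d \<le> 1" using True t r by (auto simp: d_def)
  have G: "0 < rGamma a" "0 < rGamma b" using a b by (auto intro: rGamma_pos)
  define k where "k = rGamma a * rGamma b * d powr (a + b - 2)"
  have k: "k \<ge> 0" using G by (simp add: k_def)
  have F: "?F (r + d * x) = ennreal k * (ennreal (x powr (b - 1) * (1 - x) powr (a - 1)) * indicator {0..1} x)" for x
  proof (cases "0 < x \<and> x < 1")
    case True
    have 1: "t - (r + d * x) = d * (1 - x)" by (simp add: d_def algebra_simps)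
    have 2: "r + d * x - r = d * x" by simp
    have "0 < d * x" "0 < d * (1 - x)" using d True by auto
    moreover have "d * x \<le> 1" "d * (1 - x) \<le> 1" using d True by (auto intro!: mult_le_one)
    ultimately have "?F (r + d * x) = ennreal (rGamma a * (d * (1 - x)) powr (a - 1) * (rGamma b * (d * x) powr (b - 1)))"
      unfolding 1 2 by (simp add: rl_kernel_def)
    also have "rGamma a * (d * (1 - x)) powr (a - 1) * (rGamma b * (d * x) powr (b - 1))
      = k * (x powr (b - 1) * (1 - x) powr (a - 1))"
    proof -
      have "d powr (a + b - 2) = d powr (a - 1) * d powr (b - 1)"
        by (simp add: powr_add[symmetric])
      then show ?thesis using d True by (simp add: powr_mult k_def)
    qed
    also have "ennreal \<dots> = ennreal k * (ennreal (x powr (b - 1) * (1 - x) powr (a - 1)) * indicator {0..1} x)"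
      using True k by (simp add: ennreal_mult)
    finally show ?thesis .
  next
    case False
    then have "x \<le> 0 \<or> 1 \<le> x" by auto
    then have "d * x \<le> 0 \<or> d \<le> d * x" using d by (auto simp: mult_le_0_iff)
    then have "?F (r + d * x) = 0" by (auto simp: rl_kernel_def d_def)
    moreover have "ennreal (x powr (b - 1) * (1 - x) powr (a - 1)) * indicator {0..1} x = 0"
      using False by (auto split: split_indicator)
    ultimately show ?thesis by simp
  qed
  have "(\<integral>\<^sup>+s. ?F s \<partial>leb01) = (\<integral>\<^sup>+s. ?F s * indicator {0..1} s \<partial>lborel)"
    by (intro nn_integral_leb01) measurable
  also have "\<dots> = (\<integral>\<^sup>+s. ?F s \<partial>lborel)"
    using t r by (intro nn_integral_cong) (auto simp: rl_kernel_def split: split_indicator)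
  also have "\<dots> = ennreal d * (\<integral>\<^sup>+x. ?F (r + d * x) \<partial>lborel)"
    using nn_integral_real_affine[of ?F d r] d by simp
  also have "(\<integral>\<^sup>+x. ?F (r + d * x) \<partial>lborel) = ennreal k * (\<integral>\<^sup>+x. (ennreal (x powr (b - 1) * (1 - x) powr (a - 1)) * indicator {0..1} x) \<partial>lborel)"
    unfolding F by (intro nn_integral_cmult) measurable
  also have "(\<integral>\<^sup>+x. (ennreal (x powr (b - 1) * (1 - x) powr (a - 1)) * indicator {0..1} x) \<partial>lborel) = ennreal (Beta b a)"
    by (rule nn_integral_has_integral_lebesgue'[OF _ has_integral_Beta_real]) (use a b in auto)
  also have "ennreal d * (ennreal k * ennreal (Beta b a)) = ennreal (d * (k * Beta b a))"
    using d k by (simp add: ennreal_mult')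
  also have "d * (k * Beta b a) = rl_kernel (a + b) (t - r)"
  proof -
    have "Beta b a = Gamma a * Gamma b * rGamma (a + b)"
      by (simp add: Beta_altdef add.commute)
    then have "k * Beta b a = d powr (a + b - 2) * rGamma (a + b)"
    proof -
      have "rGamma a * Gamma a = 1" "rGamma b * Gamma b = 1"
        using Gamma_real_pos[OF a] Gamma_real_pos[OF b] by (simp_all add: rGamma_inverse_Gamma)
      moreover have "k * (Gamma a * Gamma b * rGamma (a + b))
          = (rGamma a * Gamma a) * (rGamma b * Gamma b) * (d powr (a + b - 2) * rGamma (a + b))"
        by (simp add: k_def)
      ultimately show ?thesis using \<open>Beta b a = _\<close> by simp
    qed
    then have "d * (k * Beta b a) = d * d powr (a + b - 2) * rGamma (a + b)" by simp
    also have "d * d powr (a + b - 2) = d powr (a + b - 1)"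
      using powr_mult_base[of d "a + b - 2"] d by simp
    finally show ?thesis using d by (simp add: rl_kernel_def d_def)
  qed
  finally show ?thesis .
qed

text \<open>
The hypothesis concerns a single point \<open>t\<close>, so that the orders may be chosen depending on \<open>t\<close>.
\<close>

lemma rl_semigroup:
  assumes [measurable]: "f \<in> borel_measurable leb01" and a: "0 < a" and b: "0 < b" and t: "t \<in> {0..1}"
    and fin: "rl_abs (a + b) f t < \<infinity>"
  shows "rl a (rl b f) t = rl (a + b) f t"
proof -
  let ?F = "\<lambda>s r. rl_kernel a (t - s) * (rl_kernel b (s - r) * f r)"
  have kernel_int: "(\<integral>\<^sup>+s. ennreal (rl_kernel a (t - s) * rl_kernel b (s - r)) \<partial>leb01) = ennreal (rl_kernel (a + b) (t - r))"
    if "r \<in> {0..1}" for r using beta_kernel_nn[OF a b t that] .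
  have "(\<integral>\<^sup>+z. ennreal (norm (case_prod ?F z)) \<partial>(leb01 \<Otimes>\<^sub>M leb01))
     = (\<integral>\<^sup>+r. (\<integral>\<^sup>+s. ennreal (norm (?F s r)) \<partial>leb01) \<partial>leb01)"
    by (subst leb01_pair.nn_integral_snd[symmetric]) auto
  also have "\<dots> = (\<integral>\<^sup>+r. (\<integral>\<^sup>+s. ennreal (rl_kernel a (t - s) * rl_kernel b (s - r)) * ennreal \<bar>f r\<bar> \<partial>leb01) \<partial>leb01)"
    using rl_kernel_nonneg[OF a] rl_kernel_nonneg[OF b]
    by (intro nn_integral_cong) (auto simp: abs_mult ennreal_mult[symmetric] mult.assoc)
  also have "\<dots> = (\<integral>\<^sup>+r. (\<integral>\<^sup>+s. ennreal (rl_kernel a (t - s) * rl_kernel b (s - r)) \<partial>leb01) * ennreal \<bar>f r\<bar> \<partial>leb01)"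
    by (intro nn_integral_cong nn_integral_multc) measurable
  also have "\<dots> = rl_abs (a + b) f t"
    unfolding rl_abs_def by (intro nn_integral_cong) (simp add: kernel_int)
  finally have nn: "(\<integral>\<^sup>+z. ennreal (norm (case_prod ?F z)) \<partial>(leb01 \<Otimes>\<^sub>M leb01)) < \<infinity>" using fin by simp
  have int: "integrable (leb01 \<Otimes>\<^sub>M leb01) (case_prod ?F)"
    by (rule integrableI_bounded[OF _ nn]) measurable
  have "rl a (rl b f) t = (\<integral>s. (\<integral>r. ?F s r \<partial>leb01) \<partial>leb01)"
    by (simp add: rl_def)
  also have "\<dots> = (\<integral>r. (\<integral>s. ?F s r \<partial>leb01) \<partial>leb01)"
    by (rule leb01_pair.Fubini_integral[OF int, symmetric])
  also have "\<dots> = rl (a + b) f t"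
    unfolding rl_def
  proof (intro Bochner_Integration.integral_cong refl)
    fix r assume "r \<in> space leb01"
    then have r: "r \<in> {0..1}" by simp
    have "(\<integral>s. ?F s r \<partial>leb01) = (\<integral>s. rl_kernel a (t - s) * rl_kernel b (s - r) \<partial>leb01) * f r"
      by (simp add: mult.assoc[symmetric])
    also have "(\<integral>s. rl_kernel a (t - s) * rl_kernel b (s - r) \<partial>leb01) = rl_kernel (a + b) (t - r)"
      using kernel_int[OF r] rl_kernel_nonneg[OF a] rl_kernel_nonneg[OF b] rl_kernel_nonneg[of "a + b"] a b
      by (subst integral_eq_nn_integral) auto
    finally show "(\<integral>s. ?F s r \<partial>leb01) = rl_kernel (a + b) (t - r) * f r" .
  qed
  finally show ?thesis .
qed

section \<open>The one-sided maximal function\<close>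

abbreviation (input) past :: "(real \<Rightarrow> real) \<Rightarrow> nat \<Rightarrow> real \<Rightarrow> real \<Rightarrow> ennreal" where
  "past f j t s \<equiv> if t - 1 / 2 ^ j \<le> s \<and> s \<le> t then ennreal \<bar>f s\<bar> else 0"

text \<open>
Averages over the past of \<open>t\<close> only, at dyadic scales: this suffices for fractional integrals, and a
countable supremum is measurable.
\<close>

definition maximal :: "(real \<Rightarrow> real) \<Rightarrow> real \<Rightarrow> ennreal" where
  "maximal f t = (SUP j::nat. ennreal (2 ^ j) *
     (\<integral>\<^sup>+s. past f j t s \<partial>leb01))"

lemma maximal_upper:
  "ennreal (2 ^ j) * (\<integral>\<^sup>+s. past f j t s \<partial>leb01) \<le> maximal f t"
  unfolding maximal_def by (rule SUP_upper) auto

lemma maximal_measurable [measurable (raw)]: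
  assumes [measurable]: "f \<in> borel_measurable leb01"
  shows "maximal f \<in> borel_measurable leb01"
  unfolding maximal_def[abs_def]
  by (intro borel_measurable_SUP borel_measurable_times borel_measurable_const
        leb01.borel_measurable_nn_integral) measurable

lemma maximal_cmult:
  assumes [measurable]: "f \<in> borel_measurable leb01"
  shows "maximal (\<lambda>s. k * f s) t = ennreal \<bar>k\<bar> * maximal f t"
proof -
  have "(\<integral>\<^sup>+s. (if t - 1 / 2 ^ j \<le> s \<and> s \<le> t then ennreal \<bar>k * f s\<bar> else 0) \<partial>leb01)
      = ennreal \<bar>k\<bar> * (\<integral>\<^sup>+s. past f j t s \<partial>leb01)" for j :: nat
    by (subst nn_integral_cmult[symmetric]) (auto intro!: nn_integral_cong simp: abs_mult ennreal_mult)
  then show ?thesis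
    unfolding maximal_def by (simp add: SUP_mult_left_ennreal mult.left_commute)
qed

lemma maximal_add_le:
  assumes [measurable]: "g \<in> borel_measurable leb01" "h \<in> borel_measurable leb01"
    and le: "\<And>s. \<bar>f s\<bar> \<le> \<bar>g s\<bar> + \<bar>h s\<bar>"
  shows "maximal f t \<le> maximal g t + maximal h t"
  unfolding maximal_def[of f]
proof (rule SUP_least)
  fix j :: nat
  let ?I = "\<lambda>f. \<integral>\<^sup>+s. past f j t s \<partial>leb01"
  have "?I f \<le> (\<integral>\<^sup>+s. past g j t s
      + past h j t s \<partial>leb01)"
    using le by (intro nn_integral_mono) (auto simp: ennreal_plus[symmetric] simp del: ennreal_plus intro!: ennreal_leI)
  also have "\<dots> = ?I g + ?I h" by (intro nn_integral_add) measurable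
  finally have "ennreal (2 ^ j) * ?I f \<le> ennreal (2 ^ j) * (?I g + ?I h)" by (intro mult_left_mono) auto
  also have "\<dots> \<le> maximal g t + maximal h t"
    unfolding distrib_left by (intro add_mono maximal_upper)
  finally show "ennreal (2 ^ j) * ?I f \<le> maximal g t + maximal h t" .
qed

lemma leb01_sets_Int: "A \<in> sets lebesgue \<Longrightarrow> A \<inter> {0..1} \<in> sets leb01"
  by (auto simp: sets_restrict_space)

lemma emeasure_leb01_Icc_le:
  assumes "a \<le> b" shows "emeasure leb01 ({a..b} \<inter> {0..1}) \<le> ennreal (b - a)"
proof -
  have "emeasure leb01 ({a..b} \<inter> {0..1}) = emeasure lebesgue ({a..b} \<inter> {0..1})"
    by (subst emeasure_restrict_space) auto
  also have "\<dots> \<le> emeasure lebesgue {a..b}" by (intro emeasure_mono) auto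
  also have "\<dots> = ennreal (b - a)" using assms by simp
  finally show ?thesis .
qed

lemma nn_integral_Icc_const_le:
  assumes "a \<le> b" "0 \<le> c"
  shows "(\<integral>\<^sup>+s. (if a \<le> s \<and> s \<le> b then ennreal c else 0) \<partial>leb01) \<le> ennreal (c * (b - a))"
proof -
  have "(\<integral>\<^sup>+s. (if a \<le> s \<and> s \<le> b then ennreal c else 0) \<partial>leb01)
      = (\<integral>\<^sup>+s. ennreal c * indicator ({a..b} \<inter> {0..1}) s \<partial>leb01)"
    by (intro nn_integral_cong) (auto split: split_indicator)
  also have "\<dots> = ennreal c * emeasure leb01 ({a..b} \<inter> {0..1})"
    by (intro nn_integral_cmult_indicator) (auto simp: sets_restrict_space)
  also have "\<dots> \<le> ennreal c * ennreal (b - a)"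
    by (intro mult_left_mono emeasure_leb01_Icc_le assms) auto
  finally show ?thesis using assms by (simp add: ennreal_mult)
qed

lemma maximal_le_const:
  assumes "\<And>s. \<bar>f s\<bar> \<le> c"
  shows "maximal f t \<le> ennreal c"
  unfolding maximal_def
proof (rule SUP_least)
  fix j :: nat
  have c: "0 \<le> c" using assms[of 0] by linarith
  have "(\<integral>\<^sup>+s. past f j t s \<partial>leb01)
     \<le> (\<integral>\<^sup>+s. (if t - 1 / 2 ^ j \<le> s \<and> s \<le> t then ennreal c else 0) \<partial>leb01)"
    using assms by (intro nn_integral_mono) (auto intro!: ennreal_leI)
  also have "\<dots> \<le> ennreal (c * (t - (t - 1 / 2 ^ j)))"
    by (intro nn_integral_Icc_const_le c) auto
  finally have "ennreal (2 ^ j) * (\<integral>\<^sup>+s. past f j t s \<partial>leb01)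
     \<le> ennreal (2 ^ j) * ennreal (c * (t - (t - 1 / 2 ^ j)))"
    by (intro mult_left_mono) auto
  also have "\<dots> = ennreal c" using c by (simp add: ennreal_mult[symmetric])
  finally show "ennreal (2 ^ j) * (\<integral>\<^sup>+s. past f j t s \<partial>leb01) \<le> ennreal c" .
qed

text \<open>
Each point of the superlevel set is the right end of an interval on which the average of \<open>\<bar>f\<bar>\<close>
exceeds \<open>l\<close>. By Vitali's covering lemma, disjoint intervals of this kind, enlarged five times, cover
the set.
\<close>

lemma maximal_weak_type:
  assumes [measurable]: "f \<in> borel_measurable leb01" and l: "0 < l"
  shows "emeasure leb01 {t \<in> space leb01. ennreal l < maximal f t} \<le> ennreal (5 / l) * (\<integral>\<^sup>+s. ennreal \<bar>f s\<bar> \<partial>leb01)"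
proof -
  let ?I = "\<lambda>j t. \<integral>\<^sup>+s. past f j t s \<partial>leb01"
  define E where "E = {t \<in> space leb01. ennreal l < maximal f t}"
  have E_sets[measurable]: "E \<in> sets leb01" unfolding E_def by measurable
  have "\<forall>t\<in>E. \<exists>j::nat. ennreal l < ennreal (2 ^ j) * ?I j t"
    unfolding E_def maximal_def less_SUP_iff by blast
  from bchoice[OF this] obtain j :: "real \<Rightarrow> nat"
    where "\<forall>t\<in>E. ennreal l < ennreal (2 ^ j t) * ?I (j t) t" ..
  then have j: "ennreal l < ennreal (2 ^ j t) * ?I (j t) t" if "t \<in> E" for t
    using that by (rule bspec)
  \<comment> \<open>The interval of length \<open>1 / 2 ^ j t\<close> that ends at \<open>t\<close>, as a ball with centre \<open>a t\<close>.\<close>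
  define r where "r = (\<lambda>t. 1 / 2 ^ j t / 2 :: real)"
  define a where "a = (\<lambda>t. t - r t)"
  have r: "0 < r t" "r t \<le> 1" for t
  proof -
    have "1 \<le> (2::real) ^ j t" by simp
    then have "1 \<le> (2::real) ^ j t * 2" by linarith
    then show "0 < r t" "r t \<le> 1" by (auto simp: r_def)
  qed
  have cb: "cball (a t) (r t) = {t - 1 / 2 ^ j t..t}" for t
  proof -
    have "r t + r t = 1 / 2 ^ j t"
      unfolding r_def by (rule field_sum_of_halves)
    then have "t - r t - r t = t - 1 / 2 ^ j t" "t - r t + r t = t"
      by (simp_all only: diff_diff_eq diff_add_cancel)
    then show ?thesis unfolding cball_eq_atLeastAtMost a_def by (simp only:)
  qed
  have "t \<in> cball (a t) (r t)" for t unfolding cb by simp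
  then have cov: "E \<subseteq> (\<Union>i\<in>E. cball (a i) (r i))" by blast
  have rB: "0 < r t \<and> r t \<le> 1" if "t \<in> E" for t using r by simp
  obtain C where C: "countable C" "C \<subseteq> E"
     "pairwise (\<lambda>i j. disjnt (cball (a i) (r i)) (cball (a j) (r j))) C"
     "E \<subseteq> (\<Union>i\<in>C. cball (a i) (5 * r i))"
    by (rule Vitali_covering_lemma_cballs[OF cov rB])
  have small: "ennreal (10 * r i) \<le> ennreal (5 / l) * ?I (j i) i" if "i \<in> C" for i
  proof -
    have "ennreal (10 * r i) = ennreal (5 / l / 2 ^ j i) * ennreal l"
      using l by (simp add: r_def ennreal_mult[symmetric])
    also have "\<dots> \<le> ennreal (5 / l / 2 ^ j i) * (ennreal (2 ^ j i) * ?I (j i) i)"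
      using that C j[of i] by (intro mult_left_mono) auto
    also have "\<dots> = ennreal (5 / l) * ?I (j i) i"
      using l by (simp add: mult.assoc[symmetric] ennreal_mult[symmetric])
    finally show ?thesis .
  qed
  have "emeasure leb01 E = (\<integral>\<^sup>+s. indicator E s \<partial>leb01)" by simp
  also have "\<dots> \<le> (\<integral>\<^sup>+s. (\<integral>\<^sup>+i. indicator (cball (a i) (5 * r i) \<inter> {0..1}) s \<partial>count_space C) \<partial>leb01)"
  proof (intro nn_integral_mono)
    fix s assume "s \<in> space leb01"
    show "indicator E s \<le> (\<integral>\<^sup>+i. indicator (cball (a i) (5 * r i) \<inter> {0..1}) s \<partial>count_space C)"
    proof (cases "s \<in> E")
      case True
      then obtain i where i: "i \<in> C" "s \<in> cball (a i) (5 * r i)" using C by blast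
      have "(1::ennreal) = emeasure (count_space C) {i}" using i by (simp add: emeasure_count_space_finite)
      also have "\<dots> = (\<integral>\<^sup>+x. indicator {i} x \<partial>count_space C)" using i by simp
      also have "\<dots> \<le> (\<integral>\<^sup>+i. indicator (cball (a i) (5 * r i) \<inter> {0..1}) s \<partial>count_space C)"
        using i \<open>s \<in> space leb01\<close> by (intro nn_integral_mono) (auto split: split_indicator)
      finally show ?thesis using True by simp
    qed simp
  qed
  also have "\<dots> = (\<integral>\<^sup>+i. (\<integral>\<^sup>+s. indicator (cball (a i) (5 * r i) \<inter> {0..1}) s \<partial>leb01) \<partial>count_space C)"
    by (rule nn_integral_count_space_nn_integral[OF C(1)])
       (intro borel_measurable_indicator leb01_sets_Int, simp)
  also have "\<dots> \<le> (\<integral>\<^sup>+i. ennreal (5 / l) * ?I (j i) i \<partial>count_space C)"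
  proof (intro nn_integral_mono)
    fix i assume "i \<in> space (count_space C)"
    then have i: "i \<in> C" by simp
    have 5: "cball (a i) (5 * r i) = {a i - 5 * r i..a i + 5 * r i}"
      by (auto simp: cball_def dist_real_def abs_real_def)
    have "(\<integral>\<^sup>+s. indicator (cball (a i) (5 * r i) \<inter> {0..1}) s \<partial>leb01) = emeasure leb01 (cball (a i) (5 * r i) \<inter> {0..1})"
      by (subst nn_integral_indicator) (auto simp: sets_restrict_space)
    also have "\<dots> \<le> ennreal (10 * r i)"
      unfolding 5 using emeasure_leb01_Icc_le[of "a i - 5 * r i" "a i + 5 * r i"] r[of i] by simp
    also have "\<dots> \<le> ennreal (5 / l) * ?I (j i) i" by (rule small[OF i])
    finally show "(\<integral>\<^sup>+s. indicator (cball (a i) (5 * r i) \<inter> {0..1}) s \<partial>leb01) \<le> ennreal (5 / l) * ?I (j i) i" .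
  qed
  also have "\<dots> = ennreal (5 / l) * (\<integral>\<^sup>+i. ?I (j i) i \<partial>count_space C)"
    by (intro nn_integral_cmult) auto
  also have "(\<integral>\<^sup>+i. ?I (j i) i \<partial>count_space C)
     = (\<integral>\<^sup>+s. (\<integral>\<^sup>+i. past f (j i) i s \<partial>count_space C) \<partial>leb01)"
    by (rule nn_integral_count_space_nn_integral[OF C(1), symmetric]) measurable
  also have "\<dots> \<le> (\<integral>\<^sup>+s. ennreal \<bar>f s\<bar> \<partial>leb01)"
  proof (intro nn_integral_mono)
    fix s
    show "(\<integral>\<^sup>+i. past f (j i) i s \<partial>count_space C) \<le> ennreal \<bar>f s\<bar>"
    proof (cases "\<exists>i0\<in>C. s \<in> cball (a i0) (r i0)")
      case True
      then obtain i0 where i0: "i0 \<in> C" "s \<in> cball (a i0) (r i0)" by blast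
      have "(\<integral>\<^sup>+i. past f (j i) i s \<partial>count_space C)
         \<le> (\<integral>\<^sup>+i. ennreal \<bar>f s\<bar> * indicator {i0} i \<partial>count_space C)"
      proof (intro nn_integral_mono)
        fix i assume i: "i \<in> space (count_space C)"
        have "i = i0" if "s \<in> cball (a i) (r i)"
          using C(3) i i0 that unfolding pairwise_def disjnt_def by fastforce
        then show "past f (j i) i s \<le> ennreal \<bar>f s\<bar> * indicator {i0} i"
          unfolding cb by (auto split: split_indicator)
      qed
      also have "\<dots> = ennreal \<bar>f s\<bar>"
        using i0 by (subst nn_integral_cmult_indicator) (auto simp: emeasure_count_space_finite)
      finally show ?thesis .
    next
      case False
      then have "(\<integral>\<^sup>+i. past f (j i) i s \<partial>count_space C) = (\<integral>\<^sup>+i. 0 \<partial>count_space C)"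
        unfolding cb by (intro nn_integral_cong) auto
      then show ?thesis by simp
    qed
  qed
  finally show ?thesis unfolding E_def by (simp add: mult_left_mono)
qed

lemma maximal_finite_AE:
  assumes f: "Lnorm_le u f c" and c: "0 < c" and u: "0 \<le> u" "u \<le> 1"
  shows "AE t in leb01. maximal f t < \<infinity>"
proof -
  have [measurable]: "f \<in> borel_measurable leb01" using f by (rule Lnorm_le_measurable)
  have int: "(\<integral>\<^sup>+s. ennreal \<bar>f s\<bar> \<partial>leb01) \<le> ennreal c"
    by (rule Lnorm_le_integral[OF Lnorm_le_inclusion[OF f u c] c])
  let ?N = "{t \<in> space leb01. maximal f t = \<infinity>}"
  have le: "emeasure leb01 ?N \<le> ennreal (5 * c / l)" if l: "0 < l" for l
  proof -
    have S: "{t \<in> space leb01. ennreal l < maximal f t} \<in> sets leb01" by measurable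
    have "emeasure leb01 ?N \<le> emeasure leb01 {t \<in> space leb01. ennreal l < maximal f t}"
      by (intro emeasure_mono S) auto
    also have "\<dots> \<le> ennreal (5 / l) * ennreal c"
      by (rule order_trans[OF maximal_weak_type[OF _ l]]) (auto intro!: mult_left_mono int)
    finally show ?thesis using l c by (simp add: ennreal_mult[symmetric])
  qed
  have "emeasure leb01 ?N = 0"
  proof (rule antisym[OF _ zero_le])
    show "emeasure leb01 ?N \<le> 0"
  proof (rule ennreal_le_epsilon)
    fix e :: real assume "0 < e"
    then show "emeasure leb01 ?N \<le> 0 + ennreal e" using le[of "5 * c / e"] c by simp
  qed
  qed
  moreover have "?N \<in> sets leb01" by measurable
  ultimately have "?N \<in> null_sets leb01" unfolding null_sets_def by blast
  then have "AE t in leb01. t \<notin> ?N" by (rule AE_not_in)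
  then show ?thesis
    using AE_space by eventually_elim (auto simp: less_top)
qed

text \<open>
The part of \<open>f\<close> below \<open>l / 2\<close> contributes at most \<open>l / 2\<close> to the maximal function, so the weak-type
inequality need only be applied to the large values of \<open>f\<close>. This truncation is what makes the
integral over all levels \<open>l\<close> converge.
\<close>

lemma maximal_layer:
  assumes [measurable]: "f \<in> borel_measurable leb01" "r \<in> borel_measurable leb01"
    and le: "AE t in leb01. ennreal \<bar>r t\<bar> \<le> maximal f t" and l: "0 < l"
  shows "emeasure leb01 {t \<in> space leb01. l \<le> \<bar>r t\<bar>}
    \<le> ennreal (20 / l) * (\<integral>\<^sup>+s. (if l \<le> 2 * \<bar>f s\<bar> then ennreal \<bar>f s\<bar> else 0) \<partial>leb01)"
proof -
  define g where "g s = (if l \<le> 2 * \<bar>f s\<bar> then f s else 0)" for s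
  define h where "h s = (if l \<le> 2 * \<bar>f s\<bar> then 0 else f s)" for s
  have [measurable]: "g \<in> borel_measurable leb01" "h \<in> borel_measurable leb01"
    unfolding g_def h_def by measurable
  \<comment> \<open>The slack between \<open>l / 2\<close> and \<open>l / 4\<close> turns a weak inequality into a strict one.\<close>
  have mg: "ennreal (l / 4) < maximal g t" if "l \<le> \<bar>r t\<bar>" "ennreal \<bar>r t\<bar> \<le> maximal f t" for t
  proof (rule ccontr)
    assume "\<not> ennreal (l / 4) < maximal g t"
    moreover have "maximal f t \<le> maximal g t + maximal h t"
      by (rule maximal_add_le) (auto simp: g_def h_def)
    moreover have "maximal h t \<le> ennreal (l / 2)"
      using l by (intro maximal_le_const) (auto simp: h_def)
    ultimately have "ennreal l \<le> ennreal (l / 4) + ennreal (l / 2)"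
      using that by (meson add_mono ennreal_leI leI order_trans)
    then show False using l by (simp add: ennreal_plus[symmetric] del: ennreal_plus)
  qed
  have S: "{t \<in> space leb01. ennreal (l / 4) < maximal g t} \<in> sets leb01" by measurable
  have "emeasure leb01 {t \<in> space leb01. l \<le> \<bar>r t\<bar>} \<le> emeasure leb01 {t \<in> space leb01. ennreal (l / 4) < maximal g t}"
    by (intro emeasure_mono_AE S, use le in eventually_elim) (auto intro: mg)
  also have "\<dots> \<le> ennreal (5 / (l / 4)) * (\<integral>\<^sup>+s. ennreal \<bar>g s\<bar> \<partial>leb01)"
    using l by (intro maximal_weak_type) auto
  also have "(\<integral>\<^sup>+s. ennreal \<bar>g s\<bar> \<partial>leb01) = (\<integral>\<^sup>+s. (if l \<le> 2 * \<bar>f s\<bar> then ennreal \<bar>f s\<bar> else 0) \<partial>leb01)"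
    by (intro nn_integral_cong) (auto simp: g_def)
  finally show ?thesis by simp
qed

text \<open>
Marcinkiewicz interpolation: integrate \<open>maximal_layer\<close> over the levels. After exchanging the
integrals, \<open>l powr (q - 2)\<close> is integrated from \<open>0\<close> to \<open>2 * \<bar>f s\<bar>\<close>, which converges because
\<open>q > 1\<close>.
\<close>

lemma maximal_strong_type_normalized:
  assumes [measurable]: "f \<in> borel_measurable leb01" "r \<in> borel_measurable leb01"
    and le: "AE t in leb01. ennreal \<bar>r t\<bar> \<le> maximal f t" and q: "1 < q"
  shows "(\<integral>\<^sup>+t. ennreal (\<bar>r t\<bar> powr q) \<partial>leb01)
     \<le> ennreal (20 * q * 2 powr (q - 1) / (q - 1)) * (\<integral>\<^sup>+s. ennreal (\<bar>f s\<bar> powr q) \<partial>leb01)"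
proof -
  let ?X = "\<lambda>t l. if 0 \<le> l \<and> l \<le> \<bar>r t\<bar> then ennreal (q * l powr (q - 1)) else 0"
  let ?Y = "\<lambda>s l. if 0 \<le> l \<and> l \<le> 2 * \<bar>f s\<bar> then ennreal (20 * q * l powr (q - 2)) * ennreal \<bar>f s\<bar> else 0"
  let ?Z = "\<lambda>l s. if l \<le> 2 * \<bar>f s\<bar> then ennreal \<bar>f s\<bar> else 0"
  interpret P: pair_sigma_finite leb01 lborel by standard
  have [measurable]: "fst \<in> borel_measurable (leb01 \<Otimes>\<^sub>M lborel)"
    using measurable_compose[OF measurable_fst leb01_ident_measurable, of lborel] by simp
  have "(\<integral>\<^sup>+t. ennreal (\<bar>r t\<bar> powr q) \<partial>leb01)
     = (\<integral>\<^sup>+t. (\<integral>\<^sup>+l. ennreal q * (ennreal (l powr (q - 1)) * indicator {0..\<bar>r t\<bar>} l) \<partial>lborel) \<partial>leb01)"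
  proof (intro nn_integral_cong)
    fix t
    show "ennreal (\<bar>r t\<bar> powr q) = (\<integral>\<^sup>+l. ennreal q * (ennreal (l powr (q - 1)) * indicator {0..\<bar>r t\<bar>} l) \<partial>lborel)"
      using q by (subst nn_integral_cmult) (auto simp: nn_integral_powr_Icc0 ennreal_mult[symmetric])
  qed
  also have "\<dots> = (\<integral>\<^sup>+t. (\<integral>\<^sup>+l. ?X t l \<partial>lborel) \<partial>leb01)"
    using q by (intro nn_integral_cong) (auto simp: ennreal_mult split: split_indicator)
  also have "\<dots> = (\<integral>\<^sup>+l. (\<integral>\<^sup>+t. ?X t l \<partial>leb01) \<partial>lborel)"
    by (rule P.Fubini'[symmetric]) measurable
  also have "\<dots> \<le> (\<integral>\<^sup>+l. (\<integral>\<^sup>+s. ?Y s l \<partial>leb01) \<partial>lborel)"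
  proof (rule nn_integral_mono)
    fix l :: real
    show "(\<integral>\<^sup>+t. ?X t l \<partial>leb01)
      \<le> (\<integral>\<^sup>+s. ?Y s l \<partial>leb01)"
    proof (cases "0 < l")
      case True
      have "(\<integral>\<^sup>+t. ?X t l \<partial>leb01)
        = (\<integral>\<^sup>+t. ennreal (q * l powr (q - 1)) * indicator {t \<in> space leb01. l \<le> \<bar>r t\<bar>} t \<partial>leb01)"
        using True by (intro nn_integral_cong) (auto split: split_indicator)
      also have "\<dots> = ennreal (q * l powr (q - 1)) * emeasure leb01 {t \<in> space leb01. l \<le> \<bar>r t\<bar>}"
        by (intro nn_integral_cmult_indicator) measurable
      also have "\<dots> \<le> ennreal (q * l powr (q - 1)) * (ennreal (20 / l) * (\<integral>\<^sup>+s. ?Z l s \<partial>leb01))"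
        by (intro mult_left_mono maximal_layer le True) auto
      also have "\<dots> = ennreal (20 * q * l powr (q - 2)) * (\<integral>\<^sup>+s. ?Z l s \<partial>leb01)"
      proof -
        have "l powr (q - 1) = l * l powr (q - 2)"
          using powr_mult_base[of l "q - 2"] True by simp
        then have "q * l powr (q - 1) * (20 / l) = 20 * q * l powr (q - 2)"
          using True by simp
        then have "ennreal (q * l powr (q - 1)) * ennreal (20 / l) = ennreal (20 * q * l powr (q - 2))"
          using True q by (subst ennreal_mult[symmetric]) auto
        then show ?thesis by (simp add: mult.assoc[symmetric])
      qed
      also have "\<dots> = (\<integral>\<^sup>+s. ennreal (20 * q * l powr (q - 2)) * ?Z l s \<partial>leb01)"
        by (intro nn_integral_cmult[symmetric]) measurable
      also have "\<dots> = (\<integral>\<^sup>+s. ?Y s l \<partial>leb01)"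
        using True by (intro nn_integral_cong) auto
      finally show ?thesis .
    next
      case False
      then have "(\<integral>\<^sup>+t. ?X t l \<partial>leb01) = (\<integral>\<^sup>+t. 0 \<partial>leb01)"
        by (intro nn_integral_cong) auto
      then show ?thesis by simp
    qed
  qed
  also have "\<dots> = (\<integral>\<^sup>+s. (\<integral>\<^sup>+l. ?Y s l \<partial>lborel) \<partial>leb01)"
    by (rule P.Fubini') measurable
  also have "\<dots> = (\<integral>\<^sup>+s. ennreal (20 * q * 2 powr (q - 1) / (q - 1)) * ennreal (\<bar>f s\<bar> powr q) \<partial>leb01)"
  proof (intro nn_integral_cong)
    fix s
    have "(\<integral>\<^sup>+l. ?Y s l \<partial>lborel)
      = (\<integral>\<^sup>+l. ennreal (20 * q * \<bar>f s\<bar>) * (ennreal (l powr (q - 2)) * indicator {0..2 * \<bar>f s\<bar>} l) \<partial>lborel)"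
      using q by (intro nn_integral_cong) (auto simp: ennreal_mult[symmetric] mult_ac split: split_indicator)
    also have "\<dots> = ennreal (20 * q * \<bar>f s\<bar>) * ennreal ((2 * \<bar>f s\<bar>) powr (q - 1) / (q - 1))"
      using q by (subst nn_integral_cmult) (auto simp: nn_integral_powr_Icc0)
    also have "\<dots> = ennreal (20 * q * 2 powr (q - 1) / (q - 1) * (\<bar>f s\<bar> * \<bar>f s\<bar> powr (q - 1)))"
      using q by (simp add: ennreal_mult[symmetric] powr_mult mult_ac)
    also have "\<bar>f s\<bar> * \<bar>f s\<bar> powr (q - 1) = \<bar>f s\<bar> powr q"
      using powr_mult_base[of "\<bar>f s\<bar>" "q - 1"] by simp
    finally show "(\<integral>\<^sup>+l. ?Y s l \<partial>lborel)
      = ennreal (20 * q * 2 powr (q - 1) / (q - 1)) * ennreal (\<bar>f s\<bar> powr q)"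
      using q by (simp only:) (subst ennreal_mult, auto)
  qed
  also have "\<dots> = ennreal (20 * q * 2 powr (q - 1) / (q - 1)) * (\<integral>\<^sup>+s. ennreal (\<bar>f s\<bar> powr q) \<partial>leb01)"
    by (intro nn_integral_cmult) measurable
  finally show ?thesis .
qed

lemma maximal_strong_type:
  assumes v: "0 \<le> v" "v < 1"
  shows "\<exists>A>0. \<forall>f c r. 0 < c \<longrightarrow> Lnorm_le v f c \<longrightarrow> r \<in> borel_measurable leb01 \<longrightarrow>
     (AE t in leb01. ennreal \<bar>r t\<bar> \<le> maximal f t) \<longrightarrow> Lnorm_le v r (A * c)"
proof (cases "v = 0")
  case True
  show ?thesis
  proof (intro exI[of _ 1] conjI allI impI)
    fix f c and r :: "real \<Rightarrow> real"
    assume c: "0 < c" and f: "Lnorm_le v f c" and [measurable]: "r \<in> borel_measurable leb01"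
      and le: "AE t in leb01. ennreal \<bar>r t\<bar> \<le> maximal f t"
    have [measurable]: "f \<in> borel_measurable leb01" using f by (rule Lnorm_le_measurable)
    have fc: "AE t in leb01. \<bar>f t\<bar> \<le> c" using f True by (simp add: Lnorm_le_def)
    define g where "g s = (if \<bar>f s\<bar> \<le> c then f s else 0)" for s
    have eq: "maximal f t = maximal g t" for t
      unfolding maximal_def
      by (intro SUP_cong refl arg_cong2[of _ _ _ _ "(*)"] nn_integral_cong_AE, use fc in eventually_elim) (auto simp: g_def)
    have mc: "maximal f t \<le> ennreal c" for t
      unfolding eq using c by (intro maximal_le_const) (auto simp: g_def)
    from le have "AE t in leb01. \<bar>r t\<bar> \<le> c"
    proof eventually_elim
      case (elim t)
      from order_trans[OF elim mc] show ?case using c by simp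
    qed
    then show "Lnorm_le v r (1 * c)" using True by (simp add: Lnorm_le_def)
  qed auto
next
  case False
  define q where "q = 1 / v"
  have q: "1 < q" using v False by (simp add: q_def)
  define B where "B = 20 * q * 2 powr (q - 1) / (q - 1)"
  have B: "0 < B" using q by (simp add: B_def)
  show ?thesis
  proof (intro exI[of _ "B powr v"] conjI allI impI)
    fix f c and r :: "real \<Rightarrow> real"
    assume c: "0 < c" and f: "Lnorm_le v f c" and [measurable]: "r \<in> borel_measurable leb01"
      and le: "AE t in leb01. ennreal \<bar>r t\<bar> \<le> maximal f t"
    have [measurable]: "f \<in> borel_measurable leb01" using f by (rule Lnorm_le_measurable)
    define A where "A = B powr v"
    have A: "0 < A" "A powr q = B" using B v False by (auto simp: A_def powr_powr q_def)
    have le': "AE t in leb01. ennreal \<bar>1 / c * r t\<bar> \<le> maximal (\<lambda>s. 1 / c * f s) t"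
      using le
    proof eventually_elim
      case (elim t)
      have "ennreal \<bar>1 / c * r t\<bar> = ennreal \<bar>1 / c\<bar> * ennreal \<bar>r t\<bar>" by (simp add: abs_mult ennreal_mult[symmetric])
      also have "\<dots> \<le> ennreal \<bar>1 / c\<bar> * maximal f t" by (intro mult_left_mono elim) auto
      also have "\<dots> = maximal (\<lambda>s. 1 / c * f s) t" by (rule maximal_cmult[symmetric]) measurable
      finally show ?case .
    qed
    have "(\<integral>\<^sup>+t. ennreal ((\<bar>r t\<bar> / (A * c)) powr q) \<partial>leb01)
       = (\<integral>\<^sup>+t. ennreal (1 / B) * ennreal (\<bar>1 / c * r t\<bar> powr q) \<partial>leb01)"
    proof (intro nn_integral_cong)
      fix t
      have "(\<bar>r t\<bar> / (A * c)) powr q = (\<bar>1 / c * r t\<bar> / A) powr q"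
        using c by (simp add: abs_mult mult.commute)
      also have "\<dots> = 1 / B * \<bar>1 / c * r t\<bar> powr q"
        using A by (subst powr_divide) auto
      finally show "ennreal ((\<bar>r t\<bar> / (A * c)) powr q) = ennreal (1 / B) * ennreal (\<bar>1 / c * r t\<bar> powr q)"
        using B by (simp only:) (subst ennreal_mult, auto)
    qed
    also have "\<dots> = ennreal (1 / B) * (\<integral>\<^sup>+t. ennreal (\<bar>1 / c * r t\<bar> powr q) \<partial>leb01)"
      by (intro nn_integral_cmult) measurable
    also have "\<dots> \<le> ennreal (1 / B) * (ennreal B * (\<integral>\<^sup>+s. ennreal (\<bar>1 / c * f s\<bar> powr q) \<partial>leb01))"
      unfolding B_def by (intro mult_left_mono maximal_strong_type_normalized le' q) auto
    also have "\<dots> = (\<integral>\<^sup>+s. ennreal ((\<bar>f s\<bar> / c) powr q) \<partial>leb01)"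
      using B c by (simp add: mult.assoc[symmetric] ennreal_mult[symmetric])
    also have "\<dots> \<le> 1" using f False by (simp add: Lnorm_le_def q_def)
    finally show "Lnorm_le v r (B powr v * c)" using False by (simp add: Lnorm_le_def q_def A_def)
  qed (use B in auto)
qed

lemma dyadic_level_exists:
  fixes u :: real
  assumes "0 < u" "u \<le> 1"
  shows "\<exists>j::nat. 1 / 2 ^ Suc j < u \<and> u \<le> 1 / 2 ^ j"
proof -
  define n where "n = (LEAST n. (1/2) ^ n < u)"
  have ex: "\<exists>n. (1/2) ^ n < u" using real_arch_pow_inv[of u "1/2"] assms by auto
  have n: "(1/2) ^ n < u" unfolding n_def using ex by (rule LeastI_ex)
  then obtain j where j: "n = Suc j" using assms by (cases n) auto
  have "\<not> (1/2) ^ j < u" using not_less_Least[of j "\<lambda>n. (1/2) ^ n < u"] j n_def by auto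
  then show ?thesis using n j by (intro exI[of _ j]) (auto simp: power_one_over)
qed

text \<open>
As \<open>b\<close> tends to \<open>0\<close>, the geometric series over the scales grows like \<open>1 / b\<close>, and \<open>1 / \<Gamma>(b)\<close> decays
like \<open>b\<close>.
\<close>

lemma rl_kernel_dyadic_constant:
  assumes "0 < b" "b < 1"
  shows "rGamma b * (2 powr (1 - b) / (1 - 2 powr (- b))) \<le> 4 * rGamma_sup"
proof -
  have "(1/2) powr b * 1 powr (1 - b) \<le> b * (1/2) + (1 - b) * (1::real)"
    by (rule Youngs_inequality_0) (use assms in auto)
  then have "2 powr (- b) \<le> 1 - b / 2" by (simp add: powr_minus powr_divide field_simps)
  then have *: "b / 2 \<le> 1 - 2 powr (- b)" by simp
  have "2 powr (1 - b) \<le> (2::real) powr 1" using assms by (intro powr_mono) auto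
  then have "2 powr (1 - b) / (1 - 2 powr (- b)) \<le> 2 / (b / 2)"
    using * assms by (intro frac_le) auto
  then have "rGamma b * (2 powr (1 - b) / (1 - 2 powr (- b))) \<le> rGamma b * (2 / (b / 2))"
    using rGamma_pos[of b] assms by (intro mult_left_mono) auto
  also have "\<dots> = 4 * rGamma (b + 1)" using assms by (simp add: rGamma_succ[of b])
  also have "\<dots> \<le> 4 * rGamma_sup" using rGamma_le_sup[of "b + 1"] assms by simp
  finally show ?thesis .
qed

text \<open>
The part of the integral at distance about \<open>1 / 2 ^ j\<close> from \<open>t\<close> is a multiple of one of the averages
in the maximal function, and the multiples add up to a bounded constant. Uniformity in \<open>b\<close> is what
permits an order that varies with \<open>t\<close>.
\<close>

lemma rl_abs_le_maximal:
  assumes [measurable]: "f \<in> borel_measurable leb01" and b: "0 < b"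
  shows "rl_abs b f t \<le> ennreal (4 * rGamma_sup) * maximal f t"
proof (cases "1 \<le> b")
  case True
  have "rl_abs b f t \<le> (\<integral>\<^sup>+s. ennreal rGamma_sup * past f 0 t s \<partial>leb01)"
    unfolding rl_abs_def
  proof (intro nn_integral_mono)
    fix s
    have "rl_kernel b (t - s) \<le> rGamma_sup"
    proof (cases "0 < t - s \<and> t - s \<le> 1")
      case True
      then have "rGamma b * (t - s) powr (b - 1) \<le> rGamma_sup * 1"
        using \<open>1 \<le> b\<close> rGamma_pos[of b] rGamma_sup_ge_1
        by (intro mult_mono rGamma_le_sup powr_le1) auto
      with True show ?thesis by (simp add: rl_kernel_def)
    next
      case False
      then show ?thesis using rGamma_sup_ge_1 by (auto simp: rl_kernel_def)
    qed
    moreover have "rl_kernel b (t - s) = 0" if "\<not> (t - 1 / 2 ^ 0 \<le> s \<and> s \<le> t)"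
      using that by (auto simp: rl_kernel_def)
    ultimately show "ennreal (rl_kernel b (t - s)) * ennreal \<bar>f s\<bar> \<le> ennreal rGamma_sup * past f 0 t s"
      by (auto intro!: mult_right_mono ennreal_leI)
  qed
  also have "\<dots> = ennreal rGamma_sup * (\<integral>\<^sup>+s. past f 0 t s \<partial>leb01)"
    by (intro nn_integral_cmult) measurable
  also have "\<dots> \<le> ennreal rGamma_sup * maximal f t"
    using maximal_upper[where j = 0 and t = t and f = f] by (intro mult_left_mono) auto
  also have "\<dots> \<le> ennreal (4 * rGamma_sup) * maximal f t"
    using rGamma_sup_ge_1 by (intro mult_right_mono ennreal_leI) auto
  finally show ?thesis .
next
  case False
  then have b1: "b < 1" by simp
  have G: "0 < rGamma b" using b by (rule rGamma_pos)
  define k where "k j = rGamma b * 2 powr (real (Suc j) * (1 - b))" for j :: nat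
  have k: "0 \<le> k j" for j using G by (simp add: k_def)
  let ?f = "\<lambda>j s. past f j t s"
  have "rl_abs b f t \<le> (\<integral>\<^sup>+s. (\<Sum>j. ennreal (k j) * ?f j s) \<partial>leb01)"
    unfolding rl_abs_def
  proof (intro nn_integral_mono)
    fix s
    show "ennreal (rl_kernel b (t - s)) * ennreal \<bar>f s\<bar> \<le> (\<Sum>j. ennreal (k j) * ?f j s)"
    proof (cases "0 < t - s \<and> t - s \<le> 1")
      case True
      then obtain j where j: "1 / 2 ^ Suc j < t - s" "t - s \<le> 1 / 2 ^ j"
        using dyadic_level_exists[of "t - s"] by auto
      have "(t - s) powr (b - 1) \<le> (1 / 2 ^ Suc j) powr (b - 1)"
        using j b1 by (intro powr_mono2') auto
      also have "\<dots> = 2 powr (real (Suc j) * (1 - b))"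
      proof -
        have "1 / 2 ^ Suc j = (2::real) powr (- real (Suc j))"
          by (simp only: powr_minus powr_realpow[of 2] zero_less_numeral divide_inverse mult_1)
        then show ?thesis by (simp add: powr_powr algebra_simps)
      qed
      finally have "rl_kernel b (t - s) \<le> k j"
        using True G by (simp add: rl_kernel_def k_def)
      then have "ennreal (rl_kernel b (t - s)) * ennreal \<bar>f s\<bar> \<le> ennreal (k j) * ?f j s"
        using j True by (auto intro!: mult_right_mono ennreal_leI)
      also have "\<dots> \<le> (\<Sum>j. ennreal (k j) * ?f j s)"
        using sum_le_suminf[of "\<lambda>j. ennreal (k j) * ?f j s" "{j}"] by simp
      finally show ?thesis .
    next
      case False
      then show ?thesis by (auto simp: rl_kernel_def)
    qed
  qed
  also have "\<dots> = (\<Sum>j. ennreal (k j) * (\<integral>\<^sup>+s. ?f j s \<partial>leb01))"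
    by (subst nn_integral_suminf) (auto simp: nn_integral_cmult)
  also have "\<dots> \<le> (\<Sum>j. ennreal (rGamma b * 2 powr (1 - b) * (2 powr (- b)) ^ j) * maximal f t)"
  proof (intro suminf_le allI)
    fix j
    have "ennreal (k j) * (\<integral>\<^sup>+s. ?f j s \<partial>leb01) = ennreal (k j / 2 ^ j) * (ennreal (2 ^ j) * (\<integral>\<^sup>+s. ?f j s \<partial>leb01))"
      using k[of j] by (simp add: mult.assoc[symmetric] ennreal_mult[symmetric])
    also have "\<dots> \<le> ennreal (k j / 2 ^ j) * maximal f t"
      by (intro mult_left_mono maximal_upper) auto
    also have "k j / 2 ^ j = rGamma b * 2 powr (1 - b) * (2 powr (- b)) ^ j"
    proof -
      have "2 powr (real (Suc j) * (1 - b)) = 2 powr (1 - b) * 2 powr (real j) * 2 powr (- b * real j)"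
        by (simp add: powr_add[symmetric] algebra_simps)
      moreover have "2 powr (- b * real j) = (2 powr (- b)) ^ j"
        using powr_realpow[of "2 powr (- b)" j] by (simp add: powr_powr)
      ultimately show ?thesis
        by (simp add: k_def powr_realpow)
    qed
    finally show "ennreal (k j) * (\<integral>\<^sup>+s. ?f j s \<partial>leb01) \<le> ennreal (rGamma b * 2 powr (1 - b) * (2 powr (- b)) ^ j) * maximal f t" .
  qed auto
  also have "\<dots> = (\<Sum>j. ennreal (rGamma b * 2 powr (1 - b) * (2 powr (- b)) ^ j)) * maximal f t"
    by (rule ennreal_suminf_multc)
  also have "(\<Sum>j. ennreal (rGamma b * 2 powr (1 - b) * (2 powr (- b)) ^ j)) = ennreal (rGamma b * 2 powr (1 - b) * (1 / (1 - 2 powr (- b))))"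
  proof (rule suminf_ennreal_eq)
    have "2 powr (- b) < (1::real)" using b by (simp add: powr_less_one)
    then show "(\<lambda>j. rGamma b * 2 powr (1 - b) * (2 powr (- b)) ^ j) sums (rGamma b * 2 powr (1 - b) * (1 / (1 - 2 powr (- b))))"
      by (intro sums_mult geometric_sums) auto
  qed (use G in auto)
  also have "\<dots> * maximal f t \<le> ennreal (4 * rGamma_sup) * maximal f t"
    using rl_kernel_dyadic_constant[OF b b1] by (intro mult_right_mono ennreal_leI) auto
  finally show ?thesis .
qed

lemma rl_abs_finite:
  assumes "f \<in> borel_measurable leb01" "0 < b" "maximal f t < \<infinity>"
  shows "rl_abs b f t < \<infinity>"
proof -
  have "ennreal (4 * rGamma_sup) * maximal f t < \<infinity>"
    using assms(3) by (simp add: ennreal_mult_less_top)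
  with rl_abs_le_maximal[OF assms(1,2), of t] show ?thesis by (rule le_less_trans)
qed

section \<open>Dyadic discretization of a fractional integral\<close>

text \<open>
The left end of the dyadic interval of \<open>t\<close> replaces \<open>t\<close>. Dropping the kernel at distances below the
mesh width keeps it bounded; otherwise a singularity would be spread over a whole interval, and the
kernel would not be integrable in \<open>t\<close> with a bound uniform in \<open>s\<close>.
\<close>

definition step_kernel :: "real \<Rightarrow> nat \<Rightarrow> real \<Rightarrow> real \<Rightarrow> real" where
  "step_kernel b k t s =
     (if 1 / 2 ^ k \<le> of_int \<lfloor>2 ^ k * t\<rfloor> / 2 ^ k - s
      then rl_kernel b (of_int \<lfloor>2 ^ k * t\<rfloor> / 2 ^ k - s) else 0)"

definition rl_step :: "real \<Rightarrow> nat \<Rightarrow> (real \<Rightarrow> real) \<Rightarrow> real \<Rightarrow> real" where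
  "rl_step b k f t = (\<integral>s. step_kernel b k t s * f s \<partial>leb01)"

text \<open>
A majorant of the discretization error that depends on \<open>x = t - s\<close> only, so that Young's inequality
applies: close to the singularity the two kernels are bounded separately, and further away their
difference by the mesh width times the derivative.
\<close>

definition step_error :: "real \<Rightarrow> real \<Rightarrow> real \<Rightarrow> real" where
  "step_error b h x = rGamma b *
     ((x powr (b - 1) + h powr (b - 1)) * indicator {0..2 * h} x
      + h * (x / 2) powr (b - 2) * indicator {2 * h..} x)"

lemma powr_diff_le:
  fixes x y b :: real
  assumes "0 < y" "y \<le> x" "b \<le> 1" "0 \<le> b"
  shows "y powr (b - 1) - x powr (b - 1) \<le> (x - y) * y powr (b - 2)"
proof (cases "y = x")
  case False
  then have "y < x" using assms by simp
  have "\<exists>z>y. z < x \<and> x powr (b - 1) - y powr (b - 1) = (x - y) * ((b - 1) * z powr (b - 2))"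
    by (rule MVT2[OF \<open>y < x\<close>])
       (use assms in \<open>auto intro!: derivative_eq_intros simp: algebra_simps\<close>)
  then obtain z where z: "y < z" "z < x" "x powr (b - 1) - y powr (b - 1) = (x - y) * ((b - 1) * z powr (b - 2))"
    by blast
  have "y powr (b - 1) - x powr (b - 1) = (x - y) * ((1 - b) * z powr (b - 2))"
    using z(3) by (simp add: algebra_simps)
  also have "\<dots> \<le> (x - y) * (1 * y powr (b - 2))"
    using assms z by (intro mult_left_mono mult_mono powr_mono2') auto
  finally show ?thesis by simp
qed auto

lemma step_kernel_error:
  assumes b: "0 < b" "b \<le> 1" and t: "t \<in> {0..1}" and s: "s \<in> {0..1}"
  shows "\<bar>rl_kernel b (t - s) - step_kernel b k t s\<bar> \<le> step_error b (1 / 2 ^ k) (t - s)"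
proof -
  define h :: real where "h = 1 / 2 ^ k"
  define c :: real where "c = of_int \<lfloor>2 ^ k * t\<rfloor> / 2 ^ k"
  define x where "x = t - s"
  define y where "y = c - s"
  have h: "0 < h" by (simp add: h_def)
  have G: "0 < rGamma b" using b by (intro rGamma_pos)
  have "c \<le> t" "t < c + h"
  proof -
    have "of_int \<lfloor>2 ^ k * t\<rfloor> \<le> 2 ^ k * t" by (rule of_int_floor_le)
    then show "c \<le> t" unfolding c_def by (simp add: pos_divide_le_eq mult.commute)
    have "2 ^ k * t < of_int \<lfloor>2 ^ k * t\<rfloor> + 1" by linarith
    then have "t < (of_int \<lfloor>2 ^ k * t\<rfloor> + 1) / 2 ^ k" by (simp add: pos_less_divide_eq mult.commute)
    then show "t < c + h" by (simp add: c_def h_def add_divide_distrib)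
  qed
  then have xy: "y \<le> x" "x < y + h" by (auto simp: x_def y_def)
  have x1: "x \<le> 1" using t s by (auto simp: x_def)
  have K: "rl_kernel b (t - s) = (if 0 < x then rGamma b * x powr (b - 1) else 0)"
    using x1 by (auto simp: rl_kernel_def x_def)
  have K': "step_kernel b k t s = (if h \<le> y then rGamma b * y powr (b - 1) else 0)"
    using x1 xy h by (auto simp: step_kernel_def rl_kernel_def y_def c_def h_def[symmetric])
  have nonneg: "0 \<le> rGamma b * ((x powr (b - 1) + h powr (b - 1)) * indicator {0..2 * h} x)"
    "0 \<le> rGamma b * (h * (x / 2) powr (b - 2) * indicator {2 * h..} x)"
    using G h by auto
  consider "x \<le> 0" | "0 < x" "x < 2 * h" | "2 * h \<le> x" by linarith
  then have "\<bar>rl_kernel b (t - s) - step_kernel b k t s\<bar> \<le> step_error b h x"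
  proof cases
    case 1
    then have "rl_kernel b (t - s) = 0" "step_kernel b k t s = 0" using xy h by (auto simp: K K')
    then show ?thesis using nonneg by (simp add: step_error_def distrib_left)
  next
    case 2
    have "step_kernel b k t s \<le> rGamma b * h powr (b - 1)"
      unfolding K' using G h b by (auto intro!: mult_left_mono powr_mono2')
    moreover have "0 \<le> step_kernel b k t s" unfolding K' using G by auto
    ultimately have "\<bar>rl_kernel b (t - s) - step_kernel b k t s\<bar> \<le> rGamma b * x powr (b - 1) + rGamma b * h powr (b - 1)"
    proof -
      have "0 \<le> rGamma b * x powr (b - 1)" using G by simp
      moreover have "rl_kernel b (t - s) = rGamma b * x powr (b - 1)" using 2 by (simp add: K)
      ultimately show ?thesis
        using \<open>step_kernel b k t s \<le> _\<close> \<open>0 \<le> step_kernel b k t s\<close> by linarith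
    qed
    also have "\<dots> = rGamma b * ((x powr (b - 1) + h powr (b - 1)) * indicator {0..2 * h} x)"
      using 2 by (simp add: distrib_left)
    also have "\<dots> \<le> step_error b h x"
      using nonneg(2) by (simp add: step_error_def distrib_left)
    finally show ?thesis .
  next
    case 3
    then have y: "h \<le> y" "x / 2 \<le> y" "0 < x" using xy h by auto
    have "x powr (b - 1) \<le> y powr (b - 1)" using y xy h b by (intro powr_mono2') auto
    then have "\<bar>rl_kernel b (t - s) - step_kernel b k t s\<bar> = rGamma b * (y powr (b - 1) - x powr (b - 1))"
      unfolding K K' using y G by (simp add: right_diff_distrib[symmetric] abs_mult)
    also have "\<dots> \<le> rGamma b * ((x - y) * y powr (b - 2))"
      using y h xy b G by (intro mult_left_mono powr_diff_le) auto
    also have "\<dots> \<le> rGamma b * (h * (x / 2) powr (b - 2))"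
      using y h xy b G by (intro mult_left_mono mult_mono powr_mono2') auto
    also have "\<dots> = rGamma b * (h * (x / 2) powr (b - 2) * indicator {2 * h..} x)"
      using 3 by simp
    also have "\<dots> \<le> step_error b h x"
      using nonneg(1) by (simp add: step_error_def distrib_left)
    finally show ?thesis .
  qed
  then show ?thesis by (simp add: h_def x_def)
qed

lemma step_error_nonneg: "0 < b \<Longrightarrow> 0 \<le> h \<Longrightarrow> 0 \<le> step_error b h x"
  using rGamma_pos[of b] by (simp add: step_error_def)

lemma step_error_measurable [measurable]: "step_error b h \<in> borel_measurable borel"
  unfolding step_error_def[abs_def] by measurable

text \<open>
The singularity contributes \<open>h powr b / b\<close> and the derivative \<open>h powr b / (1 - b)\<close>, up to constants.
The first is absorbed by \<open>1 / \<Gamma>(b) = b / \<Gamma>(b + 1)\<close>, the second is bounded for \<open>b \<le> 1/2\<close>.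
\<close>

lemma step_error_integral:
  assumes b: "0 < b" "b \<le> 1/2" and h: "0 < h"
  shows "(\<integral>\<^sup>+x. ennreal (step_error b h x) \<partial>lborel) \<le> ennreal (5 * rGamma_sup * h powr b)"
proof -
  have G: "0 < rGamma b" using b by (intro rGamma_pos)
  define c where "c = rGamma b * (h * (1/2) powr (b - 2))"
  have c: "0 \<le> c" using G h by (simp add: c_def)
  have I1: "(\<integral>\<^sup>+x. ennreal (x powr (b - 1)) * indicator {0..2 * h} x \<partial>lborel) = ennreal ((2 * h) powr b / b)"
    using nn_integral_powr_Icc0[of "b - 1" "2 * h"] b h by simp
  have I2: "(\<integral>\<^sup>+x. ennreal (x powr (b - 2)) * indicator {2 * h..} x \<partial>lborel) = ennreal ((2 * h) powr (b - 1) / (1 - b))"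
  proof -
    have "(\<integral>\<^sup>+x. ennreal (x powr (b - 2)) * indicator {2 * h..} x \<partial>lborel) = ennreal (- ((2 * h) powr (b - 2 + 1)) / (b - 2 + 1))"
      by (rule nn_integral_has_integral_lebesgue'[OF _ has_integral_powr_to_inf]) (use b h in auto)
    also have "- ((2 * h) powr (b - 2 + 1)) / (b - 2 + 1) = (2 * h) powr (b - 1) / (1 - b)"
      using b by (simp add: divide_simps) (simp add: algebra_simps)
    finally show ?thesis .
  qed
  have I3: "(\<integral>\<^sup>+x. indicator {0..2 * h} x \<partial>lborel) = ennreal (2 * h)"
    using h by simp
  have "(\<integral>\<^sup>+x. ennreal (step_error b h x) \<partial>lborel) =
     (\<integral>\<^sup>+x. ennreal (rGamma b) * (ennreal (x powr (b - 1)) * indicator {0..2 * h} x)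
        + ennreal (rGamma b * h powr (b - 1)) * indicator {0..2 * h} x
        + ennreal c * (ennreal (x powr (b - 2)) * indicator {2 * h..} x) \<partial>lborel)"
  proof (rule nn_integral_cong)
    fix x :: real
    have i: "indicator A x = ennreal (indicator A x)" for A :: "real set"
      by (simp split: split_indicator)
    have e: "step_error b h x = rGamma b * (x powr (b - 1) * indicator {0..2 * h} x)
        + rGamma b * h powr (b - 1) * indicator {0..2 * h} x + c * (x powr (b - 2) * indicator {2 * h..} x)"
    proof (cases "2 * h \<le> x")
      case True
      then have "(x / 2) powr (b - 2) = x powr (b - 2) * (1 / 2) powr (b - 2)"
        using h by (simp add: powr_divide)
      then show ?thesis by (simp add: step_error_def c_def algebra_simps)
    qed (simp add: step_error_def algebra_simps)
    show "ennreal (step_error b h x) = ennreal (rGamma b) * (ennreal (x powr (b - 1)) * indicator {0..2 * h} x)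
        + ennreal (rGamma b * h powr (b - 1)) * indicator {0..2 * h} x
        + ennreal c * (ennreal (x powr (b - 2)) * indicator {2 * h..} x)"
      unfolding i e using G c by (simp add: ennreal_mult)
  qed
  also have "\<dots> = ennreal (rGamma b) * ennreal ((2 * h) powr b / b) + ennreal (rGamma b * h powr (b - 1)) * ennreal (2 * h)
      + ennreal c * ennreal ((2 * h) powr (b - 1) / (1 - b))"
    by (simp add: nn_integral_add nn_integral_cmult I1 I2 I3[simplified])
  also have "\<dots> = ennreal (rGamma b * ((2 * h) powr b / b) + rGamma b * h powr (b - 1) * (2 * h) + c * ((2 * h) powr (b - 1) / (1 - b)))"
  proof -
    have "0 \<le> rGamma b * ((2 * h) powr b / b)" "0 \<le> rGamma b * h powr (b - 1) * (2 * h)"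
      "0 \<le> c * ((2 * h) powr (b - 1) / (1 - b))"
      using G c b h by auto
    moreover have "ennreal (rGamma b) * ennreal ((2 * h) powr b / b) = ennreal (rGamma b * ((2 * h) powr b / b))"
      "ennreal (rGamma b * h powr (b - 1)) * ennreal (2 * h) = ennreal (rGamma b * h powr (b - 1) * (2 * h))"
      "ennreal c * ennreal ((2 * h) powr (b - 1) / (1 - b)) = ennreal (c * ((2 * h) powr (b - 1) / (1 - b)))"
      by (rule ennreal_mult[symmetric]; use G c b h in simp)+
    ultimately show ?thesis by (simp only: ennreal_plus add_nonneg_nonneg)
  qed
  also have "rGamma b * ((2 * h) powr b / b) + rGamma b * h powr (b - 1) * (2 * h) + c * ((2 * h) powr (b - 1) / (1 - b))
     = rGamma b * h powr b * (2 powr b / b + 2 + 2 / (1 - b))"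
  proof -
    have 1: "h * h powr (b - 1) = h powr b" using powr_mult_base[of h "b - 1"] h by simp
    have 2: "(1/2) powr (b - 2) * 2 powr (b - 1) = (2::real)"
    proof -
      have "(1/2) powr (b - 2) = (2::real) powr (2 - b)"
        by (simp add: powr_divide powr_minus_divide[symmetric])
      then show ?thesis by (simp add: powr_add[symmetric])
    qed
    have 3: "c * ((2 * h) powr (b - 1) / (1 - b)) = rGamma b * (h * h powr (b - 1)) * ((1/2) powr (b - 2) * 2 powr (b - 1)) / (1 - b)"
      using h by (simp add: c_def powr_mult)
    have 4: "rGamma b * h powr (b - 1) * (2 * h) = rGamma b * (h * h powr (b - 1)) * 2"
      by simp
    have 5: "(2 * h) powr b = 2 powr b * h powr b" using h by (simp add: powr_mult)
    show ?thesis unfolding 3 4 5 unfolding 1 2 using b by (simp add: field_simps)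
  qed
  also have "ennreal \<dots> \<le> ennreal (5 * rGamma_sup * h powr b)"
  proof (rule ennreal_leI)
    have "2 powr b \<le> 2 powr (1::real)" using b by (intro powr_mono) auto
    then have "2 powr b / b \<le> 2 / b" using b by (intro divide_right_mono) auto
    moreover have "2 / (1 - b) \<le> 2 / (1 / 2)" using b by (intro divide_left_mono) auto
    moreover have "6 \<le> 3 / b" using b by (simp add: field_simps)
    moreover have "2 / b + 3 / b = 5 / b" by (simp add: add_divide_distrib[symmetric])
    ultimately have "2 powr b / b + 2 + 2 / (1 - b) \<le> 5 / b" by simp
    then have "rGamma b * h powr b * (2 powr b / b + 2 + 2 / (1 - b)) \<le> rGamma b * h powr b * (5 / b)"
      using G h by (intro mult_left_mono) auto
    also have "\<dots> = 5 * rGamma (b + 1) * h powr b"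
      using rGamma_succ[of b] b by simp
    also have "\<dots> \<le> 5 * rGamma_sup * h powr b"
      using rGamma_le_sup[of "b + 1"] b by (intro mult_right_mono) auto
    finally show "rGamma b * h powr b * (2 powr b / b + 2 + 2 / (1 - b)) \<le> 5 * rGamma_sup * h powr b" .
  qed
  finally show ?thesis .
qed

lemma step_kernel_measurable_pair [measurable]:
  "(\<lambda>z. step_kernel b k (fst z) (snd z)) \<in> borel_measurable (leb01 \<Otimes>\<^sub>M leb01)"
  unfolding step_kernel_def by measurable

lemma step_kernel_measurable [measurable]:
  "step_kernel b k t \<in> borel_measurable leb01"
  unfolding step_kernel_def by measurable

lemma rl_step_measurable [measurable (raw)]:
  assumes [measurable]: "f \<in> borel_measurable leb01"
  shows "rl_step b k f \<in> borel_measurable leb01"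
proof -
  have "(\<lambda>z. step_kernel b k (fst z) (snd z) * f (snd z)) \<in> borel_measurable (leb01 \<Otimes>\<^sub>M leb01)"
    by measurable
  then show ?thesis
    unfolding rl_step_def[abs_def]
    by (intro leb01.borel_measurable_lebesgue_integral) (simp add: case_prod_beta')
qed

lemma step_kernel_bounds:
  assumes b: "0 < b" "b \<le> 1"
  shows "0 \<le> step_kernel b k t s" "step_kernel b k t s \<le> rGamma b * (1 / 2 ^ k) powr (b - 1)"
  using rGamma_pos[OF b(1)] b
  by (auto simp: step_kernel_def rl_kernel_def intro!: mult_left_mono powr_mono2')

lemma rl_step_integrable:
  assumes f: "integrable leb01 f" and b: "0 < b" "b \<le> 1"
  shows "integrable leb01 (\<lambda>s. step_kernel b k t s * f s)"
proof (rule Bochner_Integration.integrable_bound)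
  show "integrable leb01 (\<lambda>s. rGamma b * (1 / 2 ^ k) powr (b - 1) * f s)" using f by simp
  have [measurable]: "f \<in> borel_measurable leb01" using f by simp
  show "(\<lambda>s. step_kernel b k t s * f s) \<in> borel_measurable leb01" by measurable
  show "AE s in leb01. norm (step_kernel b k t s * f s) \<le> norm (rGamma b * (1 / 2 ^ k) powr (b - 1) * f s)"
  proof (rule AE_I2)
    fix s
    have "\<bar>step_kernel b k t s\<bar> \<le> \<bar>rGamma b * (1 / 2 ^ k) powr (b - 1)\<bar>"
      using step_kernel_bounds[OF b, of k t s] by linarith
    then show "norm (step_kernel b k t s * f s) \<le> norm (rGamma b * (1 / 2 ^ k) powr (b - 1) * f s)"
      unfolding real_norm_def abs_mult by (intro mult_right_mono) auto
  qed
qed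

lemma rl_step_error:
  assumes f: "Lnorm_le u f c" and c: "0 < c" and u: "0 \<le> u" "u \<le> 1" and b: "0 < b" "b \<le> 1/2"
  shows "Lnorm_le u (\<lambda>t. rl b f t - rl_step b k f t) (5 * rGamma_sup * (1 / 2 ^ k) powr b * c)"
proof -
  have [measurable]: "f \<in> borel_measurable leb01" using f by (rule Lnorm_le_measurable)
  have fint: "integrable leb01 f" by (rule Lnorm_le_integrable[OF f c u])
  let ?E = "step_error b (1 / 2 ^ k)"
  have E0: "0 \<le> ?E x" for x using b by (intro step_error_nonneg) auto
  have "AE t in leb01. maximal f t < \<infinity>" by (rule maximal_finite_AE[OF f c u])
  then have "AE t in leb01. ennreal \<bar>rl b f t - rl_step b k f t\<bar> \<le> (\<integral>\<^sup>+s. ennreal (?E (t - s)) * ennreal \<bar>f s\<bar> \<partial>leb01)"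
    using AE_space
  proof eventually_elim
    case (elim t)
    have i1: "integrable leb01 (\<lambda>s. rl_kernel b (t - s) * f s)"
      by (intro rl_integrable rl_abs_finite elim b) measurable
    have i2: "integrable leb01 (\<lambda>s. step_kernel b k t s * f s)"
      using b by (intro rl_step_integrable fint) auto
    have i: "integrable leb01 (\<lambda>s. rl_kernel b (t - s) * f s - step_kernel b k t s * f s)"
      by (rule Bochner_Integration.integrable_diff[OF i1 i2])
    have "rl b f t - rl_step b k f t = (\<integral>s. rl_kernel b (t - s) * f s - step_kernel b k t s * f s \<partial>leb01)"
      unfolding rl_def rl_step_def by (rule Bochner_Integration.integral_diff[OF i1 i2, symmetric])
    then have "ennreal \<bar>rl b f t - rl_step b k f t\<bar> \<le> (\<integral>\<^sup>+s. ennreal (norm (rl_kernel b (t - s) * f s - step_kernel b k t s * f s)) \<partial>leb01)"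
      using integral_norm_bound_ennreal[OF i] by simp
    also have "\<dots> \<le> (\<integral>\<^sup>+s. ennreal (?E (t - s)) * ennreal \<bar>f s\<bar> \<partial>leb01)"
    proof (rule nn_integral_mono)
      fix s assume "s \<in> space leb01"
      then have "\<bar>rl_kernel b (t - s) - step_kernel b k t s\<bar> \<le> ?E (t - s)"
        using elim b by (intro step_kernel_error) auto
      then have "norm (rl_kernel b (t - s) * f s - step_kernel b k t s * f s) \<le> ?E (t - s) * \<bar>f s\<bar>"
        unfolding real_norm_def left_diff_distrib[symmetric] abs_mult by (intro mult_right_mono) auto
      then show "ennreal (norm (rl_kernel b (t - s) * f s - step_kernel b k t s * f s)) \<le> ennreal (?E (t - s)) * ennreal \<bar>f s\<bar>"
        using E0 by (simp add: ennreal_mult[symmetric] ennreal_leI)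
    qed
    finally show ?case .
  qed
  moreover have "(\<integral>\<^sup>+x. ennreal (?E x) \<partial>lborel) \<le> ennreal (5 * rGamma_sup * (1 / 2 ^ k) powr b)"
    by (rule step_error_integral[OF b]) simp
  moreover have "0 < 5 * rGamma_sup * (1 / 2 ^ k) powr b" using rGamma_sup_ge_1 by simp
  ultimately show ?thesis
    by (intro Lnorm_le_convolution[OF f, where E = ?E] E0 c u) auto
qed

text \<open>
With mesh width one, the kernel is dropped altogether, except at the endpoint \<open>t = 1\<close>.
\<close>

lemma rl_step_0: "AE t in leb01. rl_step b 0 f t = 0"
proof -
  show ?thesis
    using AE_leb01_lt_1
  proof eventually_elim
    case (elim t)
    then have "\<lfloor>t\<rfloor> = 0" by (auto simp: floor_eq_iff)
    then have "rl_step b 0 f t = (\<integral>s. 0 \<partial>leb01)"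
      unfolding rl_step_def
      by (intro Bochner_Integration.integral_cong refl) (auto simp: step_kernel_def)
    then show ?case by simp
  qed
qed

definition cell_constant :: "nat \<Rightarrow> (real \<Rightarrow> real) \<Rightarrow> bool" where
  "cell_constant k h \<longleftrightarrow> (\<exists>X :: int \<Rightarrow> real. \<forall>t. h t = X \<lfloor>2 ^ k * t\<rfloor>)"

definition rl_increment :: "real \<Rightarrow> nat \<Rightarrow> (real \<Rightarrow> real) \<Rightarrow> real \<Rightarrow> real" where
  "rl_increment b k f t = rl_step b (Suc k) f t - rl_step b k f t"

lemma rl_increment_measurable [measurable (raw)]:
  assumes [measurable]: "f \<in> borel_measurable leb01"
  shows "rl_increment b k f \<in> borel_measurable leb01"
  unfolding rl_increment_def[abs_def] by measurable

lemma floor_half: "\<lfloor>x / 2\<rfloor> = \<lfloor>x\<rfloor> div 2" for x :: real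
  using floor_divide_real_eq_div[of 2 x] by simp

lemma rl_increment_cell_constant: "cell_constant (Suc k) (rl_increment b k f)"
proof -
  define X where "X k i = (\<integral>s. (if 1 / 2 ^ k \<le> of_int i / 2 ^ k - s
      then rl_kernel b (of_int i / 2 ^ k - s) else 0) * f s \<partial>leb01)" for k i
  have X: "rl_step b k f t = X k \<lfloor>2 ^ k * t\<rfloor>" for k t
    by (simp add: rl_step_def X_def step_kernel_def)
  have "\<lfloor>2 ^ k * t\<rfloor> = \<lfloor>2 ^ Suc k * t\<rfloor> div 2" for t :: real
    using floor_half[of "2 ^ Suc k * t"] by simp
  then have "rl_increment b k f t = X (Suc k) \<lfloor>2 ^ Suc k * t\<rfloor> - X k (\<lfloor>2 ^ Suc k * t\<rfloor> div 2)" for t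
    by (simp only: rl_increment_def X)
  then show ?thesis unfolding cell_constant_def
    by (intro exI[of _ "\<lambda>i. X (Suc k) i - X k (i div 2)"]) blast
qed

lemma half_power_powr: "(1 / 2 ^ k) powr b = 2 powr (- (b * real k))"
proof -
  have "1 / 2 ^ k = (2::real) powr (- real k)"
    by (simp add: powr_minus powr_realpow divide_inverse)
  then show ?thesis by (simp add: powr_powr mult.commute)
qed

lemma rl_increment_norm:
  assumes f: "Lnorm_le u f c" and c: "0 < c" and u: "0 \<le> u" "u \<le> 1" and b: "0 < b" "b \<le> 1/2"
  shows "Lnorm_le u (rl_increment b k f) (15 * rGamma_sup * 2 powr (- (b * real (Suc k))) * c)"
proof -
  have [measurable]: "f \<in> borel_measurable leb01" using f by (rule Lnorm_le_measurable)
  have S: "0 < rGamma_sup" using rGamma_sup_ge_1 by simp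
  let ?e = "\<lambda>k. 5 * rGamma_sup * (1 / 2 ^ k) powr b * c"
  have e: "0 < ?e k" for k using S c by simp
  have "Lnorm_le u (\<lambda>t. (rl b f t - rl_step b k f t) + - (rl b f t - rl_step b (Suc k) f t)) (?e k + 1 * ?e (Suc k))"
  proof (rule Lnorm_le_add[OF rl_step_error[OF f c u b]])
    show "Lnorm_le u (\<lambda>t. - (rl b f t - rl_step b (Suc k) f t)) (1 * ?e (Suc k))"
      by (rule Lnorm_le_dominated[OF rl_step_error[OF f c u b]]) (use e[of "Suc k"] u in auto)
  qed (simp_all only: mult_1 e u)
  moreover have "(\<lambda>t. (rl b f t - rl_step b k f t) + - (rl b f t - rl_step b (Suc k) f t)) = rl_increment b k f"
    by (auto simp: rl_increment_def)
  ultimately have 1: "Lnorm_le u (rl_increment b k f) (?e k + ?e (Suc k))" by simp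
  have "?e k + ?e (Suc k) \<le> 15 * rGamma_sup * 2 powr (- (b * real (Suc k))) * c"
  proof -
    have "2 powr (- (b * real k)) = 2 powr b * 2 powr (- (b * real (Suc k)))"
      by (simp add: powr_add[symmetric] algebra_simps)
    also have "\<dots> \<le> 2 powr 1 * 2 powr (- (b * real (Suc k)))"
      using b by (intro mult_right_mono powr_mono) auto
    finally have "2 powr (- (b * real k)) \<le> 2 * 2 powr (- (b * real (Suc k)))" by simp
    then have "5 * rGamma_sup * c * 2 powr (- (b * real k)) \<le> 5 * rGamma_sup * c * (2 * 2 powr (- (b * real (Suc k))))"
      using S c by (intro mult_left_mono) auto
    then show ?thesis unfolding half_power_powr by (simp add: algebra_simps)
  qed
  from Lnorm_le_mono[OF 1 this add_pos_pos[OF e e] u(1)] show ?thesis .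
qed

text \<open>
The errors are summable in \<open>L\<^sub>1\<close>, so that almost everywhere their sum converges and they tend
to zero.
\<close>

lemma rl_step_tendsto_AE:
  assumes f: "Lnorm_le u f c" and c: "0 < c" and u: "0 \<le> u" "u \<le> 1" and b: "0 < b" "b \<le> 1/2"
  shows "AE t in leb01. (\<lambda>k. rl_step b k f t) \<longlonglongrightarrow> rl b f t"
proof -
  have [measurable]: "f \<in> borel_measurable leb01" using f by (rule Lnorm_le_measurable)
  have f1: "Lnorm_le 1 f c" by (rule Lnorm_le_inclusion[OF f u c])
  define q where "q = (1/2) powr b"
  have q: "0 < q" "q < 1" using b powr_less_mono2[of b "1/2" 1] by (auto simp: q_def)
  let ?d = "\<lambda>k t. rl b f t - rl_step b k f t"
  let ?C = "5 * rGamma_sup * c"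
  have C: "0 < ?C" using rGamma_sup_ge_1 c by simp
  have le: "(\<integral>\<^sup>+t. ennreal \<bar>?d k t\<bar> \<partial>leb01) \<le> ennreal (?C * q ^ k)" for k
  proof -
    have "(1 / 2 ^ k) powr b = q ^ k"
    proof -
      have "(1 / 2 ^ k) = (1 / 2 :: real) powr real k" by (simp add: powr_realpow power_one_over)
      then have "(1 / 2 ^ k) powr b = q powr real k" by (simp add: q_def powr_powr mult.commute)
      then show ?thesis using q by (simp add: powr_realpow)
    qed
    then have "Lnorm_le 1 (?d k) (?C * q ^ k)"
      using rl_step_error[OF f1 c _ _ b, of k] by (simp add: mult_ac)
    then show ?thesis using C q by (intro Lnorm_le_integral) auto
  qed
  have "(\<integral>\<^sup>+t. (\<Sum>k. ennreal \<bar>?d k t\<bar>) \<partial>leb01) = (\<Sum>k. \<integral>\<^sup>+t. ennreal \<bar>?d k t\<bar> \<partial>leb01)"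
    by (rule nn_integral_suminf) measurable
  also have "\<dots> \<le> (\<Sum>k. ennreal (?C * q ^ k))"
    by (intro suminf_le le) auto
  also have "\<dots> = ennreal (?C * (1 / (1 - q)))"
  proof (rule suminf_ennreal_eq)
    show "(\<lambda>k. ?C * q ^ k) sums (?C * (1 / (1 - q)))"
      by (intro sums_mult geometric_sums) (use q in simp)
    show "0 \<le> ?C * q ^ k" for k
      by (rule mult_nonneg_nonneg) (use C q in auto)
  qed
  also have "\<dots> < \<infinity>" by simp
  finally have "AE t in leb01. (\<Sum>k. ennreal \<bar>?d k t\<bar>) \<noteq> \<infinity>"
    by (intro nn_integral_PInf_AE) auto
  then show ?thesis
  proof eventually_elim
    case (elim t)
    then have "summable (\<lambda>k. \<bar>?d k t\<bar>)" by (intro summable_suminf_not_top) auto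
    then have "(\<lambda>k. \<bar>?d k t\<bar>) \<longlonglongrightarrow> 0" by (rule summable_LIMSEQ_zero)
    then have "(\<lambda>k. rl b f t - ?d k t) \<longlonglongrightarrow> rl b f t - 0"
      by (intro tendsto_diff tendsto_const) (simp add: tendsto_rabs_zero_iff)
    then show ?case by simp
  qed
qed

section \<open>Rounding of dyadic step functions\<close>

text \<open>
A partial sum of the generating function of the absolute values of the integers.
\<close>

lemma sum_powers_symmetric:
  fixes x :: real
  assumes "0 < x" "x < 1"
  shows "(\<Sum>j\<in>{-int n..int n}. x ^ nat \<bar>j\<bar>) \<le> (1 + x) / (1 - x)"
proof -
  have "(\<Sum>j\<in>{-int n..int n}. x ^ nat \<bar>j\<bar>) = (1 + x - 2 * x ^ Suc n) / (1 - x)"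
  proof (induction n)
    case 0
    then show ?case using assms by (simp add: field_simps)
  next
    case (Suc n)
    have "{-int (Suc n)..int (Suc n)} = insert (-int (Suc n)) (insert (int (Suc n)) {-int n..int n})"
      by auto
    then have "(\<Sum>j\<in>{-int (Suc n)..int (Suc n)}. x ^ nat \<bar>j\<bar>) = 2 * x ^ Suc n + (\<Sum>j\<in>{-int n..int n}. x ^ nat \<bar>j\<bar>)"
      by (simp add: nat_add_distrib)
    also have "\<dots> = (1 + x - 2 * x ^ Suc (Suc n)) / (1 - x)"
      unfolding Suc.IH using assms by (simp add: field_simps)
    finally show ?case .
  qed
  also have "\<dots> \<le> (1 + x) / (1 - x)" using assms by (intro divide_right_mono) auto
  finally show ?thesis .
qed

definition int_vectors :: "'i set \<Rightarrow> real \<Rightarrow> ('i \<Rightarrow> int) set" where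
  "int_vectors I s = {z \<in> I \<rightarrow>\<^sub>E UNIV. real_of_int (\<Sum>i\<in>I. \<bar>z i\<bar>) \<le> s}"

text \<open>
Expanding the product of the one-dimensional generating functions weights a vector by \<open>x\<close> to the
power of its \<open>l\<^sub>1\<close> norm, which is at least \<open>x powr s\<close> for the vectors that are counted.
\<close>

lemma int_vectors_card:
  fixes x :: real
  assumes I: "finite I" and x: "0 < x" "x < 1"
  shows "finite (int_vectors I s) \<and> real (card (int_vectors I s)) * x powr s \<le> ((1 + x) / (1 - x)) ^ card I"
proof -
  define n where "n = nat \<lfloor>s\<rfloor>"
  define B where "B = {-int n..int n}"
  have sub: "int_vectors I s \<subseteq> I \<rightarrow>\<^sub>E B"
  proof
    fix z assume z: "z \<in> int_vectors I s"
    show "z \<in> I \<rightarrow>\<^sub>E B"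
    proof (rule PiE_I)
      fix i assume i: "i \<in> I"
      have "\<bar>z i\<bar> \<le> (\<Sum>i\<in>I. \<bar>z i\<bar>)" using i I by (intro member_le_sum) auto
      also have "\<dots> \<le> \<lfloor>s\<rfloor>" using z by (simp add: int_vectors_def le_floor_iff)
      finally have "\<bar>z i\<bar> \<le> \<lfloor>s\<rfloor>" .
      moreover have "0 \<le> \<lfloor>s\<rfloor>" using calculation abs_ge_zero[of "z i"] by linarith
      ultimately show "z i \<in> B" by (auto simp: B_def n_def)
    next
      fix i assume "i \<notin> I"
      then show "z i = undefined" using z by (auto simp: int_vectors_def PiE_def extensional_def)
    qed
  qed
  have fin: "finite (I \<rightarrow>\<^sub>E B)" using I by (intro finite_PiE) (auto simp: B_def)
  have finV: "finite (int_vectors I s)" by (rule finite_subset[OF sub fin])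
  have "real (card (int_vectors I s)) * x powr s = (\<Sum>z\<in>int_vectors I s. x powr s)" by simp
  also have "\<dots> \<le> (\<Sum>z\<in>int_vectors I s. \<Prod>i\<in>I. x ^ nat \<bar>z i\<bar>)"
  proof (rule sum_mono)
    fix z assume z: "z \<in> int_vectors I s"
    have "real (\<Sum>i\<in>I. nat \<bar>z i\<bar>) = real_of_int (\<Sum>i\<in>I. \<bar>z i\<bar>)" by simp
    also have "\<dots> \<le> s" using z by (simp add: int_vectors_def)
    finally have "x powr s \<le> x powr real (\<Sum>i\<in>I. nat \<bar>z i\<bar>)"
      using x by (intro powr_mono') auto
    also have "\<dots> = x ^ (\<Sum>i\<in>I. nat \<bar>z i\<bar>)" using x by (rule_tac powr_realpow) auto
    finally show "x powr s \<le> (\<Prod>i\<in>I. x ^ nat \<bar>z i\<bar>)" by (simp only: power_sum)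
  qed
  also have "\<dots> \<le> (\<Sum>z\<in>I \<rightarrow>\<^sub>E B. \<Prod>i\<in>I. x ^ nat \<bar>z i\<bar>)"
    using x by (intro sum_mono2 fin sub prod_nonneg) auto
  also have "\<dots> = (\<Prod>i\<in>I. \<Sum>j\<in>B. x ^ nat \<bar>j\<bar>)"
    by (rule prod_sum_PiE[symmetric]) (use I in \<open>auto simp: B_def\<close>)
  also have "\<dots> \<le> (\<Prod>i\<in>I. (1 + x) / (1 - x))"
    unfolding B_def using x by (intro prod_mono conjI sum_powers_symmetric sum_nonneg) auto
  finally show ?thesis using finV by simp
qed

lemma int_vectors_finite: "finite I \<Longrightarrow> finite (int_vectors I s)"
  using int_vectors_card[of I "1/2"] by simp

text \<open>
With less than one unit per coordinate, \<open>x = y / 2\<close> gives a logarithm of order \<open>m * y * ln (1 / y)\<close>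
for \<open>m\<close> coordinates; the logarithm is absorbed into the power of \<open>y\<close>.
\<close>

lemma int_vectors_card_sparse:
  assumes I: "finite I" and y: "0 < y" "y \<le> 1" and e: "0 < e" "e < 1"
  shows "real (card (int_vectors I (real (card I) * y))) \<le> exp ((2 + 2 / (1 - e)) * real (card I) * y powr e)"
proof -
  define m where "m = real (card I)"
  define x where "x = y / 2"
  have x: "0 < x" "x < 1" "x \<le> 1/2" using y by (auto simp: x_def)
  have m: "0 \<le> m" by (simp add: m_def)
  have "(1 + x) / (1 - x) \<le> 1 + 2 * y"
  proof -
    have "x * (4 * x) \<le> 2 * x" using x by simp
    then show ?thesis using x by (simp add: x_def field_simps)
  qed
  also have "\<dots> \<le> exp (2 * y)" by (rule exp_ge_add_one_self)
  finally have q: "(1 + x) / (1 - x) \<le> exp (2 * y)" .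
  have "real (card (int_vectors I (m * y))) * x powr (m * y) \<le> ((1 + x) / (1 - x)) ^ card I"
    unfolding m_def using int_vectors_card[OF I x(1,2)] by blast
  also have "\<dots> \<le> exp (2 * y) ^ card I" using x by (intro power_mono q) auto
  also have "\<dots> = exp (m * (2 * y))" by (simp add: m_def exp_of_nat_mult)
  finally have "real (card (int_vectors I (m * y))) \<le> exp (m * (2 * y)) / x powr (m * y)"
    using x by (simp add: pos_le_divide_eq)
  also have "\<dots> = exp (m * y * (2 + ln (2 / y)))"
  proof -
    have "x powr (m * y) = exp (- (m * y * ln (2 / y)))"
      using y by (simp add: powr_def x_def ln_div algebra_simps)
    then show ?thesis by (simp add: exp_diff[symmetric] algebra_simps)
  qed
  also have "\<dots> \<le> exp (m * ((2 + 2 / (1 - e)) * y powr e))"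
  proof -
    have "ln (2 / y) \<le> (2 / y) powr (1 - e) / (1 - e)"
      by (rule ln_powr_bound) (use y e in auto)
    also have "(2 / y) powr (1 - e) = 2 powr (1 - e) / y powr (1 - e)" using y by (simp add: powr_divide)
    also have "\<dots> \<le> 2 / y powr (1 - e)"
      using powr_mono[of "1 - e" 1 2] e by (intro divide_right_mono) auto
    finally have "ln (2 / y) \<le> 2 / y powr (1 - e) / (1 - e)" using e by (simp add: divide_right_mono)
    then have "y * (2 + ln (2 / y)) \<le> y * (2 + 2 / y powr (1 - e) / (1 - e))"
      using y by (intro mult_left_mono) auto
    also have "\<dots> = 2 * y + 2 / (1 - e) * (y / y powr (1 - e))" by (simp add: algebra_simps)
    also have "y / y powr (1 - e) = y powr e" using y powr_diff[of y 1 "1 - e"] by simp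
    also have "2 * y + 2 / (1 - e) * y powr e \<le> 2 * y powr e + 2 / (1 - e) * y powr e"
      using powr_mono'[of e 1 y] y e by simp
    finally have "y * (2 + ln (2 / y)) \<le> (2 + 2 / (1 - e)) * y powr e" by (simp add: algebra_simps)
    then show ?thesis using m by (simp add: mult.assoc mult_left_mono)
  qed
  finally show ?thesis by (simp add: m_def mult_ac)
qed

text \<open>
With at least one unit per coordinate, \<open>x = y / (1 + y)\<close> gives a logarithm of order
\<open>m * (1 + ln y)\<close>. Any power of \<open>y\<close> below \<open>1/2\<close> would serve in place of \<open>1/4\<close>, because the mesh at
\<open>r\<close> levels below the critical one leads to \<open>y = 2 powr (2 * r)\<close> on \<open>2 powr (- r)\<close> times as many cells.
\<close>

lemma int_vectors_card_dense:
  assumes I: "finite I" and y: "1 \<le> y"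
  shows "real (card (int_vectors I (real (card I) * y))) \<le> exp (7 * real (card I) * y powr (1/4))"
proof -
  define m where "m = real (card I)"
  define x where "x = y / (1 + y)"
  have x: "0 < x" "x < 1" using y by (auto simp: x_def)
  have m: "0 \<le> m" by (simp add: m_def)
  have "1 - x = 1 / (1 + y)" "1 + x = (1 + 2 * y) / (1 + y)" using y by (simp_all add: x_def field_simps)
  then have q: "(1 + x) / (1 - x) \<le> 3 * y" using y by simp
  have "3 * y \<le> exp (2 + 4 * y powr (1/4))"
  proof -
    have "ln y \<le> y powr (1/4) / (1/4)" by (rule ln_powr_bound) (use y in auto)
    then have "ln y \<le> 4 * y powr (1/4)" by simp
    then have "exp (ln y) \<le> exp (4 * y powr (1/4))" by (simp only: exp_le_cancel_iff)
    then have "y \<le> exp (4 * y powr (1/4))" using y by simp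
    moreover have "3 \<le> exp (2::real)" using exp_ge_add_one_self[of "2::real"] by simp
    ultimately have "3 * y \<le> exp 2 * exp (4 * y powr (1/4))" using y by (intro mult_mono) auto
    then show ?thesis by (simp add: exp_add)
  qed
  with q have q': "(1 + x) / (1 - x) \<le> exp (2 + 4 * y powr (1/4))" by simp
  have "real (card (int_vectors I (m * y))) * x powr (m * y) \<le> ((1 + x) / (1 - x)) ^ card I"
    unfolding m_def using int_vectors_card[OF I x(1,2)] by blast
  also have "\<dots> \<le> exp (2 + 4 * y powr (1/4)) ^ card I" using x by (intro power_mono q') auto
  also have "\<dots> = exp (m * (2 + 4 * y powr (1/4)))" by (simp add: m_def exp_of_nat_mult)
  finally have "real (card (int_vectors I (m * y))) \<le> exp (m * (2 + 4 * y powr (1/4))) / x powr (m * y)"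
    using x by (simp add: pos_le_divide_eq)
  also have "\<dots> \<le> exp (m * (2 + 4 * y powr (1/4))) * exp m"
  proof -
    have "ln (1 / x) \<le> 1 / x - 1" using x by (intro ln_le_minus_one) auto
    also have "1 / x - 1 = 1 / y" using y by (simp add: x_def field_simps)
    finally have "y * ln (1 / x) \<le> y * (1 / y)" using y by (intro mult_left_mono) auto
    then have "y * ln (1 / x) \<le> 1" using y by simp
    then have "m * (y * ln (1 / x)) \<le> m * 1" by (intro mult_left_mono m)
    then have "exp (m * y * ln (1 / x)) \<le> exp m" by (simp add: mult.assoc)
    moreover have "1 / x powr (m * y) = exp (m * y * ln (1 / x))"
    proof -
      have "ln (1 / x) = - ln x" using x by (simp add: ln_div)
      then show ?thesis using x by (simp add: powr_def exp_minus divide_inverse)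
    qed
    ultimately have "1 / x powr (m * y) \<le> exp m" by simp
    then have "exp (m * (2 + 4 * y powr (1/4))) * (1 / x powr (m * y)) \<le> exp (m * (2 + 4 * y powr (1/4))) * exp m"
      by (intro mult_left_mono) auto
    then show ?thesis by simp
  qed
  also have "\<dots> = exp (m * (3 + 4 * y powr (1/4)))" by (simp add: exp_add[symmetric] algebra_simps)
  also have "\<dots> \<le> exp (m * (7 * y powr (1/4)))"
  proof -
    have "1 \<le> y powr (1/4)" using y by (intro ge_one_powr_ge_zero) auto
    then show ?thesis using m by (simp add: mult_left_mono)
  qed
  finally show ?thesis by (simp add: m_def mult_ac)
qed

text \<open>
The cells with index outside the range cover at most the point \<open>t = 1\<close> of the unit interval.
\<close>

definition step_function :: "nat \<Rightarrow> real \<Rightarrow> (int \<Rightarrow> int) \<Rightarrow> real \<Rightarrow> real" where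
  "step_function k d z t = (if \<lfloor>2 ^ k * t\<rfloor> \<in> {0..<2 ^ k} then d * of_int (z \<lfloor>2 ^ k * t\<rfloor>) else 0)"

definition net :: "nat \<Rightarrow> real \<Rightarrow> real \<Rightarrow> (real \<Rightarrow> real) set" where
  "net k d s = step_function k d ` int_vectors {0..<2 ^ k} s"

lemma net_finite: "finite (net k d s)"
  unfolding net_def by (intro finite_imageI int_vectors_finite) simp

lemma net_card_le: "card (net k d s) \<le> card (int_vectors {0..<2 ^ k::int} s)"
  unfolding net_def by (intro card_image_le int_vectors_finite) simp

lemma step_function_measurable: "step_function k d z \<in> borel_measurable leb01"
proof -
  have "(\<lambda>t. \<lfloor>2 ^ k * t\<rfloor>) \<in> measurable leb01 (count_space UNIV)" by measurable
  from measurable_compose[OF this, of "\<lambda>i. if i \<in> {0..<2 ^ k} then d * of_int (z i) else 0" borel]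
  show ?thesis by (simp add: step_function_def[abs_def])
qed

lemma step_function_bounded: "\<bar>step_function k d z t\<bar> \<le> \<bar>d\<bar> * (\<Sum>i\<in>{0..<2 ^ k}. \<bar>of_int (z i)\<bar>)"
proof (cases "\<lfloor>2 ^ k * t\<rfloor> \<in> {0..<2 ^ k}")
  case True
  have "\<bar>of_int (z \<lfloor>2 ^ k * t\<rfloor>)\<bar> \<le> (\<Sum>i\<in>{0..<2 ^ k}. \<bar>of_int (z i) :: real\<bar>)"
    using True by (intro member_le_sum) auto
  then show ?thesis using True by (simp add: step_function_def abs_mult mult_left_mono)
next
  case False
  have "0 \<le> \<bar>d\<bar> * (\<Sum>i\<in>{0..<2 ^ k}. \<bar>of_int (z i)\<bar> :: real)" by (intro mult_nonneg_nonneg sum_nonneg) auto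
  then show ?thesis using False by (simp only: step_function_def if_False abs_zero)
qed

definition Lnorm_finite :: "real \<Rightarrow> (real \<Rightarrow> real) \<Rightarrow> bool" where
  "Lnorm_finite v y \<longleftrightarrow> (\<exists>c>0. Lnorm_le v y c)"

lemma net_Lnorm_finite:
  assumes "y \<in> net k d s" "0 \<le> v"
  shows "Lnorm_finite v y"
proof -
  obtain z where y: "y = step_function k d z" using assms by (auto simp: net_def)
  define c where "c = \<bar>d\<bar> * (\<Sum>i\<in>{0..<2 ^ k}. \<bar>of_int (z i)\<bar> :: real) + 1"
  have c: "0 < c" unfolding c_def by (intro add_nonneg_pos mult_nonneg_nonneg sum_nonneg) auto
  have "\<bar>y t\<bar> \<le> c" for t using step_function_bounded[of k d z t] by (simp add: y c_def)
  then have "Lnorm_le v y c"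
    using c assms by (intro Lnorm_le_const) (auto simp: y step_function_measurable)
  then show ?thesis using c by (auto simp: Lnorm_finite_def)
qed

text \<open>
An integer vector with \<open>l\<^sub>1\<close> norm below one vanishes. Therefore all levels far above the critical
one are approximated by zero, and finitely many levels enter the covering.
\<close>

lemma net_trivial:
  assumes "s < 1" "y \<in> net k d s"
  shows "y = (\<lambda>t. 0)"
proof -
  obtain z where z: "z \<in> int_vectors {0..<2 ^ k} s" and y: "y = step_function k d z"
    using assms by (auto simp: net_def)
  have "real_of_int (\<Sum>i\<in>{0..<2 ^ k}. \<bar>z i\<bar>) < 1" using z assms by (simp add: int_vectors_def)
  then have "(\<Sum>i\<in>{0..<2 ^ k}. \<bar>z i\<bar>) < 1" by linarith
  moreover have "0 \<le> (\<Sum>i\<in>{0..<2 ^ k}. \<bar>z i\<bar>)" by (intro sum_nonneg) auto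
  ultimately have "(\<Sum>i\<in>{0..<2 ^ k}. \<bar>z i\<bar>) = 0" by linarith
  then have "\<forall>i\<in>{0..<2 ^ k}. \<bar>z i\<bar> = 0" by (subst (asm) sum_nonneg_eq_0_iff) auto
  then show ?thesis by (auto simp: y step_function_def)
qed

definition trunc :: "real \<Rightarrow> int" where
  "trunc x = (if 0 \<le> x then \<lfloor>x\<rfloor> else \<lceil>x\<rceil>)"

lemma trunc_bounds: "\<bar>of_int (trunc x)\<bar> \<le> \<bar>x\<bar>" "\<bar>x - of_int (trunc x)\<bar> \<le> 1" "\<bar>x - of_int (trunc x)\<bar> \<le> \<bar>x\<bar>"
  unfolding trunc_def by (auto; linarith)+

text \<open>
For integers the \<open>l\<^sub>1\<close> norm is at most the \<open>p\<close>-th power of the \<open>l\<^sub>p\<close> norm. This converts a bound in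
\<open>L\<^sub>p\<close> into a bound on the number of units that are distributed over the cells.
\<close>

lemma trunc_powr: "1 \<le> p \<Longrightarrow> \<bar>of_int (trunc x)\<bar> \<le> \<bar>x\<bar> powr p"
proof -
  assume p: "1 \<le> p"
  show ?thesis
  proof (cases "trunc x = 0")
    case False
    then have "1 \<le> \<bar>trunc x\<bar>" by linarith
    then have "(1::real) \<le> \<bar>of_int (trunc x)\<bar>" by linarith
    then have "1 \<le> \<bar>x\<bar>" using trunc_bounds(1)[of x] by linarith
    then have "\<bar>x\<bar> powr 1 \<le> \<bar>x\<bar> powr p" using p by (intro powr_mono) auto
    then show ?thesis using trunc_bounds(1)[of x] \<open>1 \<le> \<bar>x\<bar>\<close> by simp
  qed simp
qed

lemma emeasure_cell:
  assumes "i \<in> {0..<2 ^ k}"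
  shows "emeasure leb01 {t \<in> space leb01. \<lfloor>2 ^ k * t\<rfloor> = i} = ennreal (1 / 2 ^ k)"
proof -
  have p: "(0::real) < 2 ^ k" by simp
  have i: "0 \<le> i" "i + 1 \<le> 2 ^ k" using assms by auto
  have i': "0 \<le> real_of_int i" "real_of_int i + 1 \<le> 2 ^ k"
    using i(1) i(2)[folded of_int_le_iff[where 'a = real]] by simp_all
  have inside: "\<lfloor>2 ^ k * t\<rfloor> = i \<and> 0 \<le> t \<and> t \<le> 1"
    if "t \<in> {of_int i / 2 ^ k..<(of_int i + 1) / 2 ^ k}" for t :: real
  proof -
    have 1: "of_int i \<le> 2 ^ k * t" "2 ^ k * t < of_int i + 1"
      using that p by (auto simp: field_simps)
    then have "\<lfloor>2 ^ k * t\<rfloor> = i" by (simp add: floor_eq_iff)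
    moreover have "0 \<le> 2 ^ k * t" "2 ^ k * t \<le> 2 ^ k * 1" using 1 i' by linarith+
    then have "0 \<le> t" "t \<le> 1" using p by (auto simp: zero_le_mult_iff mult_le_cancel_left_pos)
    ultimately show ?thesis by simp
  qed
  have "{t \<in> space leb01. \<lfloor>2 ^ k * t\<rfloor> = i} = {of_int i / 2 ^ k..<(of_int i + 1) / 2 ^ k}"
  proof (intro set_eqI iffI)
    fix t assume "t \<in> {t \<in> space leb01. \<lfloor>2 ^ k * t\<rfloor> = i}"
    then show "t \<in> {of_int i / 2 ^ k..<(of_int i + 1) / 2 ^ k}"
      using p by (auto simp: floor_eq_iff field_simps)
  next
    fix t :: real assume "t \<in> {of_int i / 2 ^ k..<(of_int i + 1) / 2 ^ k}"
    then show "t \<in> {t \<in> space leb01. \<lfloor>2 ^ k * t\<rfloor> = i}" using inside[of t] by simp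
  qed
  moreover have "{of_int i / 2 ^ k..<(of_int i + 1) / 2 ^ k} \<subseteq> {0..1::real}"
    using inside by auto
  ultimately have "emeasure leb01 {t \<in> space leb01. \<lfloor>2 ^ k * t\<rfloor> = i} = emeasure lebesgue {of_int i / 2 ^ k..<(of_int i + 1) / 2 ^ k :: real}"
    by (simp add: emeasure_restrict_space)
  also have "\<dots> = ennreal (1 / 2 ^ k)"
    by (simp add: add_divide_distrib divide_right_mono)
  finally show ?thesis .
qed

lemma cell_sum_le:
  fixes X :: "int \<Rightarrow> real"
  assumes X0: "\<And>i. 0 \<le> X i" and le: "(\<integral>\<^sup>+t. ennreal (X \<lfloor>2 ^ k * t\<rfloor>) \<partial>leb01) \<le> 1"
  shows "(\<Sum>i\<in>{0..<2 ^ k}. X i) \<le> 2 ^ k"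
proof -
  let ?C = "\<lambda>i. {t \<in> space leb01. \<lfloor>2 ^ k * t\<rfloor> = i}"
  have C: "?C i \<in> sets leb01" for i by measurable
  have "ennreal ((\<Sum>i\<in>{0..<2 ^ k}. X i) / 2 ^ k) = (\<Sum>i\<in>{0..<2 ^ k}. ennreal (X i) * emeasure leb01 (?C i))"
  proof -
    have "(\<Sum>i\<in>{0..<2 ^ k}. ennreal (X i) * emeasure leb01 (?C i)) = (\<Sum>i\<in>{0..<2 ^ k}. ennreal (X i / 2 ^ k))"
      using X0 by (intro sum.cong refl) (simp only: emeasure_cell, subst ennreal_mult[symmetric], simp_all)
    then show ?thesis using X0 by (simp add: sum_divide_distrib)
  qed
  also have "\<dots> = (\<integral>\<^sup>+t. (\<Sum>i\<in>{0..<2 ^ k}. ennreal (X i) * indicator (?C i) t) \<partial>leb01)"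
    using C by (subst nn_integral_sum) (auto simp: nn_integral_cmult_indicator)
  also have "\<dots> \<le> (\<integral>\<^sup>+t. ennreal (X \<lfloor>2 ^ k * t\<rfloor>) \<partial>leb01)"
  proof (rule nn_integral_mono)
    fix t
    have "(\<Sum>i\<in>{0..<2 ^ k}. ennreal (X i) * indicator (?C i) t) \<le> (\<Sum>i\<in>{0..<2 ^ k}. if i = \<lfloor>2 ^ k * t\<rfloor> then ennreal (X i) else 0)"
      by (intro sum_mono) (auto split: split_indicator)
    also have "\<dots> \<le> ennreal (X \<lfloor>2 ^ k * t\<rfloor>)" by (subst sum.delta) auto
    finally show "(\<Sum>i\<in>{0..<2 ^ k}. ennreal (X i) * indicator (?C i) t) \<le> ennreal (X \<lfloor>2 ^ k * t\<rfloor>)" .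
  qed
  also have "\<dots> \<le> 1" by (rule le)
  finally have "(\<Sum>i\<in>{0..<2 ^ k}. X i) / 2 ^ k \<le> 1" by simp
  then show ?thesis by simp
qed

text \<open>
Rounding the value on each cell towards zero to a multiple of \<open>N * \<tau>\<close>. Towards zero, the error is
bounded by the function as well as by the mesh.
\<close>

lemma net_approximates:
  assumes h: "cell_constant k h" and N: "Lnorm_le w h N" and pos: "0 < N" "0 < \<tau>" and w: "0 < w" "w \<le> 1"
  shows "\<exists>y\<in>net k (N * \<tau>) (2 ^ k * \<tau> powr (- (1 / w))).
    (AE t in leb01. \<bar>h t - y t\<bar> \<le> \<bar>h t\<bar>) \<and> (AE t in leb01. \<bar>h t - y t\<bar> \<le> N * \<tau>)"
proof -
  obtain X :: "int \<Rightarrow> real" where X: "\<And>t. h t = X \<lfloor>2 ^ k * t\<rfloor>" using h by (auto simp: cell_constant_def)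
  define p where "p = 1 / w"
  have p: "1 \<le> p" using w by (simp add: p_def)
  define d where "d = N * \<tau>"
  have d: "0 < d" using pos by (simp add: d_def)
  define z where "z = (\<lambda>i. if i \<in> {0..<2 ^ k} then trunc (X i / d) else undefined)"
  define y where "y = step_function k d z"
  have "(\<integral>\<^sup>+t. ennreal ((\<bar>X \<lfloor>2 ^ k * t\<rfloor>\<bar> / N) powr p) \<partial>leb01) \<le> 1"
    using N w by (simp add: Lnorm_le_def X p_def)
  then have sum: "(\<Sum>i\<in>{0..<2 ^ k}. (\<bar>X i\<bar> / N) powr p) \<le> 2 ^ k"
    by (intro cell_sum_le) auto
  have "real_of_int (\<Sum>i\<in>{0..<2 ^ k}. \<bar>z i\<bar>) = (\<Sum>i\<in>{0..<2 ^ k}. \<bar>of_int (trunc (X i / d))\<bar>)"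
    by (simp add: z_def)
  also have "\<dots> \<le> (\<Sum>i\<in>{0..<2 ^ k}. (\<bar>X i\<bar> / N) powr p * \<tau> powr (- p))"
  proof (rule sum_mono)
    fix i
    have "\<bar>of_int (trunc (X i / d))\<bar> \<le> \<bar>X i / d\<bar> powr p" by (rule trunc_powr[OF p])
    also have "\<bar>X i / d\<bar> = \<bar>X i\<bar> / N / \<tau>" using pos by (simp add: d_def)
    also have "(\<bar>X i\<bar> / N / \<tau>) powr p = (\<bar>X i\<bar> / N) powr p * \<tau> powr (- p)"
      using pos by (subst powr_divide) (auto simp: powr_minus divide_inverse)
    finally show "\<bar>of_int (trunc (X i / d))\<bar> \<le> (\<bar>X i\<bar> / N) powr p * \<tau> powr (- p)" .
  qed
  also have "\<dots> = (\<Sum>i\<in>{0..<2 ^ k}. (\<bar>X i\<bar> / N) powr p) * \<tau> powr (- p)" by (simp add: sum_distrib_right)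
  also have "\<dots> \<le> 2 ^ k * \<tau> powr (- p)" by (intro mult_right_mono sum) auto
  finally have "z \<in> int_vectors {0..<2 ^ k} (2 ^ k * \<tau> powr (- p))"
    by (auto simp: int_vectors_def z_def PiE_def extensional_def)
  then have yn: "y \<in> net k (N * \<tau>) (2 ^ k * \<tau> powr (- (1 / w)))"
    unfolding y_def net_def d_def p_def by (rule imageI)
  have eq: "AE t in leb01. y t = d * of_int (trunc (h t / d))"
    using AE_leb01_lt_1
  proof eventually_elim
    case (elim t)
    then have "0 \<le> 2 ^ k * t" "2 ^ k * t < 2 ^ k * 1" by auto
    then have "\<lfloor>2 ^ k * t\<rfloor> \<in> {0..<2 ^ k}" by (auto simp: floor_less_iff)
    then show ?case by (simp add: y_def step_function_def z_def X)
  qed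
  have hd: "h t = d * (h t / d)" for t using d by simp
  have 1: "\<bar>h t - d * of_int (trunc (h t / d))\<bar> = d * \<bar>h t / d - of_int (trunc (h t / d))\<bar>" for t
  proof -
    have "h t - d * of_int (trunc (h t / d)) = d * (h t / d - of_int (trunc (h t / d)))"
      using d by (simp add: right_diff_distrib)
    then show ?thesis using d by (simp only: abs_mult abs_of_pos)
  qed
  have "AE t in leb01. \<bar>h t - y t\<bar> \<le> \<bar>h t\<bar>"
    using eq
  proof eventually_elim
    case (elim t)
    have "d * \<bar>h t / d - of_int (trunc (h t / d))\<bar> \<le> d * \<bar>h t / d\<bar>"
      using d by (intro mult_left_mono trunc_bounds) auto
    also have "\<dots> = \<bar>h t\<bar>" using d by simp
    finally show ?case unfolding elim 1 .
  qed
  moreover have "AE t in leb01. \<bar>h t - y t\<bar> \<le> N * \<tau>"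
    using eq
  proof eventually_elim
    case (elim t)
    have "d * \<bar>h t / d - of_int (trunc (h t / d))\<bar> \<le> d * 1"
      using d by (intro mult_left_mono trunc_bounds) auto
    then show ?case unfolding elim 1 by (simp add: d_def)
  qed
  ultimately show ?thesis using yn by blast
qed

lemma net_approximates_uniform:
  assumes h: "cell_constant k h" and N: "Lnorm_le u h N" and pos: "0 < N" "0 < \<tau>"
    and u: "0 \<le> u" "u \<le> 1" and v: "0 \<le> v"
  shows "\<exists>y\<in>net k (N * \<tau>) (2 ^ k * \<tau> powr (- 1)). Lnorm_le v (\<lambda>t. h t - y t) (N * \<tau>)"
proof -
  have "Lnorm_le 1 h N" by (rule Lnorm_le_inclusion[OF N u pos(1)])
  from net_approximates[OF h this pos] obtain y where y: "y \<in> net k (N * \<tau>) (2 ^ k * \<tau> powr (- 1))"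
    "AE t in leb01. \<bar>h t - y t\<bar> \<le> N * \<tau>" by auto
  have [measurable]: "h \<in> borel_measurable leb01" "y \<in> borel_measurable leb01"
    using N y(1) by (auto simp: Lnorm_le_def net_def step_function_measurable)
  have "Lnorm_le v (\<lambda>t. h t - y t) (N * \<tau>)" by (rule Lnorm_le_const) (use y pos v in auto)
  with y show ?thesis by blast
qed

lemma net_approximates_nonlinear:
  assumes h: "cell_constant k h" and N: "Lnorm_le u h N" and pos: "0 < N" "0 < \<tau>"
    and u: "u \<le> 1" and v: "0 \<le> v" "v < u"
  shows "\<exists>y\<in>net k (N * \<tau>) (2 ^ k * \<tau> powr (- (1 / u))). Lnorm_le v (\<lambda>t. h t - y t) (N * \<tau> powr (1 - v / u))"
proof -
  have "0 < u" using v by simp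
  from net_approximates[OF h N pos this u] obtain y where y: "y \<in> net k (N * \<tau>) (2 ^ k * \<tau> powr (- (1 / u)))"
    "AE t in leb01. \<bar>h t - y t\<bar> \<le> \<bar>h t\<bar>" "AE t in leb01. \<bar>h t - y t\<bar> \<le> N * \<tau>" by auto
  have [measurable]: "h \<in> borel_measurable leb01" "y \<in> borel_measurable leb01"
    using N y(1) by (auto simp: Lnorm_le_def net_def step_function_measurable)
  have "Lnorm_le v (\<lambda>t. h t - y t) ((N * \<tau>) powr (1 - v / u) * N powr (v / u))"
    by (rule Lnorm_le_interpolate[OF N]) (use y pos v in auto)
  moreover have "(N * \<tau>) powr (1 - v / u) * N powr (v / u) = N * \<tau> powr (1 - v / u)"
  proof -
    have "N powr (1 - v / u) * N powr (v / u) = N" using pos by (simp add: powr_add[symmetric])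
    then show ?thesis using pos by (simp add: powr_mult mult_ac)
  qed
  ultimately show ?thesis using y by auto
qed

section \<open>Entropy of fractional integrals of small order\<close>

text \<open>
The number of bits \<open>x\<close> is real, so that it can be halved without rounding. The centres have finite
norm, which is needed to apply a further operator to them.
\<close>

definition entropy_cover :: "real \<Rightarrow> real \<Rightarrow> ((real \<Rightarrow> real) \<Rightarrow> real \<Rightarrow> real) \<Rightarrow> real \<Rightarrow> real \<Rightarrow> bool" where
  "entropy_cover u v T x e \<longleftrightarrow>
     (\<exists>Y. finite Y \<and> real (card Y) \<le> 2 powr x \<and> (\<forall>y\<in>Y. Lnorm_finite v y) \<and>
        (\<forall>f. Lnorm_le u f 1 \<longrightarrow> (\<exists>y\<in>Y. Lnorm_le v (\<lambda>t. T f t - y t) e)))"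

lemma sum_geometric_inj:
  fixes q :: real and g :: "nat \<Rightarrow> nat"
  assumes "finite A" "inj_on g A" "0 < q" "q < 1"
  shows "(\<Sum>k\<in>A. q ^ g k) \<le> 1 / (1 - q)"
proof -
  have "(\<Sum>k\<in>A. q ^ g k) = (\<Sum>i\<in>g ` A. q ^ i)" using assms by (simp add: sum.reindex)
  also have "\<dots> \<le> (\<Sum>i. q ^ i)" using assms by (intro sum_le_suminf) auto
  also have "\<dots> = 1 / (1 - q)" using assms by (intro suminf_geometric) auto
  finally show ?thesis .
qed

lemma two_sided_geometric:
  fixes c :: real
  assumes c: "0 < c"
  shows "\<exists>S>0. \<forall>\<kappa>::real. \<forall>A::nat set. finite A \<longrightarrow> (\<Sum>k\<in>A. 2 powr (- (c * \<bar>real k - \<kappa>\<bar>))) \<le> S"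
proof -
  define q where "q = 2 powr (- c)"
  have q: "0 < q" "q < 1" using c by (auto simp: q_def powr_less_one)
  have qpow: "2 powr (- (c * x)) \<le> q ^ n" if "real n \<le> x" for n x
  proof -
    have "2 powr (- (c * x)) \<le> 2 powr (- c * real n)" using that c by (intro powr_mono) auto
    also have "\<dots> = q ^ n" using q powr_realpow[of q n] by (simp add: q_def powr_powr)
    finally show ?thesis .
  qed
  show ?thesis
  proof (intro exI[of _ "2 / (1 - q)"] conjI allI impI)
    fix \<kappa> :: real and A :: "nat set" assume A: "finite A"
    define P where "P = {k\<in>A. \<kappa> \<le> real k}"
    define Q where "Q = {k\<in>A. \<not> \<kappa> \<le> real k}"
    define n where "n = nat \<lceil>\<kappa>\<rceil>"
    define m where "m = nat \<lfloor>\<kappa>\<rfloor>"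
    have P: "n \<le> k" "real (k - n) \<le> \<bar>real k - \<kappa>\<bar>" if "k \<in> P" for k
    proof -
      have "\<kappa> \<le> real k" using that by (simp add: P_def)
      then have "\<lceil>\<kappa>\<rceil> \<le> int k" by linarith
      then show nk: "n \<le> k" unfolding n_def nat_le_iff .
      have "\<kappa> \<le> real n" unfolding n_def by linarith
      then show "real (k - n) \<le> \<bar>real k - \<kappa>\<bar>" using nk by simp
    qed
    have Q: "k \<le> m" "real (m - k) \<le> \<bar>real k - \<kappa>\<bar>" if "k \<in> Q" for k
    proof -
      have k: "real k < \<kappa>" using that by (simp add: Q_def)
      then have "int k \<le> \<lfloor>\<kappa>\<rfloor>" by linarith
      then show km: "k \<le> m" by (simp add: m_def)
      have "real m \<le> \<kappa>" unfolding m_def using k by linarith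
      then show "real (m - k) \<le> \<bar>real k - \<kappa>\<bar>" using km by simp
    qed
    have "(\<Sum>k\<in>A. 2 powr (- (c * \<bar>real k - \<kappa>\<bar>))) = (\<Sum>k\<in>P. 2 powr (- (c * \<bar>real k - \<kappa>\<bar>))) + (\<Sum>k\<in>Q. 2 powr (- (c * \<bar>real k - \<kappa>\<bar>)))"
      using A unfolding P_def Q_def
      by (subst sum.union_disjoint[symmetric]) (auto intro!: sum.cong)
    also have "\<dots> \<le> (\<Sum>k\<in>P. q ^ (k - n)) + (\<Sum>k\<in>Q. q ^ (m - k))"
      by (intro add_mono sum_mono qpow P(2) Q(2))
    also have "\<dots> \<le> 1 / (1 - q) + 1 / (1 - q)"
    proof (intro add_mono sum_geometric_inj q)
      show "finite P" "finite Q" using A by (auto simp: P_def Q_def)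
      show "inj_on (\<lambda>k. k - n) P" by (rule inj_onI) (use P(1) in \<open>metis le_add_diff_inverse\<close>)
      show "inj_on (\<lambda>k. m - k) Q" by (rule inj_onI) (use Q(1) in \<open>metis diff_diff_cancel\<close>)
    qed
    finally show "(\<Sum>k\<in>A. 2 powr (- (c * \<bar>real k - \<kappa>\<bar>))) \<le> 2 / (1 - q)" by simp
  qed (use q in auto)
qed

lemma card_cells: "real (card {0..<2 ^ k :: int}) = 2 ^ k"
  by (simp add: nat_power_eq)

lemma two_power_powr: "(2::real) ^ k = 2 powr real k"
  by (simp add: powr_realpow)

text \<open>
At \<open>r\<close> levels below the critical level \<open>\<kappa>\<close>, the mesh \<open>2 powr (- 2 * r)\<close> costs about \<open>r\<close> bits on each
of \<open>2 powr (\<kappa> - r)\<close> cells.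
\<close>

lemma net_card_coarse:
  assumes "real k \<le> \<kappa>"
  shows "real (card (net k d (2 ^ k * (2 powr (2 * (real k - \<kappa>))) powr (- 1))))
    \<le> exp (7 * 2 powr \<kappa> * 2 powr (- (1 / 2 * \<bar>real k - \<kappa>\<bar>)))"
proof -
  define y where "y = 2 powr (2 * (\<kappa> - real k))"
  have y: "1 \<le> y" using assms unfolding y_def by (intro ge_one_powr_ge_zero) auto
  have s: "2 ^ k * (2 powr (2 * (real k - \<kappa>))) powr (- 1) = real (card {0..<2 ^ k :: int}) * y"
  proof -
    have "2 * (real k - \<kappa>) * (- 1) = 2 * (\<kappa> - real k)" by simp
    then show ?thesis unfolding card_cells y_def powr_powr by (simp only:)
  qed
  have "real (card (net k d (real (card {0..<2 ^ k :: int}) * y))) \<le> exp (7 * real (card {0..<2 ^ k :: int}) * y powr (1/4))"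
    using net_card_le[of k d] int_vectors_card_dense[of "{0..<2 ^ k :: int}" y] y
    by (intro order_trans[OF of_nat_mono[OF net_card_le]]) auto
  also have "7 * real (card {0..<2 ^ k :: int}) * y powr (1/4) = 7 * 2 powr \<kappa> * 2 powr (- (1 / 2 * \<bar>real k - \<kappa>\<bar>))"
  proof -
    have "2 powr real k * 2 powr (2 * (\<kappa> - real k) * (1/4)) = 2 powr \<kappa> * (2::real) powr (- (1 / 2 * \<bar>real k - \<kappa>\<bar>))"
      unfolding powr_add[symmetric] using assms by (intro arg_cong2[of _ _ _ _ "(powr)"] refl) (simp add: field_simps)
    then show ?thesis unfolding card_cells two_power_powr by (simp add: y_def powr_powr)
  qed
  finally show ?thesis unfolding s .
qed

text \<open>
At \<open>r\<close> levels above the critical level \<open>\<kappa>\<close>, the mesh is chosen such that \<open>2 powr (\<kappa> - e * r)\<close>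
units are distributed over the cells. The small \<open>e\<close> pays for the choice of their positions.
\<close>

lemma net_card_fine:
  assumes k: "\<kappa> < real k" and e: "0 < e" and u: "0 < u"
  shows "real (card (net k d (2 ^ k * (2 powr ((1 + e) * u * (real k - \<kappa>))) powr (- (1 / u)))))
    \<le> exp ((2 + 4 * (1 + e) / e) * 2 powr \<kappa> * 2 powr (- (e / 2 * \<bar>real k - \<kappa>\<bar>)))"
proof -
  define y where "y = 2 powr (- ((1 + e) * (real k - \<kappa>)))"
  have y: "0 < y" "y \<le> 1"
  proof -
    have "y \<le> 2 powr 0" unfolding y_def using k e by (intro powr_mono) auto
    then show "0 < y" "y \<le> 1" by (auto simp: y_def)
  qed
  \<comment> \<open>Any \<open>g < 1\<close> with \<open>(1 + e) * g > 1\<close> yields decay away from \<open>\<kappa>\<close>.\<close>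
  define g where "g = (1 + e / 2) / (1 + e)"
  have g: "0 < g" "g < 1" using e by (auto simp: g_def)
  have g': "2 + 2 / (1 - g) = 2 + 4 * (1 + e) / e" using e by (simp add: g_def field_simps)
  have s: "2 ^ k * (2 powr ((1 + e) * u * (real k - \<kappa>))) powr (- (1 / u)) = real (card {0..<2 ^ k :: int}) * y"
    unfolding card_cells using u by (simp add: powr_powr y_def)
  have "real (card (net k d (real (card {0..<2 ^ k :: int}) * y))) \<le> exp ((2 + 2 / (1 - g)) * real (card {0..<2 ^ k :: int}) * y powr g)"
    by (intro order_trans[OF of_nat_mono[OF net_card_le]] int_vectors_card_sparse y g) auto
  also have "(2 + 2 / (1 - g)) * real (card {0..<2 ^ k :: int}) * y powr g = (2 + 4 * (1 + e) / e) * 2 powr \<kappa> * 2 powr (- (e / 2 * \<bar>real k - \<kappa>\<bar>))"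
  proof -
    have "(1 + e) * g = 1 + e / 2" using e by (simp add: g_def)
    moreover have "(1 + e) * (real k - \<kappa>) * g = (1 + e) * g * (real k - \<kappa>)" by (simp only: mult_ac)
    ultimately have "(1 + e) * (real k - \<kappa>) * g = (1 + e / 2) * (real k - \<kappa>)" by (simp only:)
    then have "y powr g = 2 powr (- ((1 + e / 2) * (real k - \<kappa>)))"
      by (simp only: y_def powr_powr mult_minus_left)
    moreover have "2 powr real k * 2 powr (- ((1 + e / 2) * (real k - \<kappa>))) = 2 powr \<kappa> * (2::real) powr (- (e / 2 * \<bar>real k - \<kappa>\<bar>))"
      unfolding powr_add[symmetric] using k by (intro arg_cong2[of _ _ _ _ "(powr)"] refl) (simp add: algebra_simps)
    ultimately show ?thesis unfolding card_cells two_power_powr g' by simp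
  qed
  finally show ?thesis unfolding s .
qed

lemma Lnorm_finite_zero: "0 \<le> v \<Longrightarrow> Lnorm_finite v (\<lambda>t. 0)"
  unfolding Lnorm_finite_def by (intro exI[of _ 1] conjI Lnorm_le_const) auto

lemma Lnorm_finite_add:
  assumes "Lnorm_finite v f" "Lnorm_finite v g" "0 \<le> v" "v \<le> 1"
  shows "Lnorm_finite v (\<lambda>t. f t + g t)"
proof -
  obtain c d where "0 < c" "Lnorm_le v f c" "0 < d" "Lnorm_le v g d"
    using assms(1,2) unfolding Lnorm_finite_def by blast
  then show ?thesis
    unfolding Lnorm_finite_def using assms(3,4)
    by (intro exI[of _ "c + d"] conjI Lnorm_le_add add_pos_pos)
qed

lemma Lnorm_finite_sum:
  assumes "finite A" "\<And>i. i \<in> A \<Longrightarrow> Lnorm_finite v (f i)" "0 \<le> v" "v \<le> 1"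
  shows "Lnorm_finite v (\<lambda>t. \<Sum>i\<in>A. f i t)"
  using assms(1,2)
proof (induction A rule: finite_induct)
  case empty
  then show ?case using assms by (simp add: Lnorm_finite_zero)
next
  case (insert i A)
  then show ?case using assms by (simp add: Lnorm_finite_add)
qed

lemma Lnorm_le_cong_AE:
  assumes "Lnorm_le u f c" "g \<in> borel_measurable leb01" "AE t in leb01. g t = f t" "0 < c" "0 \<le> u"
  shows "Lnorm_le u g c"
proof -
  have "AE t in leb01. \<bar>g t\<bar> \<le> 1 * \<bar>f t\<bar>" using assms(3) by eventually_elim simp
  from Lnorm_le_dominated[OF assms(1,2) this _ assms(4,5)] show ?thesis by simp
qed

lemma Lnorm_finite_measurable: "Lnorm_finite v f \<Longrightarrow> f \<in> borel_measurable leb01"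
  by (auto simp: Lnorm_finite_def Lnorm_le_def)

text \<open>
The integral is the sum of its increments below level \<open>K\<close> and of the discretization error at level
\<open>K\<close>. Sums of centres chosen level by level are centres for the whole; their number is the product of
the numbers per level.
\<close>

lemma entropy_cover_assemble:
  fixes Y :: "nat \<Rightarrow> (real \<Rightarrow> real) set" and e :: "nat \<Rightarrow> real"
  assumes v: "0 \<le> v" "v \<le> 1"
    and Y: "\<And>i. i < K \<Longrightarrow> finite (Y i)" "\<And>i y. i < K \<Longrightarrow> y \<in> Y i \<Longrightarrow> Lnorm_finite v y"
    and e: "0 < e'" "\<And>i. i < K \<Longrightarrow> 0 < e i"
    and tail: "\<And>f. Lnorm_le u f 1 \<Longrightarrow> Lnorm_le v (\<lambda>t. rl b f t - rl_step b K f t) e'"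
    and level: "\<And>f i. Lnorm_le u f 1 \<Longrightarrow> i < K \<Longrightarrow> \<exists>y\<in>Y i. Lnorm_le v (\<lambda>t. rl_increment b i f t - y t) (e i)"
    and card: "(\<Prod>i<K. real (card (Y i))) \<le> 2 powr x"
    and E: "e' + (\<Sum>i<K. e i) \<le> E"
  shows "entropy_cover u v (rl b) x E"
proof -
  define F where "F = (\<lambda>g t. \<Sum>i<K. (g :: nat \<Rightarrow> real \<Rightarrow> real) i t)"
  define P where "P = Pi\<^sub>E {..<K} Y"
  have fin: "finite P" unfolding P_def using Y by (intro finite_PiE) auto
  have "real (card (F ` P)) \<le> real (card P)" using card_image_le[OF fin] by simp
  also have "card P = (\<Prod>i<K. card (Y i))" unfolding P_def by (rule card_PiE) simp
  also have "real \<dots> \<le> 2 powr x" using card by simp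
  finally have c: "real (card (F ` P)) \<le> 2 powr x" .
  have fn: "Lnorm_finite v y" if "y \<in> F ` P" for y
    using that v Y(2) by (auto simp: F_def P_def PiE_def Pi_def intro!: Lnorm_finite_sum)
  have "\<exists>y\<in>F ` P. Lnorm_le v (\<lambda>t. rl b f t - y t) E" if f: "Lnorm_le u f 1" for f
  proof -
    have "\<forall>i\<in>{..<K}. \<exists>y. y \<in> Y i \<and> Lnorm_le v (\<lambda>t. rl_increment b i f t - y t) (e i)"
      using level[OF f] by blast
    from bchoice[OF this] obtain g where g: "\<forall>i\<in>{..<K}. g i \<in> Y i \<and> Lnorm_le v (\<lambda>t. rl_increment b i f t - g i t) (e i)" ..
    define g' where "g' = restrict g {..<K}"
    have g': "g' \<in> P" using g by (auto simp: g'_def P_def)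
    have 1: "0 < e' + (\<Sum>i<n. e i) \<and> Lnorm_le v (\<lambda>t. (rl b f t - rl_step b K f t) + (\<Sum>i<n. rl_increment b i f t - g i t)) (e' + (\<Sum>i<n. e i))"
      if "n \<le> K" for n using that
    proof (induction n)
      case 0
      then show ?case using tail[OF f] e by simp
    next
      case (Suc n)
      then have IH: "0 < e' + (\<Sum>i<n. e i)"
        "Lnorm_le v (\<lambda>t. (rl b f t - rl_step b K f t) + (\<Sum>i<n. rl_increment b i f t - g i t)) (e' + (\<Sum>i<n. e i))"
        by simp_all
      have n: "Lnorm_le v (\<lambda>t. rl_increment b n f t - g n t) (e n)" "0 < e n" using Suc.prems g e(2) by auto
      from Lnorm_le_add[OF IH(2) n(1) IH(1) n(2) v] IH(1) n(2) show ?case by (simp add: add.assoc)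
    qed
    from 1[of K] have pos: "0 < e' + (\<Sum>i<K. e i)"
      and L: "Lnorm_le v (\<lambda>t. (rl b f t - rl_step b K f t) + (\<Sum>i<K. rl_increment b i f t - g i t)) (e' + (\<Sum>i<K. e i))" by auto
    have [measurable]: "f \<in> borel_measurable leb01" "F g' \<in> borel_measurable leb01"
      using f fn[of "F g'"] g' by (auto simp: Lnorm_le_def intro: Lnorm_finite_measurable)
    have "Lnorm_le v (\<lambda>t. rl b f t - F g' t) (e' + (\<Sum>i<K. e i))"
    proof (rule Lnorm_le_cong_AE[OF L])
      show "AE t in leb01. rl b f t - F g' t = (rl b f t - rl_step b K f t) + (\<Sum>i<K. rl_increment b i f t - g i t)"
        using rl_step_0[of b f]
      proof eventually_elim
        case (elim t)
        have "(\<Sum>i<K. rl_increment b i f t) = rl_step b K f t - rl_step b 0 f t"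
          unfolding rl_increment_def by (rule sum_lessThan_telescope)
        moreover have "(\<Sum>i<K. g' i t) = (\<Sum>i<K. g i t)" by (simp add: g'_def)
        ultimately show ?case using elim by (simp add: F_def sum_subtractf)
      qed
    qed (use pos v in auto)
    then have "Lnorm_le v (\<lambda>t. rl b f t - F g' t) E" by (rule Lnorm_le_mono[OF _ E pos v(1)])
    then show ?thesis using g' by blast
  qed
  then show ?thesis unfolding entropy_cover_def using c fn fin by (intro exI[of _ "F ` P"]) auto
qed

lemma prod_card_le:
  fixes c :: "nat \<Rightarrow> real"
  assumes "\<And>i. i < K \<Longrightarrow> 0 \<le> c i" "\<And>i. i < K \<Longrightarrow> c i \<le> exp (B * w (Suc i))"
    and S: "\<And>A. finite A \<Longrightarrow> (\<Sum>k\<in>A. w k) \<le> S" and B: "0 \<le> B" "B * S \<le> x * ln 2"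
  shows "(\<Prod>i<K. c i) \<le> 2 powr x"
proof -
  have "(\<Prod>i<K. c i) \<le> (\<Prod>i<K. exp (B * w (Suc i)))" by (intro prod_mono) (use assms in auto)
  also have "\<dots> = exp (B * (\<Sum>i<K. w (Suc i)))" by (simp add: exp_sum[symmetric] sum_distrib_left)
  also have "(\<Sum>i<K. w (Suc i)) = (\<Sum>k\<in>Suc ` {..<K}. w k)" by (simp add: sum.reindex)
  also have "exp (B * \<dots>) \<le> exp (B * S)" using B S by (simp add: mult_left_mono)
  also have "\<dots> \<le> exp (x * ln 2)" using B by simp
  also have "\<dots> = 2 powr x" by (simp add: powr_def)
  finally show ?thesis .
qed

lemma powr_scale_le:
  assumes "0 < D" "0 < x" "0 < b" "b \<le> 1"
  shows "2 powr (- (b * log 2 (x / D))) \<le> max 1 D * x powr (- b)"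
proof -
  have "2 powr (- (b * log 2 (x / D))) = (2 powr (log 2 (x / D))) powr (- b)"
    by (simp add: powr_powr mult.commute)
  also have "\<dots> = (x / D) powr (- b)" using assms by simp
  also have "\<dots> = D powr b * x powr (- b)" using assms by (simp add: powr_divide powr_minus field_simps)
  also have "D powr b \<le> max 1 D"
  proof (cases "1 \<le> D")
    case True
    then show ?thesis using powr_mono[of b 1 D] assms by simp
  next
    case False
    then show ?thesis using powr_le1[of b D] assms by simp
  qed
  finally show ?thesis by (simp add: mult_right_mono)
qed

text \<open>
The discretization error is only controlled in \<open>L\<^sub>p\<close> directly. In \<open>L\<^sub>q\<close> it is the limit of sums of
increments, with almost everywhere convergence, so that Fatou's lemma applies.
\<close>

lemma rl_tail_norm:
  assumes f: "Lnorm_le u f 1" and u: "0 \<le> u" "u \<le> 1" and b: "0 < b" "b \<le> 1/2" and v: "0 \<le> v" "v \<le> 1"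
    and e: "\<And>i. 0 < e i" and inc: "\<And>i. K \<le> i \<Longrightarrow> Lnorm_le v (rl_increment b i f) (e i)"
    and S: "\<And>A. finite A \<Longrightarrow> (\<Sum>i\<in>A. e i) \<le> S" and pos: "0 < S"
  shows "Lnorm_le v (\<lambda>t. rl b f t - rl_step b K f t) S"
proof (rule Lnorm_le_AE_limit[where e = "\<lambda>n t. rl_step b (K + Suc n) f t - rl_step b K f t"])
  have [measurable]: "f \<in> borel_measurable leb01" using f by (rule Lnorm_le_measurable)
  show "Lnorm_le v (\<lambda>t. rl_step b (K + Suc n) f t - rl_step b K f t) S" for n
  proof -
    have "Lnorm_le v (\<lambda>t. \<Sum>i\<in>{K..<K + Suc n}. rl_increment b i f t) (\<Sum>i\<in>{K..<K + Suc n}. e i)"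
      using e inc v by (intro Lnorm_le_sum) auto
    moreover have "(\<Sum>i\<in>{K..<K + Suc n}. rl_increment b i f t) = rl_step b (K + Suc n) f t - rl_step b K f t" for t
      unfolding rl_increment_def by (rule sum_Suc_diff') simp
    ultimately have "Lnorm_le v (\<lambda>t. rl_step b (K + Suc n) f t - rl_step b K f t) (\<Sum>i\<in>{K..<K + Suc n}. e i)"
      by (simp only:)
    then show ?thesis
    proof (rule Lnorm_le_mono[OF _ S _ v(1)])
      show "0 < (\<Sum>i\<in>{K..<K + Suc n}. e i)" by (rule sum_pos) (use e in simp_all)
    qed simp
  qed
  show "AE t in leb01. (\<lambda>n. rl_step b (K + Suc n) f t - rl_step b K f t) \<longlonglongrightarrow> rl b f t - rl_step b K f t"
    using rl_step_tendsto_AE[OF f _ u b, simplified]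
  proof eventually_elim
    case (elim t)
    from LIMSEQ_ignore_initial_segment[OF elim, of "Suc K"]
    show ?case by (intro tendsto_diff tendsto_const) (simp add: add.commute)
  qed
  show "(\<lambda>t. rl b f t - rl_step b K f t) \<in> borel_measurable leb01" by measurable
qed (use pos v in auto)

text \<open>
If \<open>u \<noteq> v\<close>, all quantities decay geometrically in the distance from the critical level \<open>\<kappa>\<close>: the
errors with rate \<open>c\<close>, the numbers of bits with rate \<open>c'\<close>. If \<open>u = v\<close>, the same holds below \<open>\<kappa>\<close>, and
the discretization error at \<open>\<kappa>\<close> accounts for the rest.
\<close>

lemma rl_cover_small_order:
  assumes v: "0 \<le> v" "v \<le> u" and u: "u \<le> 1" and a: "u = v \<or> u - v < a"
  shows "\<exists>C>0. \<forall>b. 0 < b \<and> a \<le> b \<and> b \<le> 1/2 \<longrightarrow> (\<forall>x>0. entropy_cover u v (rl b) x (C * x powr (- b)))"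
proof -
  have u0: "0 \<le> u" and v1: "v \<le> 1" using u v by auto
  define \<theta> where "\<theta> = u - v"
  \<comment> \<open>For \<open>u \<noteq> v\<close>, \<open>(1 + \<epsilon>) * (u - v)\<close> is halfway between \<open>u - v\<close> and \<open>a\<close>, hence below \<open>b\<close>.\<close>
  define \<epsilon> where "\<epsilon> = (if u = v then 1 else (a - \<theta>) / (2 * \<theta>))"
  define c where "c = (if u = v then 1 else min 1 ((a - \<theta>) / 2))"
  have th: "0 < \<theta>" "\<theta> < a" if "u \<noteq> v" using that v a by (auto simp: \<theta>_def)
  have ep: "0 < \<epsilon>" using th by (simp add: \<epsilon>_def)
  have ep': "(1 + \<epsilon>) * \<theta> = (a + \<theta>) / 2" if "u \<noteq> v" using th[OF that] that by (simp add: \<epsilon>_def field_simps)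
  have c: "0 < c" "c \<le> 1" using th by (auto simp: c_def)
  have c2: "c \<le> (a - \<theta>) / 2" if "u \<noteq> v"
    unfolding c_def using that by (simp only: if_False min.cobounded2)
  define c' where "c' = min (1/2) (\<epsilon> / 2)"
  have c': "0 < c'" "c' \<le> 1/2" "c' \<le> \<epsilon> / 2" using ep by (auto simp: c'_def)
  obtain S1 where S1: "0 < S1" "\<And>(\<kappa>::real) A. finite A \<Longrightarrow> (\<Sum>k\<in>A. 2 powr (- (c' * \<bar>real k - \<kappa>\<bar>))) \<le> S1"
    using two_sided_geometric[OF c'(1)] by auto
  obtain S2 where S2: "0 < S2" "\<And>(\<kappa>::real) A. finite A \<Longrightarrow> (\<Sum>k\<in>A. 2 powr (- (c * \<bar>real k - \<kappa>\<bar>))) \<le> S2"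
    using two_sided_geometric[OF c(1)] by auto
  define G where "G = rGamma_sup"
  have G: "0 < G" using rGamma_sup_ge_1 by (simp add: G_def)
  define M where "M = max 7 (2 + 4 * (1 + \<epsilon>) / \<epsilon>)"
  have M: "7 \<le> M" "2 + 4 * (1 + \<epsilon>) / \<epsilon> \<le> M" by (auto simp: M_def)
  \<comment> \<open>All levels together have at most \<open>exp (M * S1 * 2 powr \<kappa>)\<close> centres, which is \<open>2 powr x\<close> for \<open>2 powr \<kappa> = x / D\<close>.\<close>
  define D where "D = M * S1 / ln 2"
  have D: "0 < D" using S1 M by (simp add: D_def)
  define H where "H = 10 * G + 30 * G * S2"
  have H: "0 < H" using G S2(1) by (simp add: H_def add_pos_pos)
  define C where "C = H * max 1 D"
  have C: "0 < C" using H by (auto simp: C_def intro!: mult_pos_pos)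
  have "entropy_cover u v (rl b) x (C * x powr (- b))" if b: "0 < b" "b \<le> 1/2" and ab: "a \<le> b" and x: "0 < x" for b x
  proof -
    define \<kappa> where "\<kappa> = log 2 (x / D)"
    have kap: "2 powr \<kappa> = x / D" using x D by (simp add: \<kappa>_def)
    \<comment> \<open>For \<open>u = v\<close> there are no levels above \<open>\<kappa>\<close>; otherwise all nets beyond level \<open>K\<close> are trivial.\<close>
    define K where "K = (if u = v then nat \<lfloor>\<kappa>\<rfloor> else nat \<lceil>\<bar>\<kappa>\<bar> + \<bar>\<kappa>\<bar> / \<epsilon>\<rceil>)"
    have lev: "real (Suc i) \<le> \<kappa>" if "i < K" "u = v" for i using that unfolding K_def by simp linarith
    define N where "N i = 15 * G * 2 powr (- (b * real (Suc i)))" for i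
    define B where "B = 2 powr (- (b * \<kappa>))"
    define \<sigma> where "\<sigma> i = 2 powr (2 * (real (Suc i) - \<kappa>))" for i
    define \<tau> where "\<tau> i = 2 powr ((1 + \<epsilon>) * u * (real (Suc i) - \<kappa>))" for i
    have N: "0 < N i" and tau: "0 < \<tau> i" "0 < \<sigma> i" for i using G by (auto simp: N_def \<tau>_def \<sigma>_def)
    define Y where "Y i = (if real (Suc i) \<le> \<kappa> then net (Suc i) (N i * \<sigma> i) (2 ^ Suc i * \<sigma> i powr (- 1))
       else net (Suc i) (N i * \<tau> i) (2 ^ Suc i * \<tau> i powr (- (1 / u))))" for i
    define e where "e i = 15 * G * B * 2 powr (- (c * \<bar>real (Suc i) - \<kappa>\<bar>))" for i
    have e: "0 < e i" for i using G by (simp add: e_def B_def)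
    have err_le: "N i * 2 powr r \<le> e i" if "- (b * (real (Suc i) - \<kappa>)) + r \<le> - (c * \<bar>real (Suc i) - \<kappa>\<bar>)" for i r
    proof -
      have "2 powr (- (b * real (Suc i))) * 2 powr r \<le> B * 2 powr (- (c * \<bar>real (Suc i) - \<kappa>\<bar>))"
        unfolding B_def powr_add[symmetric] using that by (intro powr_mono) (auto simp: algebra_simps)
      then have "15 * G * (2 powr (- (b * real (Suc i))) * 2 powr r) \<le> 15 * G * (B * 2 powr (- (c * \<bar>real (Suc i) - \<kappa>\<bar>)))"
        using G by (intro mult_left_mono) auto
      then show ?thesis by (simp only: N_def e_def mult.assoc)
    qed
    have level: "\<exists>y\<in>Y i. Lnorm_le v (\<lambda>t. rl_increment b i f t - y t) (e i)"
      if f: "Lnorm_le u f 1" and i: "i < K \<or> u \<noteq> v" for f i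
    proof -
      have inc: "Lnorm_le u (rl_increment b i f) (N i)"
        using rl_increment_norm[OF f _ u0 u b, of i] by (simp add: N_def G_def)
      show ?thesis
      proof (cases "real (Suc i) \<le> \<kappa>")
        case True
        from net_approximates_uniform[OF rl_increment_cell_constant inc N tau(2) u0 u v(1)]
        obtain y where y: "y \<in> Y i" "Lnorm_le v (\<lambda>t. rl_increment b i f t - y t) (N i * \<sigma> i)"
          using True by (auto simp: Y_def)
        have "N i * \<sigma> i \<le> e i" unfolding \<sigma>_def
        proof (rule err_le)
          have "0 \<le> (2 - b - c) * (\<kappa> - real (Suc i))" using True b c by (intro mult_nonneg_nonneg) auto
          then show "- (b * (real (Suc i) - \<kappa>)) + 2 * (real (Suc i) - \<kappa>) \<le> - (c * \<bar>real (Suc i) - \<kappa>\<bar>)"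
            using True by (simp add: algebra_simps)
        qed
        from Lnorm_le_mono[OF y(2) this mult_pos_pos[OF N tau(2)] v(1)] y(1) show ?thesis by blast
      next
        case False
        then have uv: "u \<noteq> v" using i lev[of i] by auto
        then have vu: "v < u" using v by simp
        from net_approximates_nonlinear[OF rl_increment_cell_constant inc N tau(1) u v(1) vu]
        obtain y where y: "y \<in> Y i" "Lnorm_le v (\<lambda>t. rl_increment b i f t - y t) (N i * \<tau> i powr (1 - v / u))"
          using False by (auto simp: Y_def)
        have "(1 + \<epsilon>) * u * (real (Suc i) - \<kappa>) * (1 - v / u) = (1 + \<epsilon>) * \<theta> * (real (Suc i) - \<kappa>)"
          using uv v by (simp add: \<theta>_def field_simps)
        then have t: "\<tau> i powr (1 - v / u) = 2 powr ((a + \<theta>) / 2 * (real (Suc i) - \<kappa>))"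
          unfolding \<tau>_def powr_powr ep'[OF uv, symmetric] by (simp only:)
        have "N i * \<tau> i powr (1 - v / u) \<le> e i" unfolding t
        proof (rule err_le)
          have "0 \<le> (b - (a + \<theta>) / 2 - c) * (real (Suc i) - \<kappa>)"
            using False ab c2[OF uv] by (intro mult_nonneg_nonneg) (auto simp: field_simps)
          then show "- (b * (real (Suc i) - \<kappa>)) + (a + \<theta>) / 2 * (real (Suc i) - \<kappa>) \<le> - (c * \<bar>real (Suc i) - \<kappa>\<bar>)"
            using False by (simp add: left_diff_distrib abs_of_nonneg)
        qed
        from Lnorm_le_mono[OF y(2) this _ v(1)] N[of i] tau(1)[of i] y(1) show ?thesis by auto
      qed
    qed
    have Yzero: "y = (\<lambda>t. 0)" if i: "K \<le> i" and y: "y \<in> Y i" and uv: "u \<noteq> v" for i y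
    proof -
      have k: "\<bar>\<kappa>\<bar> + \<bar>\<kappa>\<bar> / \<epsilon> < real (Suc i)" using i uv unfolding K_def by (simp only: if_False) linarith
      moreover have "0 \<le> \<bar>\<kappa>\<bar> / \<epsilon>" using ep by simp
      ultimately have k1: "\<not> real (Suc i) \<le> \<kappa>" and k2: "\<bar>\<kappa>\<bar> / \<epsilon> < real (Suc i) - \<kappa>" by linarith+
      have "\<bar>\<kappa>\<bar> < \<epsilon> * (real (Suc i) - \<kappa>)" using k2 ep by (simp add: pos_divide_less_eq mult.commute)
      then have k3: "real (Suc i) + - ((1 + \<epsilon>) * (real (Suc i) - \<kappa>)) < 0" by (simp add: algebra_simps)
      have "(2::real) ^ Suc i * \<tau> i powr (- (1 / u)) = 2 powr (real (Suc i) + - ((1 + \<epsilon>) * (real (Suc i) - \<kappa>)))"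
        unfolding two_power_powr powr_add using uv v by (simp add: \<tau>_def powr_powr)
      also have "\<dots> < 2 powr 0" using k3 by (intro powr_less_mono) auto
      finally have "(2::real) ^ Suc i * \<tau> i powr (- (1 / u)) < 1" by simp
      from net_trivial[OF this] y k1 show ?thesis by (auto simp: Y_def)
    qed
    have esum: "(\<Sum>i\<in>A. e i) \<le> 15 * G * B * S2" if "finite A" for A
    proof -
      have "(\<Sum>i\<in>A. e i) = 15 * G * B * (\<Sum>k\<in>Suc ` A. 2 powr (- (c * \<bar>real k - \<kappa>\<bar>)))"
        by (simp add: e_def sum.reindex sum_distrib_left)
      also have "\<dots> \<le> 15 * G * B * S2" using G that by (intro mult_left_mono S2(2)) (auto simp: B_def)
      finally show ?thesis .
    qed
    have tailpos: "0 < 15 * G * B * S2" "0 < 10 * G * B" using G S2(1) by (auto simp: B_def)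
    have tail: "Lnorm_le v (\<lambda>t. rl b f t - rl_step b K f t) (10 * G * B + 15 * G * B * S2)"
      if f: "Lnorm_le u f 1" for f
    proof (cases "u = v")
      case True
      have "Lnorm_le v (\<lambda>t. rl b f t - rl_step b K f t) (5 * rGamma_sup * (1 / 2 ^ K) powr b * 1)"
        using f v u b unfolding True by (intro rl_step_error) auto
      then show ?thesis
      proof (rule Lnorm_le_mono[OF _ _ _ v(1)])
        have "2 powr (- (b * real K)) \<le> 2 powr (1 + - (b * \<kappa>))"
        proof (rule powr_mono)
          have "\<kappa> - 1 \<le> real K" unfolding K_def using True by simp linarith
          then have "b * (\<kappa> - 1) \<le> b * real K" using b by (intro mult_left_mono) auto
          then show "- (b * real K) \<le> 1 + - (b * \<kappa>)" using b by (simp add: algebra_simps)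
        qed simp
        also have "\<dots> = 2 * B" unfolding B_def by (subst powr_add) simp
        finally have "5 * G * 2 powr (- (b * real K)) \<le> 5 * G * (2 * B)" using G by (intro mult_left_mono) auto
        then show "5 * rGamma_sup * (1 / 2 ^ K) powr b * 1 \<le> 10 * G * B + 15 * G * B * S2"
          unfolding half_power_powr G_def[symmetric] using tailpos(1) by linarith
      qed (use G in \<open>simp add: G_def\<close>)
    next
      case False
      have "Lnorm_le v (\<lambda>t. rl b f t - rl_step b K f t) (15 * G * B * S2)"
      proof (rule rl_tail_norm[OF f u0 u b v(1) v1 e _ esum tailpos(1)])
        fix i assume "K \<le> i"
        with level[OF f disjI2[OF False], of i] Yzero[OF _ _ False] show "Lnorm_le v (rl_increment b i f) (e i)" by force
      qed
      then show ?thesis by (rule Lnorm_le_mono[OF _ _ tailpos(1) v(1)]) (use tailpos in simp)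
    qed
    show ?thesis
    proof (rule entropy_cover_assemble[where K = K and e' = "10 * G * B + 15 * G * B * S2" and e = e and Y = Y])
      show "(\<Prod>i<K. real (card (Y i))) \<le> 2 powr x"
      proof (rule prod_card_le[where B = "M * 2 powr \<kappa>" and w = "\<lambda>k. 2 powr (- (c' * \<bar>real k - \<kappa>\<bar>))" and S = S1])
        show "real (card (Y i)) \<le> exp (M * 2 powr \<kappa> * 2 powr (- (c' * \<bar>real (Suc i) - \<kappa>\<bar>)))" if i: "i < K" for i
        proof (cases "real (Suc i) \<le> \<kappa>")
          case True
          then have "real (card (Y i)) \<le> exp (7 * 2 powr \<kappa> * 2 powr (- (1 / 2 * \<bar>real (Suc i) - \<kappa>\<bar>)))"
            unfolding Y_def \<sigma>_def using net_card_coarse[OF True] by (simp only: if_True)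
          also have "\<dots> \<le> exp (M * 2 powr \<kappa> * 2 powr (- (c' * \<bar>real (Suc i) - \<kappa>\<bar>)))"
          proof -
            have "c' * \<bar>real (Suc i) - \<kappa>\<bar> \<le> 1 / 2 * \<bar>real (Suc i) - \<kappa>\<bar>" using c' by (intro mult_right_mono) auto
            then have "2 powr (- (1 / 2 * \<bar>real (Suc i) - \<kappa>\<bar>)) \<le> 2 powr (- (c' * \<bar>real (Suc i) - \<kappa>\<bar>))"
              by (intro powr_mono) auto
            then show ?thesis unfolding exp_le_cancel_iff using M by (intro mult_mono) auto
          qed
          finally show ?thesis .
        next
          case False
          then have k: "\<kappa> < real (Suc i)" and "u \<noteq> v" using i lev[of i] by auto
          then have "0 < u" using v by simp
          have "real (card (Y i)) \<le> exp ((2 + 4 * (1 + \<epsilon>) / \<epsilon>) * 2 powr \<kappa> * 2 powr (- (\<epsilon> / 2 * \<bar>real (Suc i) - \<kappa>\<bar>)))"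
            unfolding Y_def \<tau>_def using net_card_fine[OF k ep \<open>0 < u\<close>] False by (simp only: if_False)
          also have "\<dots> \<le> exp (M * 2 powr \<kappa> * 2 powr (- (c' * \<bar>real (Suc i) - \<kappa>\<bar>)))"
          proof -
            have "c' * \<bar>real (Suc i) - \<kappa>\<bar> \<le> \<epsilon> / 2 * \<bar>real (Suc i) - \<kappa>\<bar>" using c' by (intro mult_right_mono) auto
            then have "2 powr (- (\<epsilon> / 2 * \<bar>real (Suc i) - \<kappa>\<bar>)) \<le> 2 powr (- (c' * \<bar>real (Suc i) - \<kappa>\<bar>))"
              by (intro powr_mono) auto
            then show ?thesis unfolding exp_le_cancel_iff using M by (intro mult_mono) auto
          qed
          finally show ?thesis .
        qed
        show "M * 2 powr \<kappa> * S1 \<le> x * ln 2" unfolding kap D_def using S1(1) M by simp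
      qed (use S1 M in auto)
      show "10 * G * B + 15 * G * B * S2 + (\<Sum>i<K. e i) \<le> C * x powr (- b)"
      proof -
        have "10 * G * B + 15 * G * B * S2 + (\<Sum>i<K. e i) \<le> 10 * G * B + 15 * G * B * S2 + 15 * G * B * S2"
          by (intro add_left_mono esum) simp
        also have "\<dots> = H * B" by (simp add: H_def algebra_simps)
        also have "\<dots> \<le> H * (max 1 D * x powr (- b))"
          unfolding B_def \<kappa>_def using H D x b by (intro mult_left_mono powr_scale_le) auto
        finally show ?thesis by (simp add: C_def mult.assoc)
      qed
      show "finite (Y i)" for i by (simp add: Y_def net_finite)
      show "Lnorm_finite v y" if "y \<in> Y i" for i y
        using that v net_Lnorm_finite by (auto simp: Y_def split: if_splits)
      show "0 < 10 * G * B + 15 * G * B * S2" by (rule add_pos_pos[OF tailpos(2,1)])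
    qed (use v v1 e level tail in auto)
  qed
  then show ?thesis using C by blast
qed

section \<open>Composition and large orders\<close>

lemma Lnorm_le_scale:
  assumes "Lnorm_le u f c" "0 < k" "0 < c" "0 \<le> u"
  shows "Lnorm_le u (\<lambda>t. k * f t) (k * c)"
proof (rule Lnorm_le_dominated[OF assms(1)])
  have [measurable]: "f \<in> borel_measurable leb01" using assms(1) by (rule Lnorm_le_measurable)
  show "(\<lambda>t. k * f t) \<in> borel_measurable leb01" by measurable
  show "AE t in leb01. \<bar>k * f t\<bar> \<le> k * \<bar>f t\<bar>" using assms by (simp add: abs_mult)
qed (use assms in auto)

lemma entropy_cover_mono:
  assumes "entropy_cover u v T x e" "e \<le> e'" "0 < e" "0 \<le> v"
  shows "entropy_cover u v T x e'"
proof -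
  obtain Y where Y: "finite Y" "real (card Y) \<le> 2 powr x" "\<forall>y\<in>Y. Lnorm_finite v y"
    "\<And>f. Lnorm_le u f 1 \<Longrightarrow> \<exists>y\<in>Y. Lnorm_le v (\<lambda>t. T f t - y t) e"
    using assms(1) unfolding entropy_cover_def by blast
  have "\<exists>y\<in>Y. Lnorm_le v (\<lambda>t. T f t - y t) e'" if "Lnorm_le u f 1" for f
    using Y(4)[OF that] Lnorm_le_mono[OF _ assms(2-4)] by blast
  then show ?thesis unfolding entropy_cover_def using Y(1-3) by blast
qed

text \<open>
Coverings by balls with centres of finite norm show that the operator is bounded. This supplies the
mapping property from \<open>L\<^sub>p\<close> to \<open>L\<^sub>q\<close>.
\<close>

lemma entropy_cover_finite:
  assumes cov: "entropy_cover w v (rl b) x e" and e: "0 < e" and y: "Lnorm_finite w y"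
    and w: "0 \<le> w" and v: "0 \<le> v" "v \<le> 1"
  shows "Lnorm_finite v (rl b y)"
proof -
  obtain Y where Y: "\<forall>y\<in>Y. Lnorm_finite v y"
    "\<And>f. Lnorm_le w f 1 \<Longrightarrow> \<exists>y\<in>Y. Lnorm_le v (\<lambda>t. rl b f t - y t) e"
    using cov unfolding entropy_cover_def by blast
  obtain c where c: "0 < c" "Lnorm_le w y c" using y unfolding Lnorm_finite_def by blast
  have "Lnorm_le w (\<lambda>t. 1 / c * y t) (1 / c * c)" using c w by (intro Lnorm_le_scale) auto
  then have "Lnorm_le w (\<lambda>t. 1 / c * y t) 1" using c by simp
  from Y(2)[OF this] obtain z where z: "z \<in> Y" "Lnorm_le v (\<lambda>t. rl b (\<lambda>t. 1 / c * y t) t - z t) e" by blast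
  have "Lnorm_finite v (\<lambda>t. (rl b (\<lambda>t. 1 / c * y t) t - z t) + z t)"
    by (rule Lnorm_finite_add) (use z Y(1) e v in \<open>auto simp: Lnorm_finite_def\<close>)
  then obtain d where d: "0 < d" "Lnorm_le v (\<lambda>t. 1 / c * rl b y t) d"
    unfolding Lnorm_finite_def rl_cmult by auto
  have "Lnorm_le v (\<lambda>t. c * (1 / c * rl b y t)) (c * d)" using c d v by (intro Lnorm_le_scale) auto
  then have "Lnorm_le v (rl b y) (c * d)" using c by simp
  then show ?thesis unfolding Lnorm_finite_def using c d by (intro exI[of _ "c * d"]) auto
qed

lemma Lnorm_finite_maximal:
  assumes "Lnorm_finite v f" "0 \<le> v" "v \<le> 1"
  shows "AE t in leb01. maximal f t < \<infinity>"
  using assms maximal_finite_AE unfolding Lnorm_finite_def by blast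

lemma entropy_cover_compose:
  assumes 1: "entropy_cover u w (rl b) x e" and 2: "entropy_cover w v (rl b') x' e'"
    and e: "0 < e" "0 < e'" and b: "0 < b" "0 < b'"
    and u: "0 \<le> u" "u \<le> 1" and w: "0 \<le> w" "w \<le> 1" and v: "0 \<le> v" "v \<le> 1"
  shows "entropy_cover u v (rl (b' + b)) (x + x') (e * e')"
proof -
  obtain Y where Y: "finite Y" "real (card Y) \<le> 2 powr x" "\<And>y. y \<in> Y \<Longrightarrow> Lnorm_finite w y"
    "\<And>f. Lnorm_le u f 1 \<Longrightarrow> \<exists>y\<in>Y. Lnorm_le w (\<lambda>t. rl b f t - y t) e"
    using 1 unfolding entropy_cover_def by blast
  obtain Z where Z: "finite Z" "real (card Z) \<le> 2 powr x'" "\<And>y. y \<in> Z \<Longrightarrow> Lnorm_finite v y"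
    "\<And>f. Lnorm_le w f 1 \<Longrightarrow> \<exists>y\<in>Z. Lnorm_le v (\<lambda>t. rl b' f t - y t) e'"
    using 2 unfolding entropy_cover_def by blast
  define F where "F = (\<lambda>(y, z) t. rl b' y t + e * (z t :: real))"
  have "real (card (F ` (Y \<times> Z))) \<le> real (card Y * card Z)"
    using card_image_le[of "Y \<times> Z" F] Y(1) Z(1)
    by (simp add: card_cartesian_product del: of_nat_mult)
  also have "\<dots> \<le> 2 powr x * 2 powr x'" using Y(2) Z(2) by (simp add: mult_mono)
  finally have card: "real (card (F ` (Y \<times> Z))) \<le> 2 powr (x + x')" by (simp add: powr_add)
  have fin: "Lnorm_finite v y" if "y \<in> F ` (Y \<times> Z)" for y
  proof -
    obtain y1 z where yz: "y1 \<in> Y" "z \<in> Z" "y = (\<lambda>t. rl b' y1 t + e * z t)" using \<open>y \<in> _\<close> by (auto simp: F_def)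
    obtain c where c: "0 < c" "Lnorm_le v z c" using Z(3)[OF yz(2)] unfolding Lnorm_finite_def by blast
    have "Lnorm_le v (\<lambda>t. e * z t) (e * c)" using c e v by (intro Lnorm_le_scale) auto
    then have "Lnorm_finite v (\<lambda>t. e * z t)" using c e unfolding Lnorm_finite_def by (intro exI[of _ "e * c"]) auto
    then show ?thesis unfolding yz(3)
      using entropy_cover_finite[OF 2 e(2) Y(3)[OF yz(1)] w(1) v] v by (intro Lnorm_finite_add)
  qed
  have "\<exists>y\<in>F ` (Y \<times> Z). Lnorm_le v (\<lambda>t. rl (b' + b) f t - y t) (e * e')" if f: "Lnorm_le u f 1" for f
  proof -
    obtain y where y: "y \<in> Y" "Lnorm_le w (\<lambda>t. rl b f t - y t) e" using Y(4)[OF f] by blast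
    define g where "g = (\<lambda>t. 1 / e * (rl b f t - y t))"
    have "Lnorm_le w g (1 / e * e)" unfolding g_def using y e w by (intro Lnorm_le_scale) auto
    then have "Lnorm_le w g 1" using e by simp
    from Z(4)[OF this] obtain z where z: "z \<in> Z" "Lnorm_le v (\<lambda>t. rl b' g t - z t) e'" by blast
    have scaled: "Lnorm_le v (\<lambda>t. e * (rl b' g t - z t)) (e * e')" using z e v by (intro Lnorm_le_scale) auto
    have fM[measurable]: "f \<in> borel_measurable leb01" using f by (rule Lnorm_le_measurable)
    have yM[measurable]: "y \<in> borel_measurable leb01" using Y(3)[OF y(1)] by (rule Lnorm_finite_measurable)
    have zM[measurable]: "z \<in> borel_measurable leb01" using Z(3)[OF z(1)] by (rule Lnorm_finite_measurable)
    have "Lnorm_finite w (\<lambda>t. (rl b f t - y t) + y t)"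
      using y Y(3)[OF y(1)] e w by (intro Lnorm_finite_add) (auto simp: Lnorm_finite_def)
    then have "Lnorm_finite w (rl b f)" by simp
    from Lnorm_finite_maximal[OF this w] Lnorm_finite_maximal[OF Y(3)[OF y(1)] w] maximal_finite_AE[OF f zero_less_one u]
    have "AE t in leb01. rl (b' + b) f t - F (y, z) t = e * (rl b' g t - z t)"
      using AE_space
    proof eventually_elim
      case (elim t)
      have "rl b' (\<lambda>t. rl b f t - y t) t = rl b' (rl b f) t - rl b' y t"
        by (intro rl_diff rl_abs_finite b elim) measurable
      also have "rl b' (rl b f) t = rl (b' + b) f t"
        by (intro rl_semigroup rl_abs_finite b) (use elim b in \<open>auto intro: add_pos_pos\<close>)
      finally have "rl b' g t = 1 / e * (rl (b' + b) f t - rl b' y t)" unfolding g_def rl_cmult by simp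
      then have "e * rl b' g t = rl (b' + b) f t - rl b' y t" using e by simp
      then show ?case by (simp add: F_def right_diff_distrib)
    qed
    moreover have "(\<lambda>t. rl (b' + b) f t - F (y, z) t) \<in> borel_measurable leb01"
      unfolding F_def prod.case by measurable
    ultimately have "Lnorm_le v (\<lambda>t. rl (b' + b) f t - F (y, z) t) (e * e')"
      using e v by (intro Lnorm_le_cong_AE[OF scaled]) auto
    then show ?thesis using y z by blast
  qed
  then show ?thesis unfolding entropy_cover_def using card fin Y(1) Z(1)
    by (intro exI[of _ "F ` (Y \<times> Z)"]) auto
qed

text \<open>
For \<open>u = v\<close> the choice \<open>a = 0\<close> is allowed, and the constant is then uniform even for orders
tending to \<open>0\<close>; for \<open>u > v\<close> the orders stay away from \<open>u - v\<close>.
\<close>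

definition uniform_cover :: "real \<Rightarrow> bool" where
  "uniform_cover B \<longleftrightarrow> (\<forall>u v a. 0 \<le> v \<longrightarrow> v \<le> u \<longrightarrow> u \<le> 1 \<longrightarrow> 0 \<le> a \<longrightarrow> u = v \<or> u - v < a \<longrightarrow>
     (\<exists>C>0. \<forall>b. 0 < b \<and> a \<le> b \<and> b \<le> B \<longrightarrow> (\<forall>x>0. entropy_cover u v (rl b) x (C * x powr (- b)))))"

lemma uniform_cover_half: "uniform_cover (1 / 2)"
  unfolding uniform_cover_def
proof (intro allI impI)
  fix u v a :: real
  assume *: "0 \<le> v" "v \<le> u" "u \<le> 1" "0 \<le> a" "u = v \<or> u - v < a"
  show "\<exists>C>0. \<forall>b. 0 < b \<and> a \<le> b \<and> b \<le> 1 / 2 \<longrightarrow> (\<forall>x>0. entropy_cover u v (rl b) x (C * x powr (- b)))"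
    using rl_cover_small_order[OF *(1-3,5)] .
qed

text \<open>
Both halves of the order meet half of the gap between the exponents, so that the hypothesis
\<open>u - v < a\<close> is inherited by each of them.
\<close>

lemma uniform_cover_double:
  assumes "uniform_cover B" "0 < B"
  shows "uniform_cover (2 * B)"
  unfolding uniform_cover_def
proof (intro allI impI)
  fix u v a :: real
  assume *: "0 \<le> v" "v \<le> u" "u \<le> 1" "0 \<le> a" "u = v \<or> u - v < a"
  define w where "w = (u + v) / 2"
  have w: "0 \<le> w" "w \<le> 1" "v \<le> w" "w \<le> u" using * by (auto simp: w_def)
  have uw: "u = w \<or> u - w < a / 2" and wv: "w = v \<or> w - v < a / 2" using *(5) by (auto simp: w_def field_simps)
  obtain C1 where C1: "0 < C1" "\<And>b x. 0 < b \<Longrightarrow> a / 2 \<le> b \<Longrightarrow> b \<le> B \<Longrightarrow> 0 < x \<Longrightarrow> entropy_cover u w (rl b) x (C1 * x powr (- b))"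
    using assms(1)[unfolded uniform_cover_def, rule_format, of w u "a / 2"] uw w * by auto
  obtain C2 where C2: "0 < C2" "\<And>b x. 0 < b \<Longrightarrow> a / 2 \<le> b \<Longrightarrow> b \<le> B \<Longrightarrow> 0 < x \<Longrightarrow> entropy_cover w v (rl b) x (C2 * x powr (- b))"
    using assms(1)[unfolded uniform_cover_def, rule_format, of v w "a / 2"] wv w * by auto
  have "entropy_cover u v (rl b) x (C1 * C2 * 2 powr (2 * B) * x powr (- b))"
    if b: "0 < b" "a \<le> b" "b \<le> 2 * B" and x: "0 < x" for b x
  proof -
    let ?y = "(x / 2) powr (- (b / 2))"
    have y: "0 < ?y" using x by simp
    have "entropy_cover u v (rl (b / 2 + b / 2)) (x / 2 + x / 2) ((C1 * ?y) * (C2 * ?y))"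
    proof (rule entropy_cover_compose[where w = w])
      show "entropy_cover u w (rl (b / 2)) (x / 2) (C1 * ?y)" using b x by (intro C1) auto
      show "entropy_cover w v (rl (b / 2)) (x / 2) (C2 * ?y)" using b x by (intro C2) auto
    qed (use C1(1) C2(1) y b w * in auto)
    moreover have "(C1 * ?y) * (C2 * ?y) = C1 * C2 * (x / 2) powr (- b)"
    proof -
      have "?y * ?y = (x / 2) powr (- b)" by (simp add: powr_add[symmetric])
      then show ?thesis by (simp add: mult_ac)
    qed
    ultimately have cov: "entropy_cover u v (rl b) x (C1 * C2 * (x / 2) powr (- b))" by simp
    have "(x / 2) powr (- b) = 2 powr b * x powr (- b)" using x by (simp add: powr_divide powr_minus field_simps)
    also have "\<dots> \<le> 2 powr (2 * B) * x powr (- b)" using b by (intro mult_right_mono powr_mono) auto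
    finally have "C1 * C2 * (x / 2) powr (- b) \<le> C1 * C2 * (2 powr (2 * B) * x powr (- b))"
      using C1(1) C2(1) by (intro mult_left_mono) auto
    from entropy_cover_mono[OF cov this] C1(1) C2(1) x * show ?thesis by (simp add: mult.assoc)
  qed
  then show "\<exists>C>0. \<forall>b. 0 < b \<and> a \<le> b \<and> b \<le> 2 * B \<longrightarrow> (\<forall>x>0. entropy_cover u v (rl b) x (C * x powr (- b)))"
    using C1(1) C2(1) by (intro exI[of _ "C1 * C2 * 2 powr (2 * B)"]) auto
qed

lemma uniform_cover_all: "uniform_cover B"
proof -
  have pow: "uniform_cover (2 ^ n / 2)" for n
  proof (induction n)
    case 0
    then show ?case using uniform_cover_half by simp
  next
    case (Suc n)
    have "uniform_cover (2 * (2 ^ n / 2))" by (rule uniform_cover_double[OF Suc]) simp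
    then show ?case by simp
  qed
  obtain n :: nat where "2 * B < 2 ^ n" using real_arch_pow[of 2 "2 * B"] by auto
  then have n: "B \<le> 2 ^ n / 2" by simp
  show ?thesis unfolding uniform_cover_def
  proof (intro allI impI)
    fix u v a :: real
    assume *: "0 \<le> v" "v \<le> u" "u \<le> 1" "0 \<le> a" "u = v \<or> u - v < a"
    obtain C where "C > 0" "\<forall>b. 0 < b \<and> a \<le> b \<and> b \<le> 2 ^ n / 2 \<longrightarrow> (\<forall>x>0. entropy_cover u v (rl b) x (C * x powr (- b)))"
      using pow[of n, unfolded uniform_cover_def, rule_format, OF *] by blast
    then show "\<exists>C>0. \<forall>b. 0 < b \<and> a \<le> b \<and> b \<le> B \<longrightarrow> (\<forall>x>0. entropy_cover u v (rl b) x (C * x powr (- b)))"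
      using n by (intro exI[of _ C]) auto
  qed
qed

section \<open>Variable order\<close>

text \<open>
The operator of order \<open>g t\<close> at the point \<open>t\<close>, where order zero means the identity.
\<close>

definition rl_excess :: "(real \<Rightarrow> real) \<Rightarrow> (real \<Rightarrow> real) \<Rightarrow> real \<Rightarrow> real" where
  "rl_excess g w t = (if 0 < g t then rl (g t) w t else w t)"

lemma rl_excess_measurable:
  assumes [measurable]: "g \<in> borel_measurable leb01" "w \<in> borel_measurable leb01"
  shows "rl_excess g w \<in> borel_measurable leb01"
proof -
  have [measurable]: "(\<lambda>t. rl (g t) w t) \<in> borel_measurable leb01" by (rule rl_var_measurable) measurable
  show ?thesis unfolding rl_excess_def[abs_def] by measurable
qed

text \<open>
The constant comes from the maximal inequality and does not depend on \<open>g\<close>.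
\<close>

lemma rl_excess_bounded:
  assumes v: "0 \<le> v" "v < 1"
  shows "\<exists>A>0. \<forall>g w e. g \<in> borel_measurable leb01 \<longrightarrow> 0 < e \<longrightarrow> Lnorm_le v w e \<longrightarrow> Lnorm_le v (rl_excess g w) (A * e)"
proof -
  obtain A where A: "0 < A" "\<And>f c r. 0 < c \<Longrightarrow> Lnorm_le v f c \<Longrightarrow> r \<in> borel_measurable leb01 \<Longrightarrow>
     (AE t in leb01. ennreal \<bar>r t\<bar> \<le> maximal f t) \<Longrightarrow> Lnorm_le v r (A * c)"
    using maximal_strong_type[OF v] by blast
  define G where "G = 4 * rGamma_sup"
  have G: "0 < G" using rGamma_sup_ge_1 by (simp add: G_def)
  have "Lnorm_le v (rl_excess g w) ((G * A + 1) * e)"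
    if gM: "g \<in> borel_measurable leb01" and e: "0 < e" and w: "Lnorm_le v w e" for g w e
  proof -
    have [measurable]: "w \<in> borel_measurable leb01" "g \<in> borel_measurable leb01"
      using w gM by (auto intro: Lnorm_le_measurable)
    have [measurable]: "(\<lambda>t. rl (g t) w t) \<in> borel_measurable leb01" by (rule rl_var_measurable) measurable
    define r where "r t = 1 / G * (if 0 < g t then rl (g t) w t else 0)" for t
    have "Lnorm_le v r (A * e)"
    proof (rule A(2)[OF e w])
      show "r \<in> borel_measurable leb01" unfolding r_def[abs_def] by measurable
      have "ennreal \<bar>r t\<bar> \<le> maximal w t" for t
      proof (cases "0 < g t")
        case True
        have "ennreal \<bar>r t\<bar> = ennreal (1 / G) * ennreal \<bar>rl (g t) w t\<bar>"
          using True G by (simp add: r_def abs_mult ennreal_mult[symmetric])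
        also have "\<dots> \<le> ennreal (1 / G) * (ennreal G * maximal w t)"
          unfolding G_def using rl_le_rl_abs[of w "g t" t] rl_abs_le_maximal[of w "g t" t] True
          by (intro mult_left_mono) (auto intro: order_trans)
        also have "\<dots> = maximal w t" using G by (simp add: mult.assoc[symmetric] ennreal_mult[symmetric])
        finally show ?thesis .
      qed (simp add: r_def)
      then show "AE t in leb01. ennreal \<bar>r t\<bar> \<le> maximal w t" by simp
    qed
    then have 1: "Lnorm_le v (\<lambda>t. G * r t) (G * (A * e))" using G A(1) e v by (intro Lnorm_le_scale) auto
    have 2: "Lnorm_le v (\<lambda>t. if 0 < g t then 0 else w t) (1 * e)"
      by (rule Lnorm_le_dominated[OF w]) (use e v in auto)
    have "Lnorm_le v (\<lambda>t. G * r t + (if 0 < g t then 0 else w t)) (G * (A * e) + 1 * e)"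
      using G A(1) e v by (intro Lnorm_le_add 1 2) auto
    moreover have "(\<lambda>t. G * r t + (if 0 < g t then 0 else w t)) = rl_excess g w"
      using G by (auto simp: r_def rl_excess_def)
    ultimately show ?thesis by (simp add: algebra_simps)
  qed
  moreover have "0 < G * A + 1" using G A(1) by (simp add: add_pos_pos)
  ultimately show ?thesis by blast
qed

text \<open>
The excess of the order over its lower bound is realized by \<^const>\<open>rl_excess\<close>, applied to the
centres of a covering for the constant order. The exceptional null set consists of the points where
a maximal function is infinite; it does not depend on the order, so that the semigroup law may be
used with an order depending on the point.
\<close>

lemma entropy_cover_variable_order:
  assumes v: "0 \<le> v" "v < 1"
  shows "\<exists>A>0. \<forall>u \<alpha> \<alpha>0 x e. 0 \<le> u \<longrightarrow> u \<le> 1 \<longrightarrow> \<alpha> \<in> borel_measurable leb01 \<longrightarrow> 0 < \<alpha>0 \<longrightarrow>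
     (\<forall>t\<in>{0..1}. \<alpha>0 \<le> \<alpha> t) \<longrightarrow> 0 < e \<longrightarrow> entropy_cover u v (rl \<alpha>0) x e \<longrightarrow>
     entropy_cover u v (\<lambda>f t. rl (\<alpha> t) f t) x (A * e)"
proof -
  have v1: "v \<le> 1" using v by simp
  obtain A where A: "0 < A" "\<And>g w e. g \<in> borel_measurable leb01 \<Longrightarrow> 0 < e \<Longrightarrow> Lnorm_le v w e \<Longrightarrow> Lnorm_le v (rl_excess g w) (A * e)"
    using rl_excess_bounded[OF v] by blast
  have "entropy_cover u v (\<lambda>f t. rl (\<alpha> t) f t) x (A * e)"
    if u: "0 \<le> u" "u \<le> 1" and al[measurable]: "\<alpha> \<in> borel_measurable leb01" and a0: "0 < \<alpha>0"
      and ge: "\<And>t. t \<in> {0..1} \<Longrightarrow> \<alpha>0 \<le> \<alpha> t" and e: "0 < e" and cov: "entropy_cover u v (rl \<alpha>0) x e"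
    for u \<alpha> \<alpha>0 x e
  proof -
    define g where "g t = \<alpha> t - \<alpha>0" for t
    have g[measurable]: "g \<in> borel_measurable leb01" unfolding g_def[abs_def] by measurable
    obtain Y where Y: "finite Y" "real (card Y) \<le> 2 powr x" "\<And>y. y \<in> Y \<Longrightarrow> Lnorm_finite v y"
      "\<And>f. Lnorm_le u f 1 \<Longrightarrow> \<exists>y\<in>Y. Lnorm_le v (\<lambda>t. rl \<alpha>0 f t - y t) e"
      using cov unfolding entropy_cover_def by blast
    have "real (card (rl_excess g ` Y)) \<le> 2 powr x" using card_image_le[OF Y(1), of "rl_excess g"] Y(2) by linarith
    moreover have "Lnorm_finite v (rl_excess g y)" if "y \<in> Y" for y
      using Y(3)[OF that] A(2)[OF g] A(1) unfolding Lnorm_finite_def by (meson mult_pos_pos)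
    moreover have "\<exists>y\<in>rl_excess g ` Y. Lnorm_le v (\<lambda>t. rl (\<alpha> t) f t - y t) (A * e)" if f: "Lnorm_le u f 1" for f
    proof -
      obtain y where y: "y \<in> Y" "Lnorm_le v (\<lambda>t. rl \<alpha>0 f t - y t) e" using Y(4)[OF f] by blast
      have fM[measurable]: "f \<in> borel_measurable leb01" using f by (rule Lnorm_le_measurable)
      have yM[measurable]: "y \<in> borel_measurable leb01" using Y(3)[OF y(1)] by (rule Lnorm_finite_measurable)
      have "Lnorm_finite v (\<lambda>t. (rl \<alpha>0 f t - y t) + y t)"
        using y Y(3)[OF y(1)] e v v1 by (intro Lnorm_finite_add) (auto simp: Lnorm_finite_def)
      then have "Lnorm_finite v (rl \<alpha>0 f)" by simp
      from Lnorm_finite_maximal[OF this v(1) v1] Lnorm_finite_maximal[OF Y(3)[OF y(1)] v(1) v1] maximal_finite_AE[OF f zero_less_one u]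
      have AE: "AE t in leb01. rl (\<alpha> t) f t - rl_excess g y t = rl_excess g (\<lambda>t. rl \<alpha>0 f t - y t) t"
        using AE_space
      proof eventually_elim
        case (elim t)
        have t: "t \<in> {0..1}" using elim by simp
        show ?case
        proof (cases "0 < g t")
          case True
          have "rl (g t) (\<lambda>t. rl \<alpha>0 f t - y t) t = rl (g t) (rl \<alpha>0 f) t - rl (g t) y t"
            by (intro rl_diff rl_abs_finite True elim) measurable
          also have "rl (g t) (rl \<alpha>0 f) t = rl (g t + \<alpha>0) f t"
            by (intro rl_semigroup rl_abs_finite True a0 t) (use elim True a0 in \<open>auto intro: add_pos_pos\<close>)
          finally show ?thesis using True by (simp add: rl_excess_def g_def)
        next
          case False
          then have "\<alpha> t = \<alpha>0" using ge[OF t] by (simp add: g_def)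
          then show ?thesis using False by (simp add: rl_excess_def)
        qed
      qed
      have M[measurable]: "(\<lambda>t. rl (\<alpha> t) f t) \<in> borel_measurable leb01" by (rule rl_var_measurable) measurable
      have M'[measurable]: "rl_excess g y \<in> borel_measurable leb01" by (rule rl_excess_measurable) measurable
      have "Lnorm_le v (\<lambda>t. rl (\<alpha> t) f t - rl_excess g y t) (A * e)"
        by (rule Lnorm_le_cong_AE[OF A(2)[OF g e y(2)] _ AE]) (use A(1) e v in auto)
      then show ?thesis using y(1) by blast
    qed
    ultimately show ?thesis unfolding entropy_cover_def using Y(1)
      by (intro exI[of _ "rl_excess g ` Y"]) auto
  qed
  then show ?thesis using A(1) by blast
qed

section \<open>Entropy numbers of the operator of variable order\<close>

lemma RL_operator_eq_rl:
  assumes t: "t \<in> {0..1}"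
  shows "RL_operator \<alpha> f t = rl (\<alpha> t) f t"
proof -
  have "rl (\<alpha> t) f t = (\<integral>s. indicator {0..1} s *\<^sub>R (rl_kernel (\<alpha> t) (t - s) * f s) \<partial>lebesgue)"
    unfolding rl_def by (subst integral_restrict_space) auto
  also have "\<dots> = (\<integral>s. rGamma (\<alpha> t) * (indicator {0..t} s *\<^sub>R ((t - s) powr (\<alpha> t - 1) * f s)) \<partial>lebesgue)"
    using t by (intro Bochner_Integration.integral_cong refl) (auto simp: rl_kernel_def split: split_indicator)
  also have "\<dots> = rGamma (\<alpha> t) * (\<integral>s. indicator {0..t} s *\<^sub>R ((t - s) powr (\<alpha> t - 1) * f s) \<partial>lebesgue)"
    by simp
  also have "(\<integral>s. indicator {0..t} s *\<^sub>R ((t - s) powr (\<alpha> t - 1) * f s) \<partial>lebesgue)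
     = (\<integral>s. (t - s) powr (\<alpha> t - 1) * f s \<partial>lebesgue_on {0..t})"
    by (subst integral_restrict_space) auto
  finally show ?thesis by (simp add: RL_operator_def rGamma_inverse_Gamma divide_inverse)
qed

lemma exponent_cases:
  assumes "1 \<le> (p::ennreal)"
  obtains "p = \<infinity>" "enn2real (1 / p) = 0"
  | r where "p = ennreal r" "1 \<le> r" "enn2real p = r" "p \<noteq> \<infinity>" "enn2real (1 / p) = 1 / r"
proof (cases p)
  case (real r)
  then have r: "1 \<le> r" using assms by simp
  have "1 / p = ennreal (1 / r)" using real r by (simp add: divide_ennreal[symmetric])
  then show ?thesis using real r that(2)[of r] by simp
next
  case top
  then show ?thesis using that(1) by simp
qed

lemma Lnorm_finite_imp_Lp_space:
  assumes p: "1 \<le> p" and f: "Lnorm_finite (enn2real (1 / p)) f"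
  shows "f \<in> Lp_space leb01 p"
proof -
  obtain c where c: "0 < c" "Lnorm_le (enn2real (1 / p)) f c" using f by (auto simp: Lnorm_finite_def)
  have [measurable]: "f \<in> borel_measurable leb01" using c(2) by (rule Lnorm_le_measurable)
  from p show ?thesis
  proof (cases p rule: exponent_cases)
    case 1
    then have "AE t in leb01. \<bar>f t\<bar> \<le> c" using c by (simp add: Lnorm_le_def)
    then have "AE t in leb01. ereal \<bar>f t\<bar> \<le> ereal c" by simp
    then have "esssup leb01 (\<lambda>t. ereal \<bar>f t\<bar>) \<le> ereal c" by (intro esssup_I) measurable
    then have "esssup leb01 (\<lambda>t. ereal \<bar>f t\<bar>) < \<infinity>" by (rule le_less_trans) simp
    then show ?thesis using 1 by (simp add: Lp_space_def)
  next
    case (2 r)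
    have "(\<integral>\<^sup>+t. ennreal (\<bar>f t\<bar> powr r) \<partial>leb01) = (\<integral>\<^sup>+t. ennreal (c powr r) * ennreal ((\<bar>f t\<bar> / c) powr r) \<partial>leb01)"
    proof (rule nn_integral_cong)
      fix t
      have "\<bar>f t\<bar> powr r = c powr r * (\<bar>f t\<bar> / c) powr r" using c by (subst powr_mult[symmetric]) auto
      then show "ennreal (\<bar>f t\<bar> powr r) = ennreal (c powr r) * ennreal ((\<bar>f t\<bar> / c) powr r)"
        by (simp only: ennreal_mult powr_ge_zero)
    qed
    also have "\<dots> = ennreal (c powr r) * (\<integral>\<^sup>+t. ennreal ((\<bar>f t\<bar> / c) powr r) \<partial>leb01)"
      by (intro nn_integral_cmult) measurable
    also have "\<dots> \<le> ennreal (c powr r) * 1"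
      using c 2 by (intro mult_left_mono) (auto simp: Lnorm_le_def)
    also have "\<dots> < \<infinity>" by simp
    finally have "integrable leb01 (\<lambda>t. \<bar>f t\<bar> powr r)" by (intro integrableI_bounded) auto
    then show ?thesis using 2 by (simp add: Lp_space_def)
  qed
qed

lemma unit_ball_imp_Lnorm_le:
  assumes p: "1 \<le> p" and f: "f \<in> unit_ball (Lp_space leb01 p) (Lp_norm leb01 p)"
  shows "Lnorm_le (enn2real (1 / p)) f 1"
proof -
  have [measurable]: "f \<in> borel_measurable leb01" using f by (auto simp: unit_ball_def Lp_space_def)
  from p show ?thesis
  proof (cases p rule: exponent_cases)
    case 1
    define s where "s = esssup leb01 (\<lambda>t. ereal \<bar>f t\<bar>)"
    have s: "s < \<infinity>" "real_of_ereal s \<le> 1"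
      using f 1 by (auto simp: unit_ball_def Lp_space_def Lp_norm_def s_def)
    have "AE t in leb01. ereal \<bar>f t\<bar> \<le> s" unfolding s_def by (rule esssup_AE)
    then have "AE t in leb01. \<bar>f t\<bar> \<le> 1"
    proof eventually_elim
      case (elim t)
      then show ?case using s by (cases s) auto
    qed
    then show ?thesis using 1 by (simp add: Lnorm_le_def)
  next
    case (2 r)
    define s where "s = (\<integral>t. \<bar>f t\<bar> powr r \<partial>leb01)"
    have int: "integrable leb01 (\<lambda>t. \<bar>f t\<bar> powr r)" and s: "s powr (1 / r) \<le> 1"
      using f 2 by (auto simp: unit_ball_def Lp_space_def Lp_norm_def s_def)
    have "s \<le> 1"
    proof (rule ccontr)
      assume "\<not> s \<le> 1"
      then have "1 powr (1 / r) < s powr (1 / r)" using 2 by (intro powr_less_mono2) auto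
      then show False using s by simp
    qed
    have "(\<integral>\<^sup>+t. ennreal (\<bar>f t\<bar> powr r) \<partial>leb01) = ennreal s"
      unfolding s_def by (rule nn_integral_eq_integral[OF int]) simp
    then show ?thesis using 2 \<open>s \<le> 1\<close> by (simp add: Lnorm_le_def)
  qed
qed

lemma Lnorm_le_imp_unit_ball:
  assumes p: "1 \<le> p" and f: "Lnorm_le (enn2real (1 / p)) f 1"
  shows "f \<in> unit_ball (Lp_space leb01 p) (Lp_norm leb01 p)"
proof -
  have [measurable]: "f \<in> borel_measurable leb01" using f by (rule Lnorm_le_measurable)
  have space: "f \<in> Lp_space leb01 p"
    by (rule Lnorm_finite_imp_Lp_space[OF p]) (use f in \<open>auto simp: Lnorm_finite_def intro: exI[of _ 1]\<close>)
  from p have "Lp_norm leb01 p f \<le> 1"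
  proof (cases p rule: exponent_cases)
    case 1
    define s where "s = esssup leb01 (\<lambda>t. ereal \<bar>f t\<bar>)"
    have "AE t in leb01. \<bar>f t\<bar> \<le> 1" using f 1 by (simp add: Lnorm_le_def)
    then have "AE t in leb01. ereal \<bar>f t\<bar> \<le> 1" by (simp add: one_ereal_def)
    then have "s \<le> 1" unfolding s_def by (intro esssup_I) measurable
    then have "real_of_ereal s \<le> 1" by (cases s) auto
    then show ?thesis using 1 by (simp add: Lp_norm_def s_def)
  next
    case (2 r)
    define s where "s = (\<integral>t. \<bar>f t\<bar> powr r \<partial>leb01)"
    have int: "integrable leb01 (\<lambda>t. \<bar>f t\<bar> powr r)" using space 2 by (simp add: Lp_space_def)
    have "ennreal s = (\<integral>\<^sup>+t. ennreal (\<bar>f t\<bar> powr r) \<partial>leb01)"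
      unfolding s_def by (rule nn_integral_eq_integral[OF int, symmetric]) simp
    also have "\<dots> \<le> 1" using f 2 by (simp add: Lnorm_le_def)
    finally have s1: "s \<le> 1" by simp
    have "0 \<le> s" unfolding s_def by (intro Bochner_Integration.integral_nonneg) simp
    then have "s powr (1 / r) \<le> 1" using s1 2 by (intro powr_le1) auto
    then show ?thesis using 2 by (simp add: Lp_norm_def s_def)
  qed
  with space show ?thesis by (simp add: unit_ball_def)
qed

text \<open>
Half of the bits are enough for \<open>n \<ge> 2\<close>. For \<open>n = 1\<close> a single centre is left, since
\<open>2 powr (1 / 2) < 2\<close>.
\<close>

lemma dyadic_card:
  assumes "1 \<le> n" "real m \<le> 2 powr (real n / 2)"
  shows "m \<le> 2 ^ (n - 1)"
proof (cases "n = 1")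
  case True
  have "2 powr (1 / 2) < (2::real) powr 1" by (intro powr_less_mono) auto
  then have "real m < 2" using assms True by simp
  then show ?thesis using True by simp
next
  case False
  then have "real n / 2 \<le> real (n - 1)" using assms by simp
  then have "2 powr (real n / 2) \<le> (2::real) powr real (n - 1)" by (intro powr_mono) auto
  also have "2 powr real (n - 1) = real (2 ^ (n - 1))" by (simp add: powr_realpow)
  finally have "real m \<le> real (2 ^ (n - 1))" using assms(2) by linarith
  then show ?thesis unfolding of_nat_le_iff .
qed

text \<open>
A covering may have fewer than \<open>2 ^ (n - 1)\<close> centres, in which case one centre is repeated.
\<close>

lemma entropy_le_of_cover:
  assumes p: "1 \<le> p" and q: "1 \<le> q" and n: "1 \<le> n" and e: "0 < e"
    and al: "\<alpha> \<in> borel_measurable leb01"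
    and cov: "entropy_cover (enn2real (1 / p)) (enn2real (1 / q)) (\<lambda>f t. rl (\<alpha> t) f t) (real n / 2) e"
  shows "RL_entropy p q \<alpha> n \<le> ereal e"
proof -
  let ?u = "enn2real (1 / p)" and ?v = "enn2real (1 / q)"
  let ?N = "Lp_norm leb01 q" and ?E = "Lp_space leb01 q"
  obtain Y where Y: "finite Y" "real (card Y) \<le> 2 powr (real n / 2)" "\<And>y. y \<in> Y \<Longrightarrow> Lnorm_finite ?v y"
    "\<And>f. Lnorm_le ?u f 1 \<Longrightarrow> \<exists>y\<in>Y. Lnorm_le ?v (\<lambda>t. rl (\<alpha> t) f t - y t) e"
    using cov unfolding entropy_cover_def by blast
  have "Lnorm_le ?u (\<lambda>t. 0) 1" by (rule Lnorm_le_const) auto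
  then obtain y0 where y0: "y0 \<in> Y" using Y(4) by blast
  have card: "card Y \<le> 2 ^ (n - 1)" by (rule dyadic_card[OF n Y(2)])
  obtain h where h: "bij_betw h {1..card Y} Y" using ex_bij_betw_nat_finite_1[OF Y(1)] by blast
  define y where "y j = (if j \<le> card Y then h j else y0)" for j
  have yY: "y j \<in> Y" if "j \<in> {1..2 ^ (n - 1)}" for j
    using that h y0 by (auto simp: y_def bij_betw_def)
  have cover: "RL_operator \<alpha> ` unit_ball (Lp_space leb01 p) (Lp_norm leb01 p)
      \<subseteq> (\<Union>j\<in>{1..2 ^ (n - 1)}. (\<lambda>g t. y j t + e * g t) ` unit_ball ?E ?N)"
  proof
    fix F assume "F \<in> RL_operator \<alpha> ` unit_ball (Lp_space leb01 p) (Lp_norm leb01 p)"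
    then obtain f where f: "f \<in> unit_ball (Lp_space leb01 p) (Lp_norm leb01 p)" "F = RL_operator \<alpha> f" by blast
    have fu: "Lnorm_le ?u f 1" by (rule unit_ball_imp_Lnorm_le[OF p f(1)])
    obtain z where z: "z \<in> Y" "Lnorm_le ?v (\<lambda>t. rl (\<alpha> t) f t - z t) e" using Y(4)[OF fu] by blast
    have "z \<in> h ` {1..card Y}" using z(1) unfolding bij_betw_imp_surj_on[OF h] .
    then obtain j where j: "z = h j" "j \<in> {1..card Y}" by (rule imageE)
    have jn: "j \<in> {1..2 ^ (n - 1)}" "y j = z" using j card by (auto simp: y_def)
    define g where "g t = 1 / e * (F t - z t)" for t
    have Fz: "Lnorm_le ?v (\<lambda>t. F t - z t) e"
    proof (rule Lnorm_le_cong_AE[OF z(2)])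
      have eq: "F t - z t = rl (\<alpha> t) f t - z t" if "t \<in> space leb01" for t
        using that by (simp add: f(2) RL_operator_eq_rl)
      show "(\<lambda>t. F t - z t) \<in> borel_measurable leb01"
        using Lnorm_le_measurable[OF z(2)] by (subst measurable_cong[OF eq])
      show "AE t in leb01. F t - z t = rl (\<alpha> t) f t - z t" using eq by (intro AE_I2)
    qed (use e in auto)
    have "Lnorm_le ?v g (1 / e * e)" unfolding g_def using Fz e by (intro Lnorm_le_scale) auto
    then have "Lnorm_le ?v g 1" using e by simp
    then have "g \<in> unit_ball ?E ?N" by (rule Lnorm_le_imp_unit_ball[OF q])
    moreover have "F = (\<lambda>t. y j t + e * g t)" using e by (auto simp: g_def jn(2))
    ultimately show "F \<in> (\<Union>j\<in>{1..2 ^ (n - 1)}. (\<lambda>g t. y j t + e * g t) ` unit_ball ?E ?N)" using jn(1) by blast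
  qed
  have "\<forall>j\<in>{1..2 ^ (n - 1)}. y j \<in> ?E" using yY Y(3) Lnorm_finite_imp_Lp_space[OF q] by blast
  with cover e show ?thesis
    unfolding RL_entropy_def entropy_number_def by (intro Inf_lower) blast
qed

lemma inf_order_le:
  assumes "admissible_order p q \<alpha>" "t \<in> {0..1}"
  shows "inf_order \<alpha> \<le> \<alpha> t"
  unfolding inf_order_def
  by (rule cINF_lower) (use assms in \<open>auto simp: admissible_order_def bdd_below_def\<close>)

text \<open>
For \<open>q \<le> p\<close> the larger of the two reciprocal exponents is used for the source, that is, the unit
ball of \<open>L\<^sub>p\<close> is replaced by the larger one of \<open>L\<^sub>q\<close>.
\<close>

lemma RL_entropy_uniform:
  assumes p: "1 \<le> p" and q: "1 < q" and a: "0 \<le> a"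
    and cond: "q \<le> p \<or> enn2real (1 / p) - enn2real (1 / q) < a"
  shows "\<exists>c>0. \<forall>\<alpha>. admissible_order p q \<alpha> \<and> a \<le> inf_order \<alpha> \<and> inf_order \<alpha> \<le> b \<longrightarrow>
     (\<forall>n::nat. n \<ge> 1 \<longrightarrow> RL_entropy p q \<alpha> n \<le> ereal (c * real n powr (- inf_order \<alpha>)))"
proof -
  define u where "u = enn2real (1 / p)"
  define v where "v = enn2real (1 / q)"
  have q1: "1 \<le> q" using q by simp
  have "u \<le> 1" using p by (cases p rule: exponent_cases) (auto simp: u_def)
  moreover have "0 \<le> u" unfolding u_def by simp
  ultimately have u: "0 \<le> u" "u \<le> 1" by auto
  have "v < 1"
    using q1
  proof (cases q rule: exponent_cases)
    case 1
    show ?thesis unfolding v_def 1(2) by simp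
  next
    case (2 r)
    have "ennreal 1 < ennreal r" using q unfolding 2(1) by simp
    then have "1 < r" by (simp only: ennreal_less_iff[OF zero_le_one])
    then show ?thesis unfolding v_def 2(5) by simp
  qed
  moreover have "0 \<le> v" unfolding v_def by simp
  ultimately have v: "0 \<le> v" "v < 1" by auto
  have uv: "u \<le> v \<or> u - v < a"
  proof (cases "q \<le> p")
    case True
    have "u \<le> v"
      using p
    proof (cases p rule: exponent_cases)
      case 1
      show ?thesis unfolding u_def v_def 1(2) by simp
    next
      case p: (2 r)
      from q1 show ?thesis
      proof (cases q rule: exponent_cases)
        case 1
        then show ?thesis using True p(4) by (simp add: top_unique)
      next
        case (2 r')
        then have "r' \<le> r" using True p(1,2) by simp
        then show ?thesis unfolding u_def v_def p(5) 2(5) using 2(2) by (intro frac_le) auto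
      qed
    qed
    then show ?thesis ..
  qed (use cond u_def v_def in auto)
  define w where "w = max u v"
  have w: "0 \<le> v" "v \<le> w" "w \<le> 1" "u \<le> w" using u v by (auto simp: w_def)
  have wv: "w = v \<or> w - v < a" using uv by (auto simp: w_def)
  obtain C where C: "0 < C" "\<And>b' x. 0 < b' \<Longrightarrow> a \<le> b' \<Longrightarrow> b' \<le> b \<Longrightarrow> 0 < x \<Longrightarrow> entropy_cover w v (rl b') x (C * x powr (- b'))"
    using uniform_cover_all[of b, unfolded uniform_cover_def, rule_format, OF w(1-3) a wv] by blast
  obtain A where A: "0 < A" "\<And>u \<alpha> \<alpha>0 x e. 0 \<le> u \<Longrightarrow> u \<le> 1 \<Longrightarrow> \<alpha> \<in> borel_measurable leb01 \<Longrightarrow> 0 < \<alpha>0 \<Longrightarrow>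
     (\<forall>t\<in>{0..1}. \<alpha>0 \<le> \<alpha> t) \<Longrightarrow> 0 < e \<Longrightarrow> entropy_cover u v (rl \<alpha>0) x e \<Longrightarrow>
     entropy_cover u v (\<lambda>f t. rl (\<alpha> t) f t) x (A * e)"
    using entropy_cover_variable_order[OF v] by blast
  have "RL_entropy p q \<alpha> n \<le> ereal (A * C * 2 powr b * real n powr (- inf_order \<alpha>))"
    if adm: "admissible_order p q \<alpha>" and ab: "a \<le> inf_order \<alpha>" "inf_order \<alpha> \<le> b" and n: "n \<ge> 1" for \<alpha> n
  proof -
    let ?i = "inf_order \<alpha>"
    let ?e = "C * (real n / 2) powr (- ?i)"
    have i: "0 < ?i" and al: "\<alpha> \<in> borel_measurable leb01" using adm by (auto simp: admissible_order_def)
    have e: "0 < ?e" using C(1) n by simp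
    have "entropy_cover w v (rl ?i) (real n / 2) ?e" using i ab n by (intro C) auto
    then have "entropy_cover u v (rl ?i) (real n / 2) ?e"
      unfolding entropy_cover_def using Lnorm_le_inclusion[OF _ u(1) w(4)] by (meson zero_less_one)
    then have "entropy_cover u v (\<lambda>f t. rl (\<alpha> t) f t) (real n / 2) (A * ?e)"
      using u al i e inf_order_le[OF adm] by (intro A) auto
    then have "RL_entropy p q \<alpha> n \<le> ereal (A * ?e)"
      unfolding u_def v_def using A(1) e by (intro entropy_le_of_cover p q1 n al) auto
    also have "A * ?e \<le> A * C * 2 powr b * real n powr (- ?i)"
    proof -
      have "(real n / 2) powr (- ?i) = 2 powr ?i * real n powr (- ?i)"
        using n by (simp add: powr_divide powr_minus field_simps)
      also have "\<dots> \<le> 2 powr b * real n powr (- ?i)" using ab by (intro mult_right_mono powr_mono) auto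
      finally have "A * C * (real n / 2) powr (- ?i) \<le> A * C * (2 powr b * real n powr (- ?i))"
        using A(1) C(1) by (intro mult_left_mono) auto
      then show ?thesis by (simp add: mult.assoc)
    qed
    finally show ?thesis by simp
  qed
  then show ?thesis using A(1) C(1) by (intro exI[of _ "A * C * 2 powr b"]) auto
qed

theorem proposition7p1:
  fixes p q :: ennreal
  assumes "1 \<le> p" and "1 < q"
  shows "(\<forall>\<alpha>. admissible_order p q \<alpha> \<longrightarrow>
            (\<exists>c::real. c > 0 \<and>
              (\<forall>n::nat. n \<ge> 1 \<longrightarrow>
                RL_entropy p q \<alpha> n \<le> ereal (c * real n powr (- inf_order \<alpha>))))) \<and>
         (q \<le> p \<longrightarrow>
            (\<forall>b::real. b > 0 \<longrightarrow>
              (\<exists>c::real. c > 0 \<and>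
                (\<forall>\<alpha>. admissible_order p q \<alpha> \<and> inf_order \<alpha> \<le> b \<longrightarrow>
                  (\<forall>n::nat. n \<ge> 1 \<longrightarrow>
                    RL_entropy p q \<alpha> n \<le> ereal (c * real n powr (- inf_order \<alpha>))))))) \<and>
         (p < q \<longrightarrow>
            (\<forall>a b::real. enn2real (1 / p) - enn2real (1 / q) < a \<and> a < b \<longrightarrow>
              (\<exists>c::real. c > 0 \<and>
                (\<forall>\<alpha>. admissible_order p q \<alpha> \<and> inf_order \<alpha> \<in> {a..b} \<longrightarrow>
                  (\<forall>n::nat. n \<ge> 1 \<longrightarrow>
                    RL_entropy p q \<alpha> n \<le> ereal (c * real n powr (- inf_order \<alpha>)))))))"
proof (intro conjI allI impI)
  fix \<alpha> assume adm: "admissible_order p q \<alpha>"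
  then have "0 \<le> inf_order \<alpha>" "enn2real (1 / p) - enn2real (1 / q) < inf_order \<alpha>"
    by (auto simp: admissible_order_def)
  from RL_entropy_uniform[OF assms this(1) disjI2[OF this(2)], of "inf_order \<alpha>"] adm
  show "\<exists>c::real. c > 0 \<and> (\<forall>n::nat. n \<ge> 1 \<longrightarrow> RL_entropy p q \<alpha> n \<le> ereal (c * real n powr (- inf_order \<alpha>)))"
    by blast
next
  fix b :: real assume "q \<le> p" "b > 0"
  from RL_entropy_uniform[OF assms order_refl disjI1[OF this(1)], of b]
  obtain c where "c > 0" "\<forall>\<alpha>. admissible_order p q \<alpha> \<and> 0 \<le> inf_order \<alpha> \<and> inf_order \<alpha> \<le> b \<longrightarrow>
     (\<forall>n::nat. n \<ge> 1 \<longrightarrow> RL_entropy p q \<alpha> n \<le> ereal (c * real n powr (- inf_order \<alpha>)))" by blast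
  moreover have "0 \<le> inf_order \<alpha>" if "admissible_order p q \<alpha>" for \<alpha>
    using that by (simp add: admissible_order_def)
  ultimately show "\<exists>c::real. c > 0 \<and> (\<forall>\<alpha>. admissible_order p q \<alpha> \<and> inf_order \<alpha> \<le> b \<longrightarrow>
     (\<forall>n::nat. n \<ge> 1 \<longrightarrow> RL_entropy p q \<alpha> n \<le> ereal (c * real n powr (- inf_order \<alpha>))))" by blast
next
  fix a b :: real
  assume "p < q" and ab: "enn2real (1 / p) - enn2real (1 / q) < a \<and> a < b"
  have "0 \<le> max a 0" "enn2real (1 / p) - enn2real (1 / q) < max a 0" using ab by auto
  from RL_entropy_uniform[OF assms this(1) disjI2[OF this(2)], of b]
  obtain c where "c > 0" "\<forall>\<alpha>. admissible_order p q \<alpha> \<and> max a 0 \<le> inf_order \<alpha> \<and> inf_order \<alpha> \<le> b \<longrightarrow>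
     (\<forall>n::nat. n \<ge> 1 \<longrightarrow> RL_entropy p q \<alpha> n \<le> ereal (c * real n powr (- inf_order \<alpha>)))" by blast
  moreover have "0 \<le> inf_order \<alpha>" if "admissible_order p q \<alpha>" for \<alpha>
    using that by (simp add: admissible_order_def)
  ultimately show "\<exists>c::real. c > 0 \<and> (\<forall>\<alpha>. admissible_order p q \<alpha> \<and> inf_order \<alpha> \<in> {a..b} \<longrightarrow>
     (\<forall>n::nat. n \<ge> 1 \<longrightarrow> RL_entropy p q \<alpha> n \<le> ereal (c * real n powr (- inf_order \<alpha>))))"
    by (intro exI[of _ c]) auto
qed

end
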